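(* Let $\mathcal{H}$ be a Hilbert space and let $\mathfrak{T}\subset B(\mathcal{H})$ be a unital $\mathrm{C}^*$-algebra containing the compact operators. Let $\mathcal{A}\subset\mathfrak{T}$ be a unital subalgebra such that the inclusion $\mathcal{A}\subset\mathfrak{T}$ has the Gleason--Whitney property relative to $B(\mathcal{H})$. Then $\mathfrak{T}$ admits a non-trivial Lebesgue projection $\mathfrak{z}$, and for any absolutely continuous character $\chi$ on $\mathcal{A}$, there is a non-trivial projection $p\in\mathcal{A}^{**}$ such that $p\le\mathfrak{z}$ and $p(\chi)=1$.
   Context: Write $\mathcal{W}=B(\mathcal{H})$; absolute continuity and Lebesgue projections are taken relative to $\mathcal{W}$. Subalgebras need not be self-adjoint; unital ones contain $I$. For a subspace $\mathcal{X}\subset\mathcal{W}$, a bounded linear functional on $\mathcal{X}$ is absolutely continuous relative to $\mathcal{W}$ if it extends to a weak-$*$ continuous linear functional on $\mathcal{W}$; $\mathrm{AC}_{\mathcal{W}}(\mathcal{X})\subset\mathcal{X}^*$ is the space of these. The inclusion $\mathcal{X}\subset\mathcal{Y}$ of subspaces of $\mathcal{W}$ has the Gleason--Whitney property relative to $\mathcal{W}$ if whenever $\phi\in\mathrm{AC}_{\mathcal{W}}(\mathcal{X})$ and $\psi\in\mathcal{Y}^*$ satisfies $\psi|_{\mathcal{X}}=\phi$ and $\|\psi\|=\|\phi\|$, then $\psi\in\mathrm{AC}_{\mathcal{W}}(\mathcal{Y})$. The bidual of an operator algebra is an operator algebra under the Arens product, and $\mathcal{A}^{**}$ is identified with the subalgebra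 $\mathcal{A}^{\perp\perp}$ of the von Neumann algebra $\mathfrak{T}^{**}$. $\mathfrak{T}^*$ is a $\mathfrak{T}^{**}$-module via $(\Lambda\cdot\phi)(a)=\Lambda(\phi a)$, where $(\phi a)(b)=\phi(ab)$. The Lebesgue projection of $\mathfrak{T}$ relative to $\mathcal{W}$ is the (necessarily unique) central projection $\mathfrak{z}\in\mathfrak{T}^{**}$ with $\mathrm{AC}_{\mathcal{W}}(\mathfrak{T})=\mathfrak{z}\mathfrak{T}^*$. A projection is non-trivial if it is neither $0$ nor $I$. A character is a unital multiplicative linear functional $\chi:\mathcal{A}\to\mathbb{C}$; $p(\chi)$ denotes the value of $p\in\mathcal{A}^{**}$ at $\chi\in\mathcal{A}^*$.
   Formalization: The Hilbert space H is assumed infinite-dimensional: for finite-dimensional H, containing the compact operators forces T = B(H), whose Lebesgue projection is I and hence trivial, so the claim as stated fails there. *)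

theory Defs
  imports "HOL-Analysis.Analysis" "HOL-Library.Function_Algebras"
begin

class scaleC =
  fixes scaleC :: "complex \<Rightarrow> 'a \<Rightarrow> 'a"  (infixr "*\<^sub>C" 75)

text \<open>The inner product is linear in the first and conjugate-linear in the second variable.\<close>

class complex_hilbert = banach + scaleC +
  fixes cinner :: "'a \<Rightarrow> 'a \<Rightarrow> complex"
  assumes scaleC_add_right: "c *\<^sub>C (x + y) = c *\<^sub>C x + c *\<^sub>C y"
    and scaleC_add_left: "(c + d) *\<^sub>C x = c *\<^sub>C x + d *\<^sub>C x"
    and scaleC_scaleC: "c *\<^sub>C d *\<^sub>C x = (c * d) *\<^sub>C x"
    and scaleC_of_real: "complex_of_real r *\<^sub>C x = r *\<^sub>R x"
    and cinner_commute: "cinner x y = cnj (cinner y x)"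
    and cinner_add_left: "cinner (x + y) z = cinner x z + cinner y z"
    and cinner_scaleC_left: "cinner (c *\<^sub>C x) y = c * cinner x y"
    and cinner_self: "cinner x x = complex_of_real ((norm x)\<^sup>2)"

instantiation complex :: scaleC
begin
definition scaleC_complex :: "complex \<Rightarrow> complex \<Rightarrow> complex"
  where "scaleC_complex c z = c * z"
instance ..
end

instantiation "fun" :: (type, scaleC) scaleC
begin
definition scaleC_fun :: "complex \<Rightarrow> ('a \<Rightarrow> 'b) \<Rightarrow> 'a \<Rightarrow> 'b"
  where "scaleC_fun c f = (\<lambda>x. c *\<^sub>C f x)"
instance ..
end

lemma norm_scaleC:
  fixes x :: "'a::complex_hilbert"
  shows "norm (c *\<^sub>C x) = cmod c * norm x"
proof -
  have "cinner (c *\<^sub>C x) (c *\<^sub>C x) = c * cnj c * cinner x x"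
    by (metis cinner_commute cinner_scaleC_left complex_cnj_mult mult.assoc mult.commute)
  then have "complex_of_real ((norm (c *\<^sub>C x))\<^sup>2) = complex_of_real ((cmod c * norm x)\<^sup>2)"
    by (simp add: cinner_self power_mult_distrib flip: complex_norm_square)
  then have "(norm (c *\<^sub>C x))\<^sup>2 = (cmod c * norm x)\<^sup>2"
    by (simp only: of_real_eq_iff)
  then show ?thesis
    by simp
qed

lemma bounded_linear_scaleC: "bounded_linear (\<lambda>x::'a::complex_hilbert. c *\<^sub>C x)"
proof (rule bounded_linear_intro)
  show "c *\<^sub>C (r *\<^sub>R x) = r *\<^sub>R (c *\<^sub>C x)" for r and x :: 'a
    by (simp add: scaleC_scaleC mult.commute flip: scaleC_of_real)
  show "norm (c *\<^sub>C x) \<le> norm x * cmod c" for x :: 'a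
    by (simp add: norm_scaleC mult.commute)
qed (rule scaleC_add_right)

instantiation blinfun :: (real_normed_vector, complex_hilbert) scaleC
begin
lift_definition scaleC_blinfun :: "complex \<Rightarrow> ('a \<Rightarrow>\<^sub>L 'b) \<Rightarrow> 'a \<Rightarrow>\<^sub>L 'b"
  is "\<lambda>c a x. c *\<^sub>C a x"
  by (rule bounded_linear_compose[OF bounded_linear_scaleC])
instance ..
end

text \<open>\<open>'h \<Rightarrow>\<^sub>L 'h\<close> consists of the real-linear bounded maps; \<open>B(H)\<close> is the set of complex-linear ones.\<close>

definition bounded_ops :: "('h::complex_hilbert \<Rightarrow>\<^sub>L 'h) set"
  where "bounded_ops = {a :: 'h \<Rightarrow>\<^sub>L 'h. \<forall>c x. a (c *\<^sub>C x) = c *\<^sub>C a x}"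

definition compact_ops :: "('h::complex_hilbert \<Rightarrow>\<^sub>L 'h) set"
  where "compact_ops = {a \<in> bounded_ops. compact (closure (blinfun_apply a ` cball 0 1))}"

definition adj :: "('h::complex_hilbert \<Rightarrow>\<^sub>L 'h) \<Rightarrow> 'h \<Rightarrow>\<^sub>L 'h"
  where "adj a = (THE b :: 'h \<Rightarrow>\<^sub>L 'h. \<forall>x y. cinner (b x) y = cinner x (a y))"

definition unital_subalgebra :: "('h::complex_hilbert \<Rightarrow>\<^sub>L 'h) set \<Rightarrow> bool"
  where "unital_subalgebra A \<longleftrightarrow> A \<subseteq> bounded_ops \<and> id_blinfun \<in> A \<and>
    (\<forall>a\<in>A. \<forall>b\<in>A. a + b \<in> A) \<and> (\<forall>c. \<forall>a\<in>A. c *\<^sub>C a \<in> A) \<and>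
    (\<forall>a\<in>A. \<forall>b\<in>A. a o\<^sub>L b \<in> A)"

definition unital_cstar_algebra :: "('h::complex_hilbert \<Rightarrow>\<^sub>L 'h) set \<Rightarrow> bool"
  where "unital_cstar_algebra T \<longleftrightarrow> unital_subalgebra T \<and> closed T \<and> (\<forall>a\<in>T. adj a \<in> T)"

text \<open>
  Functionals on a space with carrier \<open>X\<close> are total functions; elements of a dual space are
  normalised to vanish off \<open>X\<close>, so that two of them are equal iff they agree on \<open>X\<close>.
\<close>

definition restr :: "'a set \<Rightarrow> ('a \<Rightarrow> complex) \<Rightarrow> 'a \<Rightarrow> complex"
  where "restr X f = (\<lambda>x. if x \<in> X then f x else 0)"

definition linear_functional :: "'a::{plus,scaleC} set \<Rightarrow> ('a \<Rightarrow> complex) \<Rightarrow> bool"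
  where "linear_functional X f \<longleftrightarrow>
    (\<forall>x\<in>X. \<forall>y\<in>X. f (x + y) = f x + f y) \<and> (\<forall>c. \<forall>x\<in>X. f (c *\<^sub>C x) = c * f x)"

text \<open>The argument \<open>N\<close> is the norm of the space with carrier \<open>X\<close>.\<close>

definition dual_space :: "('a::{plus,scaleC} \<Rightarrow> real) \<Rightarrow> 'a set \<Rightarrow> ('a \<Rightarrow> complex) set"
  where "dual_space N X = {f. (\<forall>x. x \<notin> X \<longrightarrow> f x = 0) \<and> linear_functional X f \<and>
    (\<exists>C. \<forall>x\<in>X. cmod (f x) \<le> C * N x)}"

definition dual_norm :: "('a \<Rightarrow> real) \<Rightarrow> 'a set \<Rightarrow> ('a \<Rightarrow> complex) \<Rightarrow> real"
  where "dual_norm N X f = Sup {cmod (f x) |x. x \<in> X \<and> N x \<le> 1}"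

definition op_dual :: "('h::complex_hilbert \<Rightarrow>\<^sub>L 'h) set \<Rightarrow> (('h \<Rightarrow>\<^sub>L 'h) \<Rightarrow> complex) set"
  where "op_dual X = dual_space norm X"

type_synonym 'h bidual = "(('h \<Rightarrow>\<^sub>L 'h) \<Rightarrow> complex) \<Rightarrow> complex"

definition op_bidual :: "('h::complex_hilbert \<Rightarrow>\<^sub>L 'h) set \<Rightarrow> 'h bidual set"
  where "op_bidual X = dual_space (dual_norm norm X) (op_dual X)"

text \<open>
  The predual of \<open>B(H)\<close> is the space of trace class operators. Under the trace pairing these give
  exactly the functionals \<open>a \<mapsto> \<Sum>n. \<langle>a x\<^sub>n, y\<^sub>n\<rangle>\<close> with square-summable \<open>(x\<^sub>n)\<close> and \<open>(y\<^sub>n)\<close>.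
\<close>

definition predual_functionals :: "(('h::complex_hilbert \<Rightarrow>\<^sub>L 'h) \<Rightarrow> complex) set"
  where "predual_functionals = {\<lambda>a :: 'h \<Rightarrow>\<^sub>L 'h. \<Sum>n. cinner (a (x n)) (y n) |(x :: nat \<Rightarrow> 'h) y.
    summable (\<lambda>n. (norm (x n))\<^sup>2) \<and> summable (\<lambda>n. (norm (y n))\<^sup>2)}"

definition weak_star :: "('h::complex_hilbert \<Rightarrow>\<^sub>L 'h) topology"
  where "weak_star = topology_generated_by
    {{a \<in> bounded_ops. f a \<in> U} |f U. f \<in> predual_functionals \<and> open U}"

definition abs_cont ::
    "('h::complex_hilbert \<Rightarrow>\<^sub>L 'h) set \<Rightarrow> (('h \<Rightarrow>\<^sub>L 'h) \<Rightarrow> complex) set"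
  where "abs_cont X = {\<phi> \<in> op_dual X. \<exists>\<omega>. linear_functional bounded_ops \<omega> \<and>
    continuous_map weak_star euclidean \<omega> \<and> (\<forall>x\<in>X. \<omega> x = \<phi> x)}"

definition gleason_whitney ::
    "('h::complex_hilbert \<Rightarrow>\<^sub>L 'h) set \<Rightarrow> ('h \<Rightarrow>\<^sub>L 'h) set \<Rightarrow> bool"
  where "gleason_whitney X Y \<longleftrightarrow> (\<forall>\<phi>\<in>abs_cont X. \<forall>\<psi>\<in>op_dual Y.
    (\<forall>x\<in>X. \<psi> x = \<phi> x) \<and> dual_norm norm Y \<psi> = dual_norm norm X \<phi> \<longrightarrow> \<psi> \<in> abs_cont Y)"

definition character :: "('h::complex_hilbert \<Rightarrow>\<^sub>L 'h) set \<Rightarrow> (('h \<Rightarrow>\<^sub>L 'h) \<Rightarrow> complex) \<Rightarrow> bool"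
  where "character A \<kappa> \<longleftrightarrow> linear_functional A \<kappa> \<and> \<kappa> id_blinfun = 1 \<and>
    (\<forall>a\<in>A. \<forall>b\<in>A. \<kappa> (a o\<^sub>L b) = \<kappa> a * \<kappa> b)"

text \<open>The module action \<open>(\<Lambda> \<cdot> \<phi>)(a) = \<Lambda>(\<phi> a)\<close>, where \<open>(\<phi> a)(b) = \<phi>(a b)\<close>; the Arens product is
  \<open>(\<Lambda> \<Gamma>)(\<phi>) = \<Lambda>(\<Gamma> \<cdot> \<phi>)\<close>, which extends the product of \<open>T\<close>.\<close>

definition bidual_act :: "('h::complex_hilbert \<Rightarrow>\<^sub>L 'h) set \<Rightarrow> 'h bidual \<Rightarrow>
    (('h \<Rightarrow>\<^sub>L 'h) \<Rightarrow> complex) \<Rightarrow> ('h \<Rightarrow>\<^sub>L 'h) \<Rightarrow> complex"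
  where "bidual_act T \<Lambda> \<phi> = restr T (\<lambda>a. \<Lambda> (restr T (\<lambda>b. \<phi> (a o\<^sub>L b))))"

definition arens :: "('h::complex_hilbert \<Rightarrow>\<^sub>L 'h) set \<Rightarrow> 'h bidual \<Rightarrow> 'h bidual \<Rightarrow> 'h bidual"
  where "arens T \<Lambda> \<Gamma> = restr (op_dual T) (\<lambda>\<phi>. \<Lambda> (bidual_act T \<Gamma> \<phi>))"

text \<open>The involution is \<open>\<Lambda>\<^sup>*(\<phi>) = cnj (\<Lambda>(\<phi>\<^sup>*))\<close>, where \<open>\<phi>\<^sup>*(a) = cnj (\<phi>(a\<^sup>*))\<close>.\<close>

definition bidual_star :: "('h::complex_hilbert \<Rightarrow>\<^sub>L 'h) set \<Rightarrow> 'h bidual \<Rightarrow> 'h bidual"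
  where "bidual_star T \<Lambda> = restr (op_dual T) (\<lambda>\<phi>. cnj (\<Lambda> (restr T (\<lambda>a. cnj (\<phi> (adj a))))))"

definition bidual_one :: "('h::complex_hilbert \<Rightarrow>\<^sub>L 'h) set \<Rightarrow> 'h bidual"
  where "bidual_one T = restr (op_dual T) (\<lambda>\<phi>. \<phi> id_blinfun)"

text \<open>The operator order: the positive elements of the C*-algebra \<open>T\<^sup>*\<^sup>*\<close> are those of the form \<open>\<Theta>\<^sup>* \<Theta>\<close>.\<close>

definition bidual_le :: "('h::complex_hilbert \<Rightarrow>\<^sub>L 'h) set \<Rightarrow> 'h bidual \<Rightarrow> 'h bidual \<Rightarrow> bool"
  where "bidual_le T \<Lambda> \<Gamma> \<longleftrightarrow> (\<exists>\<Theta>\<in>op_bidual T. \<Gamma> - \<Lambda> = arens T (bidual_star T \<Theta>) \<Theta>)"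

definition projection :: "('h::complex_hilbert \<Rightarrow>\<^sub>L 'h) set \<Rightarrow> 'h bidual \<Rightarrow> bool"
  where "projection T p \<longleftrightarrow> p \<in> op_bidual T \<and> arens T p p = p \<and> bidual_star T p = p"

definition nontrivial_projection :: "('h::complex_hilbert \<Rightarrow>\<^sub>L 'h) set \<Rightarrow> 'h bidual \<Rightarrow> bool"
  where "nontrivial_projection T p \<longleftrightarrow> projection T p \<and> p \<noteq> 0 \<and> p \<noteq> bidual_one T"

definition lebesgue_projection :: "('h::complex_hilbert \<Rightarrow>\<^sub>L 'h) set \<Rightarrow> 'h bidual \<Rightarrow> bool"
  where "lebesgue_projection T z \<longleftrightarrow> projection T z \<and>
    (\<forall>\<Lambda>\<in>op_bidual T. arens T z \<Lambda> = arens T \<Lambda> z) \<and>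
    abs_cont T = bidual_act T z ` op_dual T"

text \<open>
  The second adjoint of the inclusion \<open>A \<subseteq> T\<close>. It is the canonical identification of \<open>A\<^sup>*\<^sup>*\<close> with
  the bi-annihilator of \<open>A\<close> in \<open>T\<^sup>*\<^sup>*\<close>.
\<close>

definition bidual_incl ::
    "('h::complex_hilbert \<Rightarrow>\<^sub>L 'h) set \<Rightarrow> ('h \<Rightarrow>\<^sub>L 'h) set \<Rightarrow> 'h bidual \<Rightarrow> 'h bidual"
  where "bidual_incl A T p = restr (op_dual T) (\<lambda>\<phi>. p (restr A \<phi>))"

end

theory Submission
  imports Defs
begin

text \<open>For an infinite-dimensional space \<open>H\<close>, let \<open>F\<close> be the ideal of finite rank operators, which lies in \<open>T\<close>. Each
  \<open>\<phi> \<in> T\<^sup>*\<close> agrees on \<open>F\<close> with a unique functional from the predual of \<open>B(H)\<close>, its normal part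
  (lemma \<open>ex_normal_part\<close>). To see this, \<open>\<phi>\<close> is written as a combination of four positive functionals
  by means of the Hahn-Banach theorem, and the restriction to \<open>F\<close> of a positive functional is exhausted
  by a greedy Cholesky decomposition (lemmas \<open>cholesky_step\<close> and \<open>positive_functional_normal_part\<close>).

  An operator \<open>R\<close> now acts on \<open>T\<^sup>*\<close> by evaluating normal parts at \<open>R\<close>. This embeds \<open>B(H)\<close> into
  \<open>T\<^sup>*\<^sup>*\<close> as a *-algebra (\<open>normal_element\<close>), and the image of the unit is the Lebesgue projection
  (lemma \<open>lebesgue_projection_normal_element\<close>). It is not the unit of \<open>T\<^sup>*\<^sup>*\<close>, as in infinite
  dimension there are functionals that vanish on \<open>F\<close> but not at the unit.

  Let \<open>\<kappa>\<close> be an absolutely continuous character of \<open>A\<close>. It is contractive, and by the Gleason-Whitney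
  property all its extensions of norm one to \<open>T\<close> are weak-* continuous; in particular none of them has
  mass at infinity. By duality, \<open>A\<close> contains for each \<open>\<epsilon> > 0\<close> an operator \<open>a\<close> with nonnegative real part
  which modulo \<open>F\<close> has real part at least one, although \<open>Re \<kappa>(a) < \<epsilon>\<close> (lemma \<open>accretive_peak\<close>).
  Then \<open>exp(-t a)\<close>, with \<open>t\<close> large and \<open>\<epsilon>\<close> much smaller than \<open>1 / t\<close>, is a contraction which is small
  modulo \<open>F\<close> and on which \<open>\<kappa>\<close> is almost one (lemma \<open>contractive_peak\<close>). A cluster point \<open>R\<close> of such
  contractions in the weak operator topology gives an element of \<open>A\<^sup>\<bottom>\<^sup>\<bottom>\<close> with value one at \<open>\<kappa>\<close>, and
  so do its powers (lemma \<open>ex_peaking_contraction\<close>). Their means cluster at an orthogonal projection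
  (lemmas \<open>mean_ergodic_projection\<close> and \<open>ex_peaking_projection\<close>), which yields the projection \<open>p\<close>.
  It lies below the Lebesgue projection by construction.\<close>

section \<open>Complex Hilbert spaces\<close>

lemma scaleC_one: "1 *\<^sub>C x = (x :: 'a::complex_hilbert)"
  using scaleC_of_real[of 1 x] by simp

lemma cinner_add_right: "cinner x (y + z) = cinner x y + cinner x (z :: 'a::complex_hilbert)"
  by (metis cinner_add_left cinner_commute complex_cnj_add)

lemma cinner_scaleC_right: "cinner x (c *\<^sub>C y) = cnj c * cinner x (y :: 'a::complex_hilbert)"
  by (metis cinner_commute cinner_scaleC_left complex_cnj_mult)

lemma cinner_scaleR_left: "cinner (r *\<^sub>R x) y = r *\<^sub>R cinner x (y :: 'a::complex_hilbert)"
  by (metis cinner_scaleC_left scaleC_of_real scaleR_conv_of_real)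

lemma cinner_scaleR_right: "cinner x (r *\<^sub>R y) = r *\<^sub>R cinner x (y :: 'a::complex_hilbert)"
  by (metis cinner_scaleC_right scaleC_of_real scaleR_conv_of_real complex_cnj_complex_of_real)

lemma norm_add_square:
  "(norm (x + y))\<^sup>2 = (norm x)\<^sup>2 + (norm y)\<^sup>2 + 2 * Re (cinner x (y :: 'a::complex_hilbert))"
proof -
  have "complex_of_real ((norm (x + y))\<^sup>2) = of_real ((norm x)\<^sup>2) + of_real ((norm y)\<^sup>2)
      + (cinner x y + cnj (cinner x y))"
    by (simp only: cinner_self[symmetric] cinner_commute[of y x, symmetric]
        cinner_add_left cinner_add_right ac_simps)
  also have "\<dots> = of_real ((norm x)\<^sup>2 + (norm y)\<^sup>2 + 2 * Re (cinner x y))"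
    by (simp only: complex_add_cnj of_real_add)
  finally show ?thesis
    by (simp only: of_real_eq_iff)
qed

lemma cinner_zero_left [simp]: "cinner 0 (y :: 'a::complex_hilbert) = 0"
  using cinner_add_left[of 0 0 y] by simp

lemma cinner_zero_right [simp]: "cinner (y :: 'a::complex_hilbert) 0 = 0"
  using cinner_add_right[of y 0 0] by simp

lemma cinner_cauchy_schwarz: "cmod (cinner x y) \<le> norm x * norm (y :: 'a::complex_hilbert)"
proof (cases "y = 0")
  case False
  let ?c = "cinner x y"
  let ?t = "- (?c / of_real ((norm y)\<^sup>2))"
  have pos: "(norm y)\<^sup>2 > 0" using False by simp
  have "0 \<le> (norm (x + ?t *\<^sub>C y))\<^sup>2" by simp
  also have "\<dots> = (norm x)\<^sup>2 + (cmod ?t * norm y)\<^sup>2 + 2 * Re (cnj ?t * ?c)"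
    by (simp only: norm_add_square norm_scaleC cinner_scaleC_right)
  also have "(cmod ?t * norm y)\<^sup>2 = (cmod ?c)\<^sup>2 / (norm y)\<^sup>2"
  proof -
    have "cmod ?t = cmod ?c / (norm y)\<^sup>2"
      by (simp add: norm_divide norm_power)
    then show ?thesis using pos by (simp add: field_simps power2_eq_square)
  qed
  also have "cnj ?t * ?c = of_real (- (cmod ?c)\<^sup>2 / (norm y)\<^sup>2)"
    by (simp add: complex_norm_square field_simps del: of_real_power)
  finally have "(cmod ?c)\<^sup>2 / (norm y)\<^sup>2 \<le> (norm x)\<^sup>2"
    by (simp del: of_real_power)
  then have "(cmod ?c)\<^sup>2 \<le> (norm x * norm y)\<^sup>2"
    using pos by (simp add: field_simps power_mult_distrib)
  then show ?thesis
    by (rule power2_le_imp_le) simp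
qed simp

interpretation cinner: bounded_bilinear "cinner :: 'a::complex_hilbert \<Rightarrow> 'a \<Rightarrow> complex"
proof
  show "\<exists>K. \<forall>(a :: 'a) b. cmod (cinner a b) \<le> norm a * norm b * K"
    by (intro exI[of _ 1] allI) (simp add: cinner_cauchy_schwarz)
qed (simp_all add: cinner_add_left cinner_add_right cinner_scaleR_left cinner_scaleR_right)

interpretation scaleC: bounded_bilinear "scaleC :: complex \<Rightarrow> 'a::complex_hilbert \<Rightarrow> 'a"
proof
  show "(a + a') *\<^sub>C b = a *\<^sub>C b + a' *\<^sub>C b" "a *\<^sub>C (b + b') = a *\<^sub>C b + a *\<^sub>C b'"
    for a a' and b b' :: 'a
    by (simp_all add: scaleC_add_left scaleC_add_right)
  show "(r *\<^sub>R a) *\<^sub>C b = r *\<^sub>R (a *\<^sub>C b)" "a *\<^sub>C (r *\<^sub>R b) = r *\<^sub>R (a *\<^sub>C b)"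
    for r a and b :: 'a
    by (simp_all add: scaleC_scaleC scaleR_conv_of_real mult.commute flip: scaleC_of_real)
  show "\<exists>K. \<forall>a (b :: 'a). norm (a *\<^sub>C b) \<le> norm a * norm b * K"
    by (intro exI[of _ 1]) (simp add: norm_scaleC)
qed

lemma Re_cinner_self: "Re (cinner x x) = (norm (x :: 'a::complex_hilbert))\<^sup>2"
  by (simp add: cinner_self)

lemma norm_diff_square:
  "(norm (x - y))\<^sup>2 = (norm x)\<^sup>2 + (norm y)\<^sup>2 - 2 * Re (cinner x (y :: 'a::complex_hilbert))"
  using norm_add_square[of x "- y"] by (simp add: cinner.minus_right)

lemma cinner_eqI:
  assumes "\<And>z. cinner x z = cinner y (z :: 'a::complex_hilbert)"
  shows "x = y"
proof -
  have "cinner (x - y) (x - y) = 0"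
    using assms by (simp add: cinner.diff_left)
  then show ?thesis by (simp add: cinner_self)
qed

text \<open>The Riesz vector of \<open>f\<close> minimises \<open>\<parallel>x\<parallel>\<^sup>2 - 2 Re (f x)\<close>; by the parallelogram law every
  minimising sequence is a Cauchy sequence, so that the minimum is attained.\<close>

lemma riesz:
  fixes f :: "'a::complex_hilbert \<Rightarrow> complex"
  assumes f: "bounded_linear f" and fC: "\<And>c x. f (c *\<^sub>C x) = c * f x"
  obtains u where "\<And>x. f x = cinner x u"
proof -
  interpret bounded_linear f by (rule f)
  obtain C where C: "\<And>x. cmod (f x) \<le> norm x * C" using bounded by blast
  define J where "J x = (norm x)\<^sup>2 - 2 * Re (f x)" for x
  have Jb: "J x \<ge> - C\<^sup>2" for x
  proof -
    have "Re (f x) \<le> norm x * C"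
      using C[of x] complex_Re_le_cmod[of "f x"] by linarith
    moreover have "0 \<le> (norm x - C)\<^sup>2" by simp
    ultimately show ?thesis unfolding J_def power2_diff by linarith
  qed
  define m where "m = Inf (range J)"
  have bdd: "bdd_below (range J)"
    using Jb by (intro bdd_belowI[of _ "- C\<^sup>2"]) blast
  have m: "m \<le> J x" for x
    unfolding m_def by (rule cInf_lower[OF _ bdd]) simp
  have "\<exists>x. J x < m + 1 / Suc n" for n
    using cInf_lessD[of "range J" "m + 1 / Suc n"] unfolding m_def by auto
  then obtain X where X: "\<And>n. J (X n) < m + 1 / Suc n" by metis
  have par: "(norm (x - y))\<^sup>2 \<le> 2 * (J x - m) + 2 * (J y - m)" for x y
  proof -
    have "4 * (norm ((1/2) *\<^sub>R (x + y)))\<^sup>2 = (norm (x + y))\<^sup>2"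
      by (simp add: power_divide)
    moreover have "Re (f ((1/2) *\<^sub>R (x + y))) = (Re (f x) + Re (f y)) / 2"
      by (simp only: scaleR add) simp
    ultimately have "4 * J ((1/2) *\<^sub>R (x + y)) = (norm (x + y))\<^sup>2 - 4 * Re (f x) - 4 * Re (f y)"
      unfolding J_def by simp
    moreover have "(norm (x - y))\<^sup>2 + (norm (x + y))\<^sup>2 = 2 * (norm x)\<^sup>2 + 2 * (norm y)\<^sup>2"
      by (simp add: norm_add_square norm_diff_square)
    ultimately show ?thesis
      using m[of "(1/2) *\<^sub>R (x + y)"] by (simp add: J_def)
  qed
  have "Cauchy X"
  proof (rule CauchyI)
    fix e :: real assume e: "e > 0"
    then have "e\<^sup>2 / 4 > 0" by simp
    then obtain N where N: "1 / Suc N < e\<^sup>2 / 4"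
      using nat_approx_posE by (metis inverse_eq_divide)
    have "norm (X i - X j) < e" if "i \<ge> N" "j \<ge> N" for i j
    proof -
      have "J (X k) - m < e\<^sup>2 / 4" if "k \<ge> N" for k
      proof -
        have "1 / real (Suc k) \<le> 1 / Suc N" using that by (simp add: field_simps)
        then show ?thesis using X[of k] N by linarith
      qed
      note this[OF that(1)] this[OF that(2)]
      then have "(norm (X i - X j))\<^sup>2 < e\<^sup>2"
        using par[of "X i" "X j"] by (auto simp: field_simps)
      then show ?thesis using e by (simp add: power2_less_imp_less)
    qed
    then show "\<exists>M. \<forall>i\<ge>M. \<forall>j\<ge>M. norm (X i - X j) < e" by blast
  qed
  then obtain u where u: "X \<longlonglongrightarrow> u"
    using Cauchy_convergent convergent_def by blast
  have "(\<lambda>n. J (X n)) \<longlonglongrightarrow> J u"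
    unfolding J_def by (intro tendsto_intros u tendsto)
  moreover have "(\<lambda>n. m + 1 / Suc n) \<longlonglongrightarrow> m + 0"
    by (intro tendsto_intros LIMSEQ_Suc[OF lim_1_over_n[where 'a = real]])
  ultimately have Ju: "J u \<le> m"
    using X LIMSEQ_le[of "\<lambda>n. J (X n)" "J u" "\<lambda>n. m + 1 / Suc n" m] by (auto intro: less_imp_le)
  have Re: "Re (f x) = Re (cinner x u)" for x
  proof -
    define d where "d = Re (cinner x u) - Re (f x)"
    have le: "0 \<le> t * (2 * d) + t\<^sup>2 * (norm x)\<^sup>2" for t
    proof -
      have "J (u + t *\<^sub>R x) = J u + t * (2 * d) + t\<^sup>2 * (norm x)\<^sup>2"
        using cinner_commute[of u x]
        by (simp add: J_def norm_add_square add scaleR cinner_scaleR_right d_def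
            power_mult_distrib algebra_simps)
      then show ?thesis using m[of "u + t *\<^sub>R x"] Ju by linarith
    qed
    show ?thesis
    proof (cases "norm x = 0")
      case False
      have "- (d / (norm x)\<^sup>2) * (2 * d) + (- (d / (norm x)\<^sup>2))\<^sup>2 * (norm x)\<^sup>2 = - (d\<^sup>2 / (norm x)\<^sup>2)"
        using False by (simp add: field_simps power2_eq_square)
      then have "d\<^sup>2 / (norm x)\<^sup>2 \<le> 0" using le[of "- (d / (norm x)\<^sup>2)"] by simp
      then show ?thesis using False by (simp add: d_def divide_le_0_iff)
    qed (simp add: zero)
  qed
  have "f x = cinner x u" for x
  proof (rule complex_eqI)
    have "Re (\<i> * f x) = Re (\<i> * cinner x u)"
      using Re[of "\<i> *\<^sub>C x"] by (simp only: fC cinner_scaleC_left)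
    then show "Im (f x) = Im (cinner x u)" by simp
  qed (rule Re)
  then show ?thesis by (rule that)
qed

section \<open>Bounded operators\<close>

lemma scaleC_blinfun_apply [simp]: "(c *\<^sub>C a) x = c *\<^sub>C a x"
  for a :: "'a::real_normed_vector \<Rightarrow>\<^sub>L 'b::complex_hilbert"
  by (simp add: scaleC_blinfun.rep_eq)

lemma norm_scaleC_blinfun: "norm (c *\<^sub>C a) = cmod c * norm a"
  for a :: "'a::real_normed_vector \<Rightarrow>\<^sub>L 'b::complex_hilbert"
proof (rule antisym)
  have *: "norm (c *\<^sub>C a) \<le> cmod c * norm a" for c and a :: "'a \<Rightarrow>\<^sub>L 'b"
    by (rule norm_blinfun_bound)
      (simp_all add: norm_scaleC norm_blinfun mult_left_mono mult.assoc)
  show "norm (c *\<^sub>C a) \<le> cmod c * norm a" by (rule *)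
  show "cmod c * norm a \<le> norm (c *\<^sub>C a)"
  proof (cases "c = 0")
    case False
    have "inverse c *\<^sub>C c *\<^sub>C a = a"
      using False by (intro blinfun_eqI) (simp add: scaleC_scaleC scaleC_one)
    then have "norm a \<le> cmod (inverse c) * norm (c *\<^sub>C a)"
      using *[of "inverse c" "c *\<^sub>C a"] by simp
    then show ?thesis using False by (simp add: norm_inverse norm_divide field_simps)
  qed simp
qed

lemma of_real_scaleC_blinfun: "complex_of_real r *\<^sub>C a = r *\<^sub>R a"
  for a :: "'a::real_normed_vector \<Rightarrow>\<^sub>L 'b::complex_hilbert"
  by (rule blinfun_eqI) (simp add: scaleC_of_real blinfun.scaleR_left)

lemma scaleC_scaleC_blinfun: "c *\<^sub>C d *\<^sub>C a = (c * d) *\<^sub>C a"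
  for a :: "'a::real_normed_vector \<Rightarrow>\<^sub>L 'b::complex_hilbert"
  by (rule blinfun_eqI) (simp add: scaleC_scaleC)

lemma bounded_opsD: "a \<in> bounded_ops \<Longrightarrow> blinfun_apply a (c *\<^sub>C x) = c *\<^sub>C blinfun_apply a x"
  by (simp add: bounded_ops_def)

lemma subspace_bounded_ops: "subspace bounded_ops"
  by (auto simp: subspace_def bounded_ops_def blinfun.add_left blinfun.scaleR_left scaleC.add_right
      scaleC.scaleR_right scaleC.zero_right)

lemma scaleC_in_bounded_ops: "a \<in> bounded_ops \<Longrightarrow> c *\<^sub>C a \<in> bounded_ops"
  by (simp add: bounded_ops_def scaleC_scaleC mult.commute)

lemma id_in_bounded_ops: "id_blinfun \<in> bounded_ops"
  by (simp add: bounded_ops_def)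

lemma compose_in_bounded_ops: "a \<in> bounded_ops \<Longrightarrow> b \<in> bounded_ops \<Longrightarrow> a o\<^sub>L b \<in> bounded_ops"
  by (simp add: bounded_ops_def)

lemma norm_id_blinfun_le: "norm (id_blinfun :: 'a::real_normed_vector \<Rightarrow>\<^sub>L 'a) \<le> 1"
  by (rule norm_blinfun_bound) simp_all

lemma operator_of_form:
  fixes B :: "'a::complex_hilbert \<Rightarrow> 'a \<Rightarrow> complex"
  assumes add1: "\<And>x x' y. B (x + x') y = B x y + B x' y"
    and add2: "\<And>x y y'. B x (y + y') = B x y + B x y'"
    and scale1: "\<And>c x y. B (c *\<^sub>C x) y = c * B x y"
    and scale2: "\<And>c x y. B x (c *\<^sub>C y) = cnj c * B x y"
    and bound: "\<And>x y. cmod (B x y) \<le> C * norm x * norm y"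
  obtains a :: "'a \<Rightarrow>\<^sub>L 'a" where "a \<in> bounded_ops" "\<And>x y. cinner (a x) y = B x y" "norm a \<le> max C 0"
proof -
  have "\<exists>u. \<forall>y. cnj (B x y) = cinner y u" for x
  proof -
    have "bounded_linear (\<lambda>y. cnj (B x y))"
    proof (rule bounded_linear_intro)
      show "cnj (B x (r *\<^sub>R y)) = r *\<^sub>R cnj (B x y)" for r y
        using scale2[of x "of_real r" y] by (simp add: scaleC_of_real scaleR_conv_of_real)
      show "norm (cnj (B x y)) \<le> norm y * (C * norm x)" for y
        using bound[of x y] by (simp add: mult.commute)
    qed (simp add: add2)
    then show ?thesis
      by (rule riesz) (auto simp: scale2)
  qed
  then obtain u where "\<And>x y. cnj (B x y) = cinner y (u x)" by metis
  then have u: "cinner (u x) y = B x y" for x y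
    by (metis cinner_commute complex_cnj_cnj)
  have uC: "u (c *\<^sub>C x) = c *\<^sub>C u x" for c x
    by (rule cinner_eqI) (simp add: u scale1 cinner_scaleC_left)
  have nu: "norm (u x) \<le> norm x * max C 0" for x
  proof (cases "u x = 0")
    case False
    have "(norm (u x))\<^sup>2 = cmod (B x (u x))"
      using arg_cong[OF u[of x "u x"], of cmod] by (simp add: cinner_self norm_power)
    also have "\<dots> \<le> max C 0 * norm x * norm (u x)"
      by (rule order_trans[OF bound]) (simp add: mult_right_mono)
    finally show ?thesis using False by (simp add: power2_eq_square mult.commute)
  qed simp
  have bl: "bounded_linear u"
  proof (rule bounded_linear_intro)
    show "u (x + y) = u x + u y" for x y
      by (rule cinner_eqI) (simp add: u add1 cinner_add_left)
    show "u (r *\<^sub>R x) = r *\<^sub>R u x" for r x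
      by (metis uC scaleC_of_real)
  qed (rule nu)
  show ?thesis
  proof
    show "Blinfun u \<in> bounded_ops"
      by (simp add: bounded_ops_def bounded_linear_Blinfun_apply[OF bl] uC)
    show "cinner (Blinfun u x) y = B x y" for x y
      by (simp add: bounded_linear_Blinfun_apply[OF bl] u)
    show "norm (Blinfun u) \<le> max C 0"
      by (rule norm_blinfun_bound) (simp_all add: bounded_linear_Blinfun_apply[OF bl] nu mult.commute)
  qed
qed

lemma
  fixes a :: "'a::complex_hilbert \<Rightarrow>\<^sub>L 'a"
  assumes a: "a \<in> bounded_ops"
  shows adj_in_bounded_ops: "adj a \<in> bounded_ops"
    and cinner_adj_left: "cinner (adj a x) y = cinner x (a y)"
proof -
  obtain b :: "'a \<Rightarrow>\<^sub>L 'a" where b: "b \<in> bounded_ops" "\<And>x y. cinner (b x) y = cinner x (a y)"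
  proof (rule operator_of_form[of "\<lambda>x y. cinner x (a y)" "norm a"])
    show "cmod (cinner x (a y)) \<le> norm a * norm x * norm y" for x y
      using mult_left_mono[OF norm_blinfun[of a y] norm_ge_zero[of x]] cinner_cauchy_schwarz[of x "a y"]
      by (simp add: algebra_simps)
  qed (simp_all add: cinner_add_left cinner_add_right cinner_scaleC_left cinner_scaleC_right
      blinfun.add_right bounded_opsD[OF a])
  have "adj a = b"
    unfolding adj_def
  proof (rule the_equality)
    show "\<forall>x y. cinner (b x) y = cinner x (a y)" using b by simp
    show "b' = b" if "\<forall>x y. cinner (b' x) y = cinner x (a y)" for b' :: "'a \<Rightarrow>\<^sub>L 'a"
      using that b by (intro blinfun_eqI cinner_eqI) simp
  qed
  then show "adj a \<in> bounded_ops" "cinner (adj a x) y = cinner x (a y)"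
    using b by simp_all
qed

lemma cinner_adj_right: "a \<in> bounded_ops \<Longrightarrow> cinner x (blinfun_apply (adj a) y) = cinner (blinfun_apply a x) y"
  by (metis cinner_adj_left cinner_commute)

lemma adj_eqI:
  fixes a b :: "'a::complex_hilbert \<Rightarrow>\<^sub>L 'a"
  assumes "a \<in> bounded_ops" and "\<And>x y. cinner (b x) y = cinner x (a y)"
  shows "adj a = b"
  using assms by (intro blinfun_eqI cinner_eqI) (simp add: cinner_adj_left)

lemma norm_adj_le: "norm (adj a) \<le> norm a" if a: "a \<in> bounded_ops"
proof (rule norm_blinfun_bound)
  show "norm (adj a x) \<le> norm a * norm x" for x
  proof (cases "adj a x = 0")
    case False
    have "(norm (adj a x))\<^sup>2 = cmod (cinner x (a (adj a x)))"
      using arg_cong[OF cinner_adj_left[OF a, of x "adj a x"], of cmod] by (simp add: cinner_self norm_power)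
    also have "\<dots> \<le> norm x * (norm a * norm (adj a x))"
      by (rule order_trans[OF cinner_cauchy_schwarz mult_left_mono[OF norm_blinfun]]) simp
    finally show ?thesis using False by (simp add: power2_eq_square mult.commute mult.left_commute)
  qed simp
qed simp

section \<open>The Hahn-Banach theorem\<close>

text \<open>By Zorn's lemma there is a minimal sublinear functional below \<open>p\<close>, and minimality forces it to be
  linear.\<close>

lemma sublinear_dominates_linear:
  fixes p :: "'v::real_vector \<Rightarrow> real"
  assumes p_add: "\<And>x y. p (x + y) \<le> p x + p y"
    and p_scale: "\<And>t x. t > 0 \<Longrightarrow> p (t *\<^sub>R x) \<le> t * p x"
  obtains f where "linear f" "\<And>x. f x \<le> p x"
proof -
  define sub :: "('v \<Rightarrow> real) \<Rightarrow> bool" where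
    "sub q \<longleftrightarrow> (\<forall>x y. q (x + y) \<le> q x + q y) \<and> (\<forall>t>0. \<forall>x. q (t *\<^sub>R x) \<le> t * q x)" for q
  have subD: "q (x + y) \<le> q x + q y" "t > 0 \<Longrightarrow> q (t *\<^sub>R x) \<le> t * q x" if "sub q" for q x y t
    using that by (auto simp: sub_def)
  have sub0: "q 0 = 0" if "sub q" for q
    using subD(1)[OF that, of 0 0] subD(2)[OF that, of "1/2" 0] by simp
  have sub_minus: "- q (- x) \<le> q x" if "sub q" for q x
    using subD(1)[OF that, of x "- x"] sub0[OF that] by simp
  have sub_scale: "q (t *\<^sub>R x) = t * q x" if "sub q" "t > 0" for q t x
  proof (rule antisym)
    have "q (inverse t *\<^sub>R t *\<^sub>R x) \<le> inverse t * q (t *\<^sub>R x)"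
      using that by (intro subD(2)) auto
    then show "t * q x \<le> q (t *\<^sub>R x)" using that by (simp add: field_simps)
  qed (use subD(2) that in blast)
  define S where "S = {q. sub q \<and> q \<le> p}"
  have "\<exists>m\<in>S. \<forall>q\<in>S. q \<le> m \<longrightarrow> q = m"
  proof (rule predicate_Zorn)
    show "partial_order_on S (relation_of (\<lambda>q r. r \<le> q) S)"
      by (rule partial_order_on_relation_ofI) auto
  next
    fix C assume C: "C \<in> Chains (relation_of (\<lambda>q r. r \<le> q) S)"
    then have CS: "C \<subseteq> S" and chain: "\<And>q r. q \<in> C \<Longrightarrow> r \<in> C \<Longrightarrow> q \<le> r \<or> r \<le> q"
      by (auto simp: Chains_def relation_of_def)
    show "\<exists>u\<in>S. \<forall>q\<in>C. u \<le> q"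
    proof (cases "C = {}")
      case True
      have "p \<in> S" using p_add p_scale by (simp add: S_def sub_def)
      with True show ?thesis by blast
    next
      case False
      have Csub: "sub q" "q x \<le> p x" if "q \<in> C" for q x
        using that CS by (auto simp: S_def le_fun_def)
      define u where "u x = (INF q\<in>C. q x)" for x
      have lower: "- p (- x) \<le> q x" if "q \<in> C" for q x
        using sub_minus[OF Csub(1)[OF that], of x] Csub(2)[OF that, of "- x"] by linarith
      have bdd: "bdd_below ((\<lambda>q. q x) ` C)" for x
        by (rule bdd_belowI[of _ "- p (- x)"]) (use lower in auto)
      have u_le: "u x \<le> q x" if "q \<in> C" for q x
        unfolding u_def by (rule cINF_lower[OF bdd that])
      have u_approx: "\<exists>q\<in>C. q x < u x + e" if "e > 0" for x e
        using cINF_less_iff[OF False bdd, of x "u x + e"] that unfolding u_def by auto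
      have "u (x + y) \<le> u x + u y" for x y
      proof (rule field_le_epsilon)
        fix e :: real assume "e > 0"
        then have "e / 2 > 0" by simp
        from u_approx[OF this, of x] u_approx[OF this, of y]
        obtain q r where qr: "q \<in> C" "q x < u x + e / 2" "r \<in> C" "r y < u y + e / 2"
          by blast
        then obtain s where s: "s \<in> C" "s \<le> q" "s \<le> r"
          using chain[of q r] by blast
        have "u (x + y) \<le> s x + s y"
          using u_le[OF s(1), of "x + y"] subD(1)[OF Csub(1)[OF s(1)], of x y] by linarith
        also have "\<dots> \<le> q x + r y"
          using s by (intro add_mono) (auto simp: le_fun_def)
        finally show "u (x + y) \<le> u x + u y + e" using qr by simp
      qed
      moreover have "u (t *\<^sub>R x) \<le> t * u x" if t: "t > 0" for t x
      proof -
        have "u (t *\<^sub>R x) / t \<le> u x"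
          unfolding u_def[of x]
        proof (rule cINF_greatest[OF False])
          fix q assume q: "q \<in> C"
          have "u (t *\<^sub>R x) \<le> t * q x"
            using u_le[OF q, of "t *\<^sub>R x"] subD(2)[OF Csub(1)[OF q] t, of x] by linarith
          then show "u (t *\<^sub>R x) / t \<le> q x" using t by (simp add: field_simps)
        qed
        then show ?thesis using t by (simp add: field_simps)
      qed
      ultimately have "sub u" by (simp add: sub_def)
      moreover have "u \<le> p"
        using False u_le Csub(2) by (metis le_funI order_trans equals0I)
      ultimately have "u \<in> S" by (simp add: S_def)
      then show ?thesis using u_le by (auto simp: le_fun_def)
    qed
  qed
  then obtain m where mS: "m \<in> S" and min: "\<And>q. q \<in> S \<Longrightarrow> q \<le> m \<Longrightarrow> q = m" by blast
  have m: "sub m" "m \<le> p" using mS by (auto simp: S_def)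
  \<comment> \<open>A minimal sublinear functional is additive: otherwise its infimum along the rays of
    direction \<open>y\<close> would be a smaller one.\<close>
  have super: "m x + m y \<le> m (x + y)" for x y
  proof -
    define G where "G x = (\<lambda>t. m (x + t *\<^sub>R y) - t * m y) ` {0..}" for x
    define n where "n x = Inf (G x)" for x
    have lower: "- m (- x) \<le> m (x + t *\<^sub>R y) - t * m y" if "t \<ge> 0" for x t
    proof -
      have "m (t *\<^sub>R y) = t * m y"
        using that sub_scale[OF m(1), of t y] sub0[OF m(1)] by (cases "t = 0") auto
      then show ?thesis
        using subD(1)[OF m(1), of "x + t *\<^sub>R y" "- x"] by simp
    qed
    have bdd: "bdd_below (G x)" for x
      by (rule bdd_belowI[of _ "- m (- x)"]) (use lower in \<open>auto simp: G_def\<close>)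
    have n_le: "n x \<le> m (x + t *\<^sub>R y) - t * m y" if "t \<ge> 0" for x t
      unfolding n_def by (rule cInf_lower[OF _ bdd]) (use that in \<open>auto simp: G_def\<close>)
    have n_approx: "\<exists>t\<ge>0. m (x + t *\<^sub>R y) - t * m y < n x + e" if "e > 0" for x e
    proof -
      have "Inf (G x) < n x + e" using that by (simp add: n_def)
      moreover have "G x \<noteq> {}" by (simp add: G_def)
      ultimately obtain g where "g \<in> G x" "g < n x + e" by (metis cInf_lessD)
      then show ?thesis by (auto simp: G_def)
    qed
    have "n (x1 + x2) \<le> n x1 + n x2" for x1 x2
    proof (rule field_le_epsilon)
      fix e :: real assume "e > 0"
      then have "e / 2 > 0" by simp
      from n_approx[OF this, of x1] n_approx[OF this, of x2]
      obtain t1 t2 where t: "t1 \<ge> 0" "m (x1 + t1 *\<^sub>R y) - t1 * m y < n x1 + e / 2"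
        "t2 \<ge> 0" "m (x2 + t2 *\<^sub>R y) - t2 * m y < n x2 + e / 2" by blast
      have "n (x1 + x2) \<le> m ((x1 + x2) + (t1 + t2) *\<^sub>R y) - (t1 + t2) * m y"
        using t by (intro n_le) simp
      also have "(x1 + x2) + (t1 + t2) *\<^sub>R y = (x1 + t1 *\<^sub>R y) + (x2 + t2 *\<^sub>R y)"
        by (simp add: algebra_simps)
      finally show "n (x1 + x2) \<le> n x1 + n x2 + e"
        using t subD(1)[OF m(1), of "x1 + t1 *\<^sub>R y" "x2 + t2 *\<^sub>R y"] by (simp add: distrib_right)
    qed
    moreover have "n (s *\<^sub>R x) \<le> s * n x" if s: "s > 0" for s x
    proof -
      have "n (s *\<^sub>R x) / s \<le> Inf (G x)"
      proof (rule cInf_greatest)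
        fix g assume "g \<in> G x"
        then obtain t where t: "t \<ge> 0" and g: "g = m (x + t *\<^sub>R y) - t * m y" by (auto simp: G_def)
        have "n (s *\<^sub>R x) \<le> m (s *\<^sub>R x + (s * t) *\<^sub>R y) - (s * t) * m y"
          using s t by (intro n_le) simp
        also have "s *\<^sub>R x + (s * t) *\<^sub>R y = s *\<^sub>R (x + t *\<^sub>R y)"
          by (simp add: algebra_simps)
        also have "m (s *\<^sub>R (x + t *\<^sub>R y)) = s * m (x + t *\<^sub>R y)" by (rule sub_scale[OF m(1) s])
        finally have "n (s *\<^sub>R x) \<le> s * g" by (simp add: g right_diff_distrib)
        then show "n (s *\<^sub>R x) / s \<le> g" using s by (simp add: field_simps)
      qed (simp add: G_def)
      then show ?thesis using s by (simp add: field_simps n_def)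
    qed
    ultimately have "sub n" by (simp add: sub_def)
    moreover have "n \<le> m"
      using n_le[of 0] by (simp add: le_fun_def)
    ultimately have "n = m"
      using m(2) by (intro min) (auto simp: S_def)
    then show ?thesis using n_le[of 1 x] by simp
  qed
  have add: "m (x + y) = m x + m y" for x y
    using super subD(1)[OF m(1)] by (rule antisym[rotated])
  have minus: "m (- x) = - m x" for x
    using add[of x "- x"] sub0[OF m(1)] by simp
  have "linear m"
  proof (rule linearI)
    show "m (t *\<^sub>R x) = t *\<^sub>R m x" for t x
    proof (cases t "0 :: real" rule: linorder_cases)
      case less
      then show ?thesis using sub_scale[OF m(1), of "- t" x] minus[of "t *\<^sub>R x"] by simp
    qed (simp_all add: sub_scale[OF m(1)] sub0[OF m(1)])
  qed (rule add)
  then show ?thesis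
    using that m(2) by (auto simp: le_fun_def)
qed

text \<open>All extension problems below are of this form: \<open>G\<close> lists the upper bounds that the
  functional has to respect. Prescribed values are pairs of opposite bounds.\<close>

lemma linear_respecting_bounds:
  fixes G :: "('v::real_vector \<times> real) set"
  assumes add: "\<And>v s w t. (v, s) \<in> G \<Longrightarrow> (w, t) \<in> G \<Longrightarrow> (v + w, s + t) \<in> G"
    and scale: "\<And>v s r. (v, s) \<in> G \<Longrightarrow> r > 0 \<Longrightarrow> (r *\<^sub>R v, r * s) \<in> G"
    and total: "\<And>v. \<exists>s. (v, s) \<in> G"
    and zero: "\<And>s. (0, s) \<in> G \<Longrightarrow> s \<ge> 0"
  obtains f where "linear f" "\<And>v s. (v, s) \<in> G \<Longrightarrow> f v \<le> s"
proof -
  define B where "B v = {s. (v, s) \<in> G}" for v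
  have ne: "B v \<noteq> {}" for v using total by (auto simp: B_def)
  have bdd: "bdd_below (B v)" for v
  proof -
    obtain s0 where "(- v, s0) \<in> G" using total by blast
    then have "- s0 \<le> s" if "s \<in> B v" for s
      using add[of v s "- v" s0] zero[of "s + s0"] that by (simp add: B_def)
    then show ?thesis by (rule bdd_belowI)
  qed
  define p where "p v = Inf (B v)" for v
  have le: "p v \<le> s" if "(v, s) \<in> G" for v s
    unfolding p_def by (rule cInf_lower[OF _ bdd]) (simp add: B_def that)
  have approx: "\<exists>s. (v, s) \<in> G \<and> s < p v + e" if "e > 0" for v e
  proof -
    have "Inf (B v) < p v + e" using that by (simp add: p_def)
    with ne obtain s where "s \<in> B v" "s < p v + e" by (metis cInf_lessD)
    then show ?thesis by (auto simp: B_def)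
  qed
  obtain f where f: "linear f" "\<And>v. f v \<le> p v"
  proof (rule sublinear_dominates_linear)
    show "p (v + w) \<le> p v + p w" for v w
    proof (rule field_le_epsilon)
      fix e :: real assume "e > 0"
      then have "e / 2 > 0" by simp
      from approx[OF this, of v] approx[OF this, of w]
      obtain s t where "(v, s) \<in> G" "s < p v + e / 2" "(w, t) \<in> G" "t < p w + e / 2" by blast
      then show "p (v + w) \<le> p v + p w + e"
        using le[OF add, of v s w t] by simp
    qed
    show "p (r *\<^sub>R v) \<le> r * p v" if r: "r > 0" for r v
    proof -
      have "p (r *\<^sub>R v) / r \<le> Inf (B v)"
      proof (rule cInf_greatest[OF ne])
        fix s assume "s \<in> B v"
        then have "p (r *\<^sub>R v) \<le> r * s" using scale r by (intro le) (simp add: B_def)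
        then show "p (r *\<^sub>R v) / r \<le> s" using r by (simp add: field_simps)
      qed
      then show ?thesis using r by (simp add: p_def field_simps)
    qed
  qed blast
  then show ?thesis using that le by (meson order_trans)
qed

section \<open>Finite rank operators\<close>

definition rank_one :: "'a::complex_hilbert \<Rightarrow> 'a \<Rightarrow> 'a \<Rightarrow>\<^sub>L 'a"
  where "rank_one x y = Blinfun (\<lambda>h. cinner h y *\<^sub>C x)"

definition finite_rank :: "('a::complex_hilbert \<Rightarrow>\<^sub>L 'a) set"
  where "finite_rank = span (range (\<lambda>(x, y). rank_one x y))"

lemma rank_one_apply [simp]: "blinfun_apply (rank_one x y) h = cinner h y *\<^sub>C x"
proof -
  have "bounded_linear (\<lambda>h. cinner h y *\<^sub>C x)"
    by (rule bounded_linear_compose[OF scaleC.bounded_linear_left cinner.bounded_linear_left])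
  then show ?thesis
    by (simp add: rank_one_def bounded_linear_Blinfun_apply)
qed

lemma rank_one_add_left: "rank_one (x + x') y = rank_one x y + rank_one x' y"
  by (rule blinfun_eqI) (simp add: blinfun.add_left scaleC_add_right)

lemma rank_one_add_right: "rank_one x (y + y') = rank_one x y + rank_one x y'"
  by (rule blinfun_eqI) (simp add: blinfun.add_left cinner_add_right scaleC_add_left)

lemma rank_one_scaleC_left: "rank_one (c *\<^sub>C x) y = c *\<^sub>C rank_one x y"
  by (rule blinfun_eqI) (simp add: scaleC_scaleC mult.commute)

lemma rank_one_scaleC_right: "rank_one x (c *\<^sub>C y) = cnj c *\<^sub>C rank_one x y"
  by (rule blinfun_eqI) (simp add: cinner_scaleC_right scaleC_scaleC)

lemma norm_rank_one_le: "norm (rank_one x y) \<le> norm x * norm y"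
proof (rule norm_blinfun_bound)
  show "norm (rank_one x y h) \<le> norm x * norm y * norm h" for h
    using mult_right_mono[OF cinner_cauchy_schwarz[of h y] norm_ge_zero[of x]]
    by (simp add: norm_scaleC algebra_simps)
qed simp

lemma subspace_finite_rank: "subspace finite_rank"
  by (simp add: finite_rank_def)

lemma rank_one_in_finite_rank: "rank_one x y \<in> finite_rank"
  unfolding finite_rank_def by (rule span_base) auto

lemma finite_rank_induct [consumes 1, case_names subspace rank_one]:
  assumes "k \<in> finite_rank" and "subspace {k. P k}" and "\<And>x y. P (rank_one x y)"
  shows "P k"
proof -
  have "finite_rank \<subseteq> {k. P k}"
    unfolding finite_rank_def using assms(2,3) by (intro span_minimal) auto
  then show ?thesis using assms(1) by blast
qed

lemma finite_rank_bounded: "k \<in> finite_rank \<Longrightarrow> k \<in> bounded_ops"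
proof (induction rule: finite_rank_induct)
  case subspace
  then show ?case by (simp add: subspace_bounded_ops)
qed (simp add: bounded_ops_def cinner_scaleC_left scaleC_scaleC)

lemma rank_one_bounded: "rank_one x y \<in> bounded_ops"
  by (rule finite_rank_bounded[OF rank_one_in_finite_rank])

lemma compose_linear [simp]:
  fixes a :: "'b::real_normed_vector \<Rightarrow>\<^sub>L 'c::real_normed_vector" and d :: "'a::real_normed_vector \<Rightarrow>\<^sub>L 'b"
  shows "a o\<^sub>L (d + d') = (a o\<^sub>L d) + (a o\<^sub>L d')" "(a + a') o\<^sub>L d = (a o\<^sub>L d) + (a' o\<^sub>L d)"
    "a o\<^sub>L (d - d') = (a o\<^sub>L d) - (a o\<^sub>L d')" "(a - a') o\<^sub>L d = (a o\<^sub>L d) - (a' o\<^sub>L d)"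
    "a o\<^sub>L (r *\<^sub>R d) = r *\<^sub>R (a o\<^sub>L d)" "(r *\<^sub>R a) o\<^sub>L d = r *\<^sub>R (a o\<^sub>L d)"
    "a o\<^sub>L 0 = 0" "0 o\<^sub>L d = 0" "a o\<^sub>L id_blinfun = a" "id_blinfun o\<^sub>L a = a"
  by (rule blinfun_eqI; simp add: blinfun.bilinear_simps)+

lemma compose_finite_rank:
  assumes a: "a \<in> bounded_ops" and k: "k \<in> finite_rank"
  shows "a o\<^sub>L k \<in> finite_rank"
  using k
proof (induction rule: finite_rank_induct)
  case subspace
  then show ?case
    using subspace_finite_rank by (auto simp: subspace_def)
next
  case (rank_one x y)
  have "a o\<^sub>L rank_one x y = rank_one (a x) y"
    by (rule blinfun_eqI) (simp add: bounded_opsD[OF a])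
  then show ?case by (simp add: rank_one_in_finite_rank)
qed

lemma finite_rank_compose:
  assumes a: "a \<in> bounded_ops" and k: "k \<in> finite_rank"
  shows "k o\<^sub>L a \<in> finite_rank"
  using k
proof (induction rule: finite_rank_induct)
  case subspace
  then show ?case
    using subspace_finite_rank by (auto simp: subspace_def)
next
  case (rank_one x y)
  have "rank_one x y o\<^sub>L a = rank_one x (adj a y)"
    by (rule blinfun_eqI) (simp add: cinner_adj_right[OF a])
  then show ?case by (simp add: rank_one_in_finite_rank)
qed

lemma scaleC_finite_rank:
  assumes "k \<in> finite_rank"
  shows "c *\<^sub>C k \<in> finite_rank"
proof -
  have "c *\<^sub>C k = (c *\<^sub>C id_blinfun) o\<^sub>L k"
    by (rule blinfun_eqI) simp
  then show ?thesis
    using assms by (simp add: compose_finite_rank scaleC_in_bounded_ops id_in_bounded_ops)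
qed

lemma compact_opsI:
  assumes "a \<in> bounded_ops" "compact K" "blinfun_apply a ` cball 0 1 \<subseteq> K"
  shows "a \<in> compact_ops"
proof -
  have "closure (blinfun_apply a ` cball 0 1) \<subseteq> K"
    using assms by (intro closure_minimal compact_imp_closed)
  then have "K \<inter> closure (blinfun_apply a ` cball 0 1) = closure (blinfun_apply a ` cball 0 1)" by blast
  then have "compact (closure (blinfun_apply a ` cball 0 1))"
    using compact_Int_closed[OF assms(2) closed_closure, of "blinfun_apply a ` cball 0 1"] by simp
  then show ?thesis using assms(1) by (simp add: compact_ops_def)
qed

lemma subspace_compact_ops: "subspace compact_ops"
proof (rule subspaceI)
  show "(0 :: 'a \<Rightarrow>\<^sub>L 'a) \<in> compact_ops"
    by (rule compact_opsI[of _ "{0}"]) (auto simp: subspace_0[OF subspace_bounded_ops])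
next
  fix a b :: "'a \<Rightarrow>\<^sub>L 'a" assume "a \<in> compact_ops" "b \<in> compact_ops"
  then have ab: "a \<in> bounded_ops" "b \<in> bounded_ops"
    and K: "compact (closure (blinfun_apply a ` cball 0 1))" "compact (closure (blinfun_apply b ` cball 0 1))"
    by (auto simp: compact_ops_def)
  show "a + b \<in> compact_ops"
  proof (rule compact_opsI[OF subspace_add[OF subspace_bounded_ops ab] compact_sums[OF K]], rule image_subsetI)
    fix x :: 'a assume x: "x \<in> cball 0 1"
    have "a x \<in> closure (blinfun_apply a ` cball 0 1)" "b x \<in> closure (blinfun_apply b ` cball 0 1)"
      by (rule subsetD[OF closure_subset imageI[OF x]])+
    then show "(a + b) x \<in> {y + z |y z. y \<in> closure (blinfun_apply a ` cball 0 1)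
        \<and> z \<in> closure (blinfun_apply b ` cball 0 1)}"
      unfolding blinfun.add_left by blast
  qed
next
  fix r and a :: "'a \<Rightarrow>\<^sub>L 'a" assume a: "a \<in> compact_ops"
  then have K: "compact (closure (blinfun_apply a ` cball 0 1))" by (simp add: compact_ops_def)
  show "r *\<^sub>R a \<in> compact_ops"
  proof (rule compact_opsI[OF _ compact_scaling[OF K, of r]])
    show "r *\<^sub>R a \<in> bounded_ops"
      using a by (intro subspace_scale[OF subspace_bounded_ops]) (simp add: compact_ops_def)
    show "blinfun_apply (r *\<^sub>R a) ` cball 0 1 \<subseteq> (*\<^sub>R) r ` closure (blinfun_apply a ` cball 0 1)"
      using closure_subset[of "blinfun_apply a ` cball 0 1"] by (auto simp: blinfun.scaleR_left)
  qed
qed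

lemma finite_rank_compact: "k \<in> finite_rank \<Longrightarrow> k \<in> compact_ops"
proof (induction rule: finite_rank_induct)
  case subspace
  then show ?case by (simp add: subspace_compact_ops)
next
  case (rank_one x y)
  have "compact ((\<lambda>c. c *\<^sub>C x) ` cball 0 (norm y))"
    by (intro compact_continuous_image compact_cball
        bounded_linear.continuous_on[OF scaleC.bounded_linear_left] continuous_on_id)
  moreover have "blinfun_apply (rank_one x y) ` cball 0 1 \<subseteq> (\<lambda>c. c *\<^sub>C x) ` cball 0 (norm y)"
  proof (rule image_subsetI)
    fix h :: 'a assume "h \<in> cball 0 1"
    then have "cmod (cinner h y) \<le> norm y"
      using cinner_cauchy_schwarz[of h y] mult_right_mono[of "norm h" 1 "norm y"] by simp
    then show "rank_one x y h \<in> (\<lambda>c. c *\<^sub>C x) ` cball 0 (norm y)" by auto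
  qed
  ultimately show ?case
    by (rule compact_opsI[OF rank_one_bounded])
qed

text \<open>An operator of finite rank vanishes on a subspace of finite codimension.\<close>

lemma finite_rank_kernel:
  assumes "k \<in> finite_rank"
  shows "\<exists>Y. finite Y \<and> (\<forall>h. (\<forall>y\<in>Y. cinner h y = 0) \<longrightarrow> blinfun_apply k h = 0)"
  using assms
proof (induction rule: finite_rank_induct)
  case subspace
  let ?P = "\<lambda>k Y. finite Y \<and> (\<forall>h. (\<forall>y\<in>Y. cinner h y = 0) \<longrightarrow> blinfun_apply k h = 0)"
  show ?case
  proof (rule subspaceI)
    show "0 \<in> {k. \<exists>Y. ?P k Y}" by (intro CollectI exI[of _ "{}"]) simp
    show "a + b \<in> {k. \<exists>Y. ?P k Y}" if "a \<in> {k. \<exists>Y. ?P k Y}" "b \<in> {k. \<exists>Y. ?P k Y}" for a b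
    proof -
      from that obtain Y Z where "?P a Y" "?P b Z" by (elim CollectE exE)
      then show ?thesis by (intro CollectI exI[of _ "Y \<union> Z"]) (simp add: blinfun.add_left)
    qed
  qed (auto simp: blinfun.scaleR_left)
next
  case (rank_one x y)
  show ?case by (intro exI[of _ "{y}"]) (simp add: scaleC.zero_left)
qed

text \<open>These are the complements of the orthogonal projections of finite rank. They shrink to zero
  strongly, so that they measure what happens far out in the space. The list \<open>es\<close>
  exhibits the projection as a sum of positive operators of rank one.\<close>

definition coprojection :: "('a::complex_hilbert \<Rightarrow>\<^sub>L 'a) \<Rightarrow> bool"
  where "coprojection Q \<longleftrightarrow> Q \<in> bounded_ops \<and> adj Q = Q \<and> Q o\<^sub>L Q = Q \<and>
    (\<exists>es. id_blinfun - Q = (\<Sum>e\<leftarrow>es. rank_one e e))"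

lemma coprojection_bounded: "coprojection Q \<Longrightarrow> Q \<in> bounded_ops"
  by (simp add: coprojection_def)

lemma cinner_coprojection:
  assumes "coprojection Q"
  shows "cinner (blinfun_apply Q x) y = cinner x (blinfun_apply Q y)"
  using assms cinner_adj_left[of Q x y] by (simp add: coprojection_def)

lemma coprojection_idem:
  assumes "coprojection Q"
  shows "blinfun_apply Q (blinfun_apply Q x) = blinfun_apply Q x"
  using assms blinfun_apply_blinfun_compose[of Q Q x] by (simp add: coprojection_def)

lemma cinner_coprojection_self:
  assumes "coprojection Q"
  shows "cinner (blinfun_apply Q x) x = of_real ((norm (blinfun_apply Q x))\<^sup>2)"
  using cinner_coprojection[OF assms, of "blinfun_apply Q x" x]
  by (simp only: coprojection_idem[OF assms] cinner_self)

lemma coprojection_complement_finite_rank: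
  assumes "coprojection Q"
  shows "id_blinfun - Q \<in> finite_rank"
proof -
  have "(\<Sum>e\<leftarrow>es. rank_one e e) \<in> finite_rank" for es :: "'a list"
    by (induction es)
      (simp_all add: subspace_0[OF subspace_finite_rank] subspace_add[OF subspace_finite_rank] rank_one_in_finite_rank)
  then show ?thesis
    using assms by (auto simp: coprojection_def)
qed

lemma coprojection_pythagoras:
  assumes "coprojection Q"
  shows "(norm x)\<^sup>2 = (norm (blinfun_apply Q x))\<^sup>2 + (norm (x - blinfun_apply Q x))\<^sup>2"
proof -
  have "Re (cinner x (Q x)) = (norm (Q x))\<^sup>2"
    using cinner_coprojection_self[OF assms, of x] cinner_coprojection[OF assms, of x x] by simp
  then show ?thesis by (simp add: norm_diff_square)
qed

lemma norm_coprojection_le: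
  assumes "coprojection Q"
  shows "norm Q \<le> 1" "norm (id_blinfun - Q) \<le> 1"
proof -
  have "(norm (Q x))\<^sup>2 \<le> (norm x)\<^sup>2" "(norm (x - Q x))\<^sup>2 \<le> (norm x)\<^sup>2" for x
    using coprojection_pythagoras[OF assms, of x] by simp_all
  then have "norm (Q x) \<le> norm x" "norm (x - Q x) \<le> norm x" for x
    by (auto intro: power2_le_imp_le)
  then show "norm Q \<le> 1" "norm (id_blinfun - Q) \<le> 1"
    by (auto intro!: norm_blinfun_bound simp: blinfun.diff_left)
qed

text \<open>Otherwise the unit would be a finite sum of operators of rank one. Dimension is counted over the
  reals, which is why the vectors \<open>\<i> e\<close> are added to the spanning set.\<close>

lemma coprojection_nonzero:
  fixes Q :: "'a::complex_hilbert \<Rightarrow>\<^sub>L 'a"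
  assumes Q: "coprojection Q" and inf_dim: "\<not> (\<exists>B :: 'a set. finite B \<and> span B = UNIV)"
  shows "Q \<noteq> 0"
proof
  assume "Q = 0"
  then obtain es :: "'a list" where es: "id_blinfun = (\<Sum>e\<leftarrow>es. rank_one e e)"
    using Q by (auto simp: coprojection_def)
  let ?B = "set es \<union> (\<lambda>e. \<i> *\<^sub>C e) ` set es"
  have scale: "c *\<^sub>C e \<in> span ?B" if "e \<in> set es" for c e
  proof -
    have "c *\<^sub>C e = (of_real (Re c) + of_real (Im c) * \<i>) *\<^sub>C e"
      using complex_eq[of c] by (simp add: mult.commute)
    also have "\<dots> = Re c *\<^sub>R e + Im c *\<^sub>R (\<i> *\<^sub>C e)"
      by (simp only: scaleC_add_left scaleC_scaleC[symmetric] scaleC_of_real)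
    also have "\<dots> \<in> span ?B" using that by (intro span_add span_scale span_base) auto
    finally show ?thesis .
  qed
  have "set fs \<subseteq> set es \<Longrightarrow> (\<Sum>e\<leftarrow>fs. rank_one e e) x \<in> span ?B" for fs x
    by (induction fs) (auto simp: blinfun.add_left span_zero intro!: span_add scale)
  from this[of es] have "x \<in> span ?B" for x by (simp flip: es)
  then show False using inf_dim by (metis List.finite_set UNIV_eq_I finite_Un finite_imageI)
qed

text \<open>This is Gram-Schmidt orthogonalisation.\<close>

lemma ex_coprojection:
  assumes "finite X"
  shows "\<exists>Q :: 'a::complex_hilbert \<Rightarrow>\<^sub>L 'a. coprojection Q \<and> (\<forall>x\<in>X. Q x = 0)"
  using assms
proof induction
  case empty
  have "coprojection (id_blinfun :: 'a \<Rightarrow>\<^sub>L 'a)"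
    unfolding coprojection_def
    by (intro conjI id_in_bounded_ops adj_eqI exI[of _ "[]"]) simp_all
  then show ?case by blast
next
  case (insert x X)
  then obtain Q :: "'a \<Rightarrow>\<^sub>L 'a" where Q: "coprojection Q" and QX: "\<forall>x\<in>X. Q x = 0" by blast
  show ?case
  proof (cases "Q x = 0")
    case True
    with Q QX show ?thesis by blast
  next
    case False
    define u where "u = (1 / norm (Q x)) *\<^sub>R Q x"
    have Qu: "Q u = u" by (simp add: u_def blinfun.scaleR_right coprojection_idem[OF Q])
    have uu: "cinner u u = 1" using False by (simp add: u_def cinner_self)
    have xu: "cinner x u = of_real (norm (Q x))"
    proof -
      have "cinner x u = cinner (Q x) u" by (simp add: cinner_coprojection[OF Q] Qu)
      also have "\<dots> = of_real (norm (Q x))"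
        using False by (simp add: u_def cinner.scaleR_right cinner_self scaleR_conv_of_real power2_eq_square)
      finally show ?thesis .
    qed
    let ?R = "Q - rank_one u u"
    have R: "?R \<in> bounded_ops"
      by (intro subspace_diff[OF subspace_bounded_ops] coprojection_bounded[OF Q] rank_one_bounded)
    have Qh: "cinner (Q h) u = cinner h u" for h by (simp add: cinner_coprojection[OF Q] Qu)
    have "coprojection ?R"
      unfolding coprojection_def
    proof (intro conjI R)
      show "adj ?R = ?R"
      proof (rule adj_eqI[OF R])
        show "cinner (?R h) k = cinner h (?R k)" for h k
          using cinner_commute[of k u]
          by (simp add: blinfun.diff_left cinner.diff_left cinner.diff_right
            cinner_coprojection[OF Q] cinner_scaleC_left cinner_scaleC_right)
      qed
      show "?R o\<^sub>L ?R = ?R"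
        by (rule blinfun_eqI) (simp add: blinfun.diff_left blinfun.diff_right cinner.diff_left
            coprojection_idem[OF Q] Qh bounded_opsD[OF coprojection_bounded[OF Q]] Qu uu cinner_scaleC_left)
      obtain es where "id_blinfun - Q = (\<Sum>e\<leftarrow>es. rank_one e e)"
        using Q by (auto simp: coprojection_def)
      then show "\<exists>es. id_blinfun - ?R = (\<Sum>e\<leftarrow>es. rank_one e e)"
        by (intro exI[of _ "u # es"]) (simp add: algebra_simps)
    qed
    moreover have "?R x = 0"
    proof -
      have "?R x = Q x - norm (Q x) *\<^sub>R u" by (simp add: blinfun.diff_left xu scaleC_of_real)
      then show ?thesis using False by (simp add: u_def)
    qed
    moreover have "?R y = 0" if "y \<in> X" for y
    proof -
      have "Q y = 0" using QX that by blast
      then show ?thesis using Qh[of y] by (simp add: blinfun.diff_left scaleC.zero_left)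
    qed
    ultimately show ?thesis by blast
  qed
qed

section \<open>The predual of B(H)\<close>

lemma summable_mult_of_squares:
  fixes x :: "nat \<Rightarrow> 'a::real_normed_vector" and y :: "nat \<Rightarrow> 'b::real_normed_vector"
  assumes "summable (\<lambda>n. (norm (x n))\<^sup>2)" "summable (\<lambda>n. (norm (y n))\<^sup>2)"
  shows "summable (\<lambda>n. norm (x n) * norm (y n))"
proof (rule summable_comparison_test'[OF summable_add[OF assms]])
  show "norm (norm (x n) * norm (y n)) \<le> (norm (x n))\<^sup>2 + (norm (y n))\<^sup>2" for n
  proof -
    have "0 \<le> (norm (x n) - norm (y n))\<^sup>2" by simp
    moreover have "0 \<le> norm (x n) * norm (y n)" by simp
    ultimately have "norm (x n) * norm (y n) \<le> (norm (x n))\<^sup>2 + (norm (y n))\<^sup>2"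
      unfolding power2_diff mult.assoc by linarith
    then show ?thesis by (simp add: abs_mult)
  qed
qed

lemma cinner_operator_bound:
  "cmod (cinner (blinfun_apply a x) y) \<le> norm a * (norm x * norm (y :: 'h::complex_hilbert))"
  using mult_right_mono[OF norm_blinfun[of a x] norm_ge_zero[of y]] cinner_cauchy_schwarz[of "a x" y]
  by (simp add: mult.assoc)

lemma predual_functional_summable:
  fixes x y :: "nat \<Rightarrow> 'h::complex_hilbert"
  assumes "summable (\<lambda>n. (norm (x n))\<^sup>2)" "summable (\<lambda>n. (norm (y n))\<^sup>2)"
  shows "summable (\<lambda>n. cinner (blinfun_apply a (x n)) (y n))"
  by (rule summable_comparison_test'[OF summable_mult[OF summable_mult_of_squares[OF assms], of "norm a"]])
    (rule cinner_operator_bound)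

lemma predualE:
  fixes \<omega> :: "('h::complex_hilbert \<Rightarrow>\<^sub>L 'h) \<Rightarrow> complex"
  assumes "\<omega> \<in> predual_functionals"
  obtains x y where "summable (\<lambda>n. (norm (x n))\<^sup>2)" "summable (\<lambda>n. (norm (y n))\<^sup>2)"
    "\<And>a. \<omega> a = (\<Sum>n. cinner (blinfun_apply a (x n)) (y n))"
  using assms unfolding predual_functionals_def by blast

lemma predualI:
  fixes \<omega> :: "('h::complex_hilbert \<Rightarrow>\<^sub>L 'h) \<Rightarrow> complex"
  assumes "summable (\<lambda>n. (norm (x n))\<^sup>2)" "summable (\<lambda>n. (norm (y n))\<^sup>2)"
    and "\<And>a. \<omega> a = (\<Sum>n. cinner (blinfun_apply a (x n)) (y n))"
  shows "\<omega> \<in> predual_functionals"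
  using assms unfolding predual_functionals_def by blast

lemma
  fixes \<omega> :: "('h::complex_hilbert \<Rightarrow>\<^sub>L 'h) \<Rightarrow> complex"
  assumes \<omega>: "\<omega> \<in> predual_functionals"
  shows predual_add: "\<omega> (a + b) = \<omega> a + \<omega> b"
    and predual_scaleC: "\<omega> (c *\<^sub>C a) = c * \<omega> a"
    and predual_bounded: "\<exists>C\<ge>0. \<forall>a. cmod (\<omega> a) \<le> C * norm a"
proof -
  obtain x y where xy: "summable (\<lambda>n. (norm (x n))\<^sup>2)" "summable (\<lambda>n. (norm (y n))\<^sup>2)"
    and eq: "\<And>a. \<omega> a = (\<Sum>n. cinner (blinfun_apply a (x n)) (y n))"
    using \<omega> by (rule predualE) blast
  note summ = predual_functional_summable[OF xy]
  show "\<omega> (a + b) = \<omega> a + \<omega> b"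
    by (simp add: eq blinfun.add_left cinner_add_left suminf_add[OF summ summ])
  show "\<omega> (c *\<^sub>C a) = c * \<omega> a"
    by (simp add: eq cinner_scaleC_left suminf_mult[OF summ])
  have "cmod (\<omega> a) \<le> (\<Sum>n. norm (x n) * norm (y n)) * norm a" for a
  proof -
    have "cmod (\<omega> a) \<le> (\<Sum>n. norm a * (norm (x n) * norm (y n)))"
      unfolding eq by (rule norm_suminf_le[OF cinner_operator_bound
            summable_mult[OF summable_mult_of_squares[OF xy]]])
    then show ?thesis
      by (simp add: suminf_mult[OF summable_mult_of_squares[OF xy]] mult.commute)
  qed
  moreover have "(\<Sum>n. norm (x n) * norm (y n)) \<ge> 0"
    by (rule suminf_nonneg[OF summable_mult_of_squares[OF xy]]) simp
  ultimately show "\<exists>C\<ge>0. \<forall>a. cmod (\<omega> a) \<le> C * norm a" by blast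
qed

lemma predual_scaleR: "\<omega> \<in> predual_functionals \<Longrightarrow> \<omega> (r *\<^sub>R a) = r *\<^sub>R \<omega> a"
  by (simp add: predual_scaleC scaleR_conv_of_real flip: of_real_scaleC_blinfun)

lemma predual_zero: "\<omega> \<in> predual_functionals \<Longrightarrow> \<omega> 0 = 0"
  using predual_scaleR[of \<omega> 0 0] by simp

lemma predual_diff: "\<omega> \<in> predual_functionals \<Longrightarrow> \<omega> (a - b) = \<omega> a - \<omega> b"
  using predual_add[of \<omega> "a - b" b] by simp

lemma zero_in_predual: "(\<lambda>a. 0) \<in> (predual_functionals :: (('h::complex_hilbert \<Rightarrow>\<^sub>L 'h) \<Rightarrow> complex) set)"
  by (rule predualI[of "\<lambda>n. 0" "\<lambda>n. 0"]) simp_all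

lemma vector_functional_in_predual:
  "(\<lambda>a. cinner (blinfun_apply a x) y) \<in> predual_functionals"
proof (rule predualI)
  let ?x = "\<lambda>n :: nat. if n = 0 then x else 0" and ?y = "\<lambda>n :: nat. if n = 0 then y else 0"
  have "summable (\<lambda>n. (norm (?x n))\<^sup>2)" "summable (\<lambda>n. (norm (?y n))\<^sup>2)"
    by (rule summable_finite[of "{0}"]; simp)+
  then show "summable (\<lambda>n. (norm (?x n))\<^sup>2)" "summable (\<lambda>n. (norm (?y n))\<^sup>2)" .
  show "cinner (blinfun_apply a x) y = (\<Sum>n. cinner (blinfun_apply a (?x n)) (?y n))" for a
    by (subst suminf_finite[of "{0}"]) simp_all
qed

lemma scaleC_in_predual:
  assumes "\<omega> \<in> predual_functionals"
  shows "(\<lambda>a. c * \<omega> a) \<in> predual_functionals"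
proof -
  obtain x y where xy: "summable (\<lambda>n. (norm (x n))\<^sup>2)" "summable (\<lambda>n. (norm (y n))\<^sup>2)"
    and eq: "\<And>a. \<omega> a = (\<Sum>n. cinner (blinfun_apply a (x n)) (y n))"
    using assms by (rule predualE) blast
  show ?thesis
  proof (rule predualI[OF xy(1)])
    show "summable (\<lambda>n. (norm (cnj c *\<^sub>C y n))\<^sup>2)"
      using summable_mult[OF xy(2), of "(cmod c)\<^sup>2"] by (simp add: norm_scaleC power_mult_distrib)
    show "c * \<omega> a = (\<Sum>n. cinner (blinfun_apply a (x n)) (cnj c *\<^sub>C y n))" for a
      by (simp add: eq cinner_scaleC_right suminf_mult[OF predual_functional_summable[OF xy]])
  qed
qed

text \<open>The sequences of two functionals are interleaved to give those of their sum.\<close>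

lemma add_in_predual:
  fixes \<omega> \<omega>' :: "('h::complex_hilbert \<Rightarrow>\<^sub>L 'h) \<Rightarrow> complex"
  assumes "\<omega> \<in> predual_functionals" "\<omega>' \<in> predual_functionals"
  shows "(\<lambda>a. \<omega> a + \<omega>' a) \<in> predual_functionals"
proof -
  obtain x y where xy: "summable (\<lambda>n. (norm (x n))\<^sup>2)" "summable (\<lambda>n. (norm (y n))\<^sup>2)"
    and eq: "\<And>a. \<omega> a = (\<Sum>n. cinner (blinfun_apply a (x n)) (y n))"
    using assms(1) by (rule predualE) blast
  obtain x' y' where xy': "summable (\<lambda>n. (norm (x' n))\<^sup>2)" "summable (\<lambda>n. (norm (y' n))\<^sup>2)"
    and eq': "\<And>a. \<omega>' a = (\<Sum>n. cinner (blinfun_apply a (x' n)) (y' n))"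
    using assms(2) by (rule predualE) blast
  define J where "J u v n = (if even n then v (n div 2) else u ((n - 1) div 2))" for u v :: "nat \<Rightarrow> 'h" and n :: nat
  have J_norm: "(norm (J u v n))\<^sup>2 = (if even n then (norm (v (n div 2)))\<^sup>2 else (norm (u ((n - 1) div 2)))\<^sup>2)"
    for u v n by (simp add: J_def)
  have J_cinner: "Re (cinner (blinfun_apply a (J u v n)) (J u' v' n)) =
      (if even n then Re (cinner (a (v (n div 2))) (v' (n div 2)))
       else Re (cinner (a (u ((n - 1) div 2))) (u' ((n - 1) div 2))))"
    "Im (cinner (blinfun_apply a (J u v n)) (J u' v' n)) =
      (if even n then Im (cinner (a (v (n div 2))) (v' (n div 2)))
       else Im (cinner (a (u ((n - 1) div 2))) (u' ((n - 1) div 2))))"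
    for a :: "'h \<Rightarrow>\<^sub>L 'h" and u v u' v' n by (simp_all add: J_def)
  have sqsum: "summable (\<lambda>n. (norm (J u v n))\<^sup>2)"
    if "summable (\<lambda>n. (norm (u n))\<^sup>2)" "summable (\<lambda>n. (norm (v n))\<^sup>2)" for u v
    using sums_summable[OF sums_if[OF summable_sums[OF that(1)] summable_sums[OF that(2)]]]
    by (simp only: J_norm)
  show ?thesis
  proof (rule predualI[OF sqsum[OF xy(1) xy'(1)] sqsum[OF xy(2) xy'(2)]])
    fix a :: "'h \<Rightarrow>\<^sub>L 'h"
    have "(\<lambda>n. cinner (a (x n)) (y n)) sums \<omega> a" "(\<lambda>n. cinner (a (x' n)) (y' n)) sums \<omega>' a"
      unfolding eq eq' by (intro summable_sums predual_functional_summable xy xy')+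
    then have "(\<lambda>n. cinner (a (J x x' n)) (J y y' n)) sums (\<omega> a + \<omega>' a)"
      unfolding sums_complex_iff J_cinner plus_complex.sel by (intro conjI sums_if) auto
    then show "\<omega> a + \<omega>' a = (\<Sum>n. cinner (a (J x x' n)) (J y y' n))"
      by (rule sums_unique)
  qed
qed

lemma diff_in_predual:
  assumes "\<omega> \<in> predual_functionals" "\<omega>' \<in> predual_functionals"
  shows "(\<lambda>a. \<omega> a - \<omega>' a) \<in> predual_functionals"
  using add_in_predual[OF assms(1) scaleC_in_predual[OF assms(2), of "- 1"]] by simp

lemma compose_in_predual:
  fixes S R :: "'h::complex_hilbert \<Rightarrow>\<^sub>L 'h"
  assumes "\<omega> \<in> predual_functionals" and S: "S \<in> bounded_ops"
  shows "(\<lambda>a. \<omega> (S o\<^sub>L a o\<^sub>L R)) \<in> predual_functionals"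
proof -
  obtain x y where xy: "summable (\<lambda>n. (norm (x n))\<^sup>2)" "summable (\<lambda>n. (norm (y n))\<^sup>2)"
    and eq: "\<And>a. \<omega> a = (\<Sum>n. cinner (blinfun_apply a (x n)) (y n))"
    using assms(1) by (rule predualE) blast
  have sq: "summable (\<lambda>n. (norm (blinfun_apply R (x n)))\<^sup>2)" if "summable (\<lambda>n. (norm (x n))\<^sup>2)"
    for R :: "'h \<Rightarrow>\<^sub>L 'h" and x :: "nat \<Rightarrow> 'h"
  proof (rule summable_comparison_test'[OF summable_mult[OF that, of "(norm R)\<^sup>2"]])
    show "norm ((norm (R (x n)))\<^sup>2) \<le> (norm R)\<^sup>2 * (norm (x n))\<^sup>2" for n
      using power_mono[OF norm_blinfun[of R "x n"], of 2] by (simp add: power_mult_distrib)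
  qed
  show ?thesis
    by (rule predualI[OF sq[OF xy(1)] sq[OF xy(2)], of _ R "adj S"])
      (simp add: eq cinner_adj_right[OF S])
qed

lemma adj_in_predual:
  fixes \<omega> :: "('h::complex_hilbert \<Rightarrow>\<^sub>L 'h) \<Rightarrow> complex"
  assumes "\<omega> \<in> predual_functionals"
  shows "\<exists>\<omega>'\<in>predual_functionals. \<forall>a\<in>bounded_ops. \<omega>' a = cnj (\<omega> (adj a))"
proof -
  obtain x y where xy: "summable (\<lambda>n. (norm (x n))\<^sup>2)" "summable (\<lambda>n. (norm (y n))\<^sup>2)"
    and eq: "\<And>a. \<omega> a = (\<Sum>n. cinner (blinfun_apply a (x n)) (y n))"
    using assms by (rule predualE) blast
  let ?\<omega> = "\<lambda>a. \<Sum>n. cinner (blinfun_apply a (y n)) (x n)"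
  have "?\<omega> a = cnj (\<omega> (adj a))" if a: "a \<in> bounded_ops" for a
  proof -
    have "(\<lambda>n. cinner (adj a (x n)) (y n)) sums \<omega> (adj a)"
      unfolding eq by (rule summable_sums[OF predual_functional_summable[OF xy]])
    then have "(\<lambda>n. cnj (cinner (adj a (x n)) (y n))) sums cnj (\<omega> (adj a))"
      by (simp only: sums_cnj)
    moreover have "cnj (cinner (adj a (x n)) (y n)) = cinner (a (y n)) (x n)" for n
      by (simp only: cinner_adj_left[OF a] cinner_commute[of "a (y n)" "x n"])
    ultimately have "(\<lambda>n. cinner (a (y n)) (x n)) sums cnj (\<omega> (adj a))"
      by (simp only:)
    then show ?thesis by (rule sums_unique[symmetric])
  qed
  moreover have "?\<omega> \<in> predual_functionals"
    by (rule predualI[OF xy(2,1)]) simp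
  ultimately show ?thesis by (intro bexI[of _ ?\<omega>] ballI)
qed

text \<open>All but a small tail of the series is annihilated once \<open>Q\<close> vanishes on the first few vectors of
  both sequences.\<close>

lemma predual_small_at_infinity:
  fixes \<omega> :: "('h::complex_hilbert \<Rightarrow>\<^sub>L 'h) \<Rightarrow> complex"
  assumes \<omega>: "\<omega> \<in> predual_functionals" and e: "e > 0"
  shows "\<exists>X. finite X \<and> (\<forall>Q a. coprojection Q \<longrightarrow> (\<forall>x\<in>X. blinfun_apply Q x = 0) \<longrightarrow>
    cmod (\<omega> (a o\<^sub>L Q)) \<le> e * norm a \<and> cmod (\<omega> (Q o\<^sub>L a)) \<le> e * norm a)"
proof -
  obtain x y where xy: "summable (\<lambda>n. (norm (x n))\<^sup>2)" "summable (\<lambda>n. (norm (y n))\<^sup>2)"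
    and eq: "\<And>a. \<omega> a = (\<Sum>n. cinner (blinfun_apply a (x n)) (y n))"
    using \<omega> by (rule predualE) blast
  note s = summable_mult_of_squares[OF xy]
  obtain N where N: "norm (\<Sum>i. norm (x (i + N)) * norm (y (i + N))) < e"
    using suminf_exist_split[OF e s] by blast
  have tail: "cmod (\<omega> b) \<le> e * norm a"
    if zero: "\<And>n. n < N \<Longrightarrow> cinner (blinfun_apply b (x n)) (y n) = 0"
      and bound: "norm b \<le> norm a" for a b :: "'h \<Rightarrow>\<^sub>L 'h"
  proof -
    have s': "summable (\<lambda>i. norm (x (i + N)) * norm (y (i + N)))"
      by (rule summable_ignore_initial_segment[OF s])
    have "\<omega> b = (\<Sum>i. cinner (b (x (i + N))) (y (i + N)))"
      unfolding eq using suminf_split_initial_segment[OF predual_functional_summable[OF xy, of b], of N] zero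
      by simp
    also have "cmod \<dots> \<le> (\<Sum>i. norm b * (norm (x (i + N)) * norm (y (i + N))))"
      by (rule norm_suminf_le[OF cinner_operator_bound summable_mult[OF s']])
    also have "\<dots> = norm b * (\<Sum>i. norm (x (i + N)) * norm (y (i + N)))"
      by (rule suminf_mult[OF s'])
    also have "\<dots> \<le> norm a * e"
      using N bound suminf_nonneg[OF s'] by (intro mult_mono) auto
    finally show ?thesis by (simp add: mult.commute)
  qed
  show ?thesis
  proof (intro exI[of _ "x ` {..<N} \<union> y ` {..<N}"] conjI allI impI)
    fix Q a :: "'h \<Rightarrow>\<^sub>L 'h"
    assume Q: "coprojection Q" and z: "\<forall>v\<in>x ` {..<N} \<union> y ` {..<N}. blinfun_apply Q v = 0"
    have "norm (a o\<^sub>L Q) \<le> norm a * norm Q" "norm (Q o\<^sub>L a) \<le> norm Q * norm a"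
      by (rule norm_blinfun_compose)+
    moreover have "norm a * norm Q \<le> norm a * 1" "norm Q * norm a \<le> 1 * norm a"
      using norm_coprojection_le(1)[OF Q] by (intro mult_left_mono mult_right_mono; simp)+
    ultimately have n: "norm (a o\<^sub>L Q) \<le> norm a" "norm (Q o\<^sub>L a) \<le> norm a" by simp_all
    show "cmod (\<omega> (a o\<^sub>L Q)) \<le> e * norm a"
      using z by (intro tail n(1)) simp
    show "cmod (\<omega> (Q o\<^sub>L a)) \<le> e * norm a"
      using z by (intro tail n(2)) (simp add: cinner_coprojection[OF Q])
  qed simp
qed

text \<open>The finite rank operators \<open>a (1 - Q)\<close> approximate \<open>a\<close> in the weak-* topology.\<close>

lemma predual_zero_on_finite_rank:
  fixes \<omega> :: "('h::complex_hilbert \<Rightarrow>\<^sub>L 'h) \<Rightarrow> complex"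
  assumes \<omega>: "\<omega> \<in> predual_functionals" and zero: "\<And>k. k \<in> finite_rank \<Longrightarrow> \<omega> k = 0"
    and a: "a \<in> bounded_ops"
  shows "\<omega> a = 0"
proof -
  have "cmod (\<omega> a) \<le> e * norm a" if e: "e > 0" for e
  proof -
    obtain X where "finite X" and X: "\<And>Q. coprojection Q \<Longrightarrow> \<forall>x\<in>X. Q x = 0 \<Longrightarrow> cmod (\<omega> (a o\<^sub>L Q)) \<le> e * norm a"
      using predual_small_at_infinity[OF \<omega> e] by blast
    then obtain Q where Q: "coprojection Q" "cmod (\<omega> (a o\<^sub>L Q)) \<le> e * norm a"
      using ex_coprojection[of X] by blast
    have "a = (a o\<^sub>L Q) + (a o\<^sub>L (id_blinfun - Q))" by simp
    then have "\<omega> a = \<omega> (a o\<^sub>L Q) + \<omega> (a o\<^sub>L (id_blinfun - Q))"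
      using predual_add[OF \<omega>] by metis
    also have "\<omega> (a o\<^sub>L (id_blinfun - Q)) = 0"
      by (rule zero[OF compose_finite_rank[OF a coprojection_complement_finite_rank[OF Q(1)]]])
    finally show ?thesis using Q by simp
  qed
  note small = this
  have "cmod (\<omega> a) \<le> 0 + e" if e: "e > 0" for e
  proof -
    have "e / (norm a + 1) * norm a \<le> e"
      using e by (simp add: field_simps add_pos_nonneg)
    moreover have "e / (norm a + 1) > 0" using e by (simp add: add_nonneg_pos)
    ultimately show ?thesis using small[of "e / (norm a + 1)"] by linarith
  qed
  then have "cmod (\<omega> a) \<le> 0" by (rule field_le_epsilon)
  then show ?thesis by simp
qed

lemma topspace_weak_star: "topspace (weak_star :: ('h::complex_hilbert \<Rightarrow>\<^sub>L 'h) topology) = bounded_ops"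
  unfolding weak_star_def topology_generated_by_topspace
  using zero_in_predual by (auto intro!: exI[of _ bounded_ops])

lemma predual_weak_star_continuous:
  assumes "\<omega> \<in> predual_functionals"
  shows "continuous_map weak_star euclidean \<omega>"
  unfolding continuous_map_def topspace_weak_star
proof (intro conjI allI impI)
  fix U :: "complex set" assume "openin euclidean U"
  then show "openin weak_star {x \<in> bounded_ops. \<omega> x \<in> U}"
    unfolding weak_star_def using assms by (intro topology_generated_by_Basis) auto
qed simp

text \<open>A weak-* neighbourhood of zero contains a subspace of finite codimension, which is all that is
  needed to recognise the continuous functionals.\<close>

lemma weak_star_neighbourhood:
  fixes V :: "('h::complex_hilbert \<Rightarrow>\<^sub>L 'h) set"
  assumes "openin weak_star V" "0 \<in> V"
  shows "\<exists>F. finite F \<and> F \<subseteq> predual_functionals \<and> {a \<in> bounded_ops. \<forall>f\<in>F. f a = 0} \<subseteq> V"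
proof -
  have "generate_topology_on {{a \<in> bounded_ops. f a \<in> U} |f U. f \<in> predual_functionals \<and> open U} V"
    using assms(1) unfolding weak_star_def by (rule openin_topology_generated_by)
  then show ?thesis using assms(2)
  proof induction
    case (Int A B)
    then have "0 \<in> A" "0 \<in> B" by simp_all
    obtain F where F: "finite F" "F \<subseteq> predual_functionals"
        "{a \<in> bounded_ops. \<forall>f\<in>F. f a = 0} \<subseteq> A"
      using Int.IH(1)[OF \<open>0 \<in> A\<close>] by (elim exE conjE)
    obtain G where G: "finite G" "G \<subseteq> predual_functionals"
        "{a \<in> bounded_ops. \<forall>f\<in>G. f a = 0} \<subseteq> B"
      using Int.IH(2)[OF \<open>0 \<in> B\<close>] by (elim exE conjE)
    have "{a \<in> bounded_ops. \<forall>f\<in>F \<union> G. f a = 0} \<subseteq> A \<inter> B"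
      using F(3) G(3) by blast
    then show ?case using F G by (intro exI[of _ "F \<union> G"]) simp
  next
    case (UN K)
    then obtain A where A: "A \<in> K" "0 \<in> A" by blast
    then obtain F where F: "finite F" "F \<subseteq> predual_functionals"
      "{a \<in> bounded_ops. \<forall>f\<in>F. f a = 0} \<subseteq> A"
      using UN.IH[OF A] by (elim exE conjE)
    then show ?case
      by (intro exI[of _ F] conjI F(1,2) subset_trans[OF F(3) Union_upper[OF A(1)]])
  next
    case (Basis A)
    then obtain f U where A: "A = {a \<in> bounded_ops. f a \<in> U}" "f \<in> predual_functionals" by auto
    have "f 0 \<in> U" using Basis A by simp
    then have "{a \<in> bounded_ops. \<forall>g\<in>{f}. g a = 0} \<subseteq> A"
      using predual_zero[OF A(2)] by (auto simp: A(1))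
    then show ?case using A(2) by (intro exI[of _ "{f}"]) simp
  qed simp
qed

text \<open>A functional that vanishes on the common kernel of finitely many functionals is a linear
  combination of them. The induction replaces \<open>X\<close> by the kernel of one of them.\<close>

lemma predual_of_kernels:
  fixes \<omega> :: "('h::complex_hilbert \<Rightarrow>\<^sub>L 'h) \<Rightarrow> complex"
  assumes "finite F" "F \<subseteq> predual_functionals"
    and "\<And>a b. a \<in> X \<Longrightarrow> b \<in> X \<Longrightarrow> a + b \<in> X" "\<And>c a. a \<in> X \<Longrightarrow> c *\<^sub>C a \<in> X"
    and "linear_functional X \<omega>"
    and "\<And>a. a \<in> X \<Longrightarrow> \<forall>f\<in>F. f a = 0 \<Longrightarrow> \<omega> a = 0"
  shows "\<exists>\<omega>'\<in>predual_functionals. \<forall>a\<in>X. \<omega> a = \<omega>' a"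
  using assms
proof (induction F arbitrary: X)
  case empty
  then show ?case using zero_in_predual by (intro bexI[of _ "\<lambda>a. 0"]) auto
next
  case (insert f F)
  have f: "f \<in> predual_functionals" and F: "F \<subseteq> predual_functionals" using insert.prems(1) by auto
  show ?case
  proof (cases "\<exists>a\<in>X. f a \<noteq> 0")
    case False
    show ?thesis
      using insert.IH[OF F insert.prems(2,3,4)] insert.prems(5) False by simp
  next
    case True
    then obtain e0 where e0: "e0 \<in> X" "f e0 \<noteq> 0" by blast
    define e where "e = (1 / f e0) *\<^sub>C e0"
    have e: "e \<in> X" "f e = 1"
      using e0 insert.prems(3) by (simp_all add: e_def predual_scaleC[OF f])
    have "\<exists>\<omega>'\<in>predual_functionals. \<forall>a\<in>{a \<in> X. f a = 0}. \<omega> a = \<omega>' a"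
    proof (rule insert.IH[OF F])
      show "linear_functional {a \<in> X. f a = 0} \<omega>"
        using insert.prems(4) by (auto simp: linear_functional_def)
    qed (use insert.prems in \<open>auto simp: predual_add[OF f] predual_scaleC[OF f]\<close>)
    then obtain \<omega>1 where \<omega>1: "\<omega>1 \<in> predual_functionals" "\<And>a. a \<in> X \<Longrightarrow> f a = 0 \<Longrightarrow> \<omega> a = \<omega>1 a" by auto
    have "\<omega> a = \<omega>1 a + (\<omega> e - \<omega>1 e) * f a" if a: "a \<in> X" for a
    proof -
      have "(- f a) *\<^sub>C e \<in> X" using e insert.prems(3) by blast
      moreover from this a have "a + (- f a) *\<^sub>C e \<in> X" using insert.prems(2) by blast
      moreover have "f (a + (- f a) *\<^sub>C e) = 0"
        by (simp only: predual_add[OF f] predual_scaleC[OF f] e(2)) simp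
      ultimately have "\<omega> a + (- f a) * \<omega> e = \<omega>1 a + (- f a) * \<omega>1 e"
        using \<omega>1(2)[of "a + (- f a) *\<^sub>C e"] a e insert.prems(4)
        by (simp only: predual_add[OF \<omega>1(1)] predual_scaleC[OF \<omega>1(1)] linear_functional_def)
      then show ?thesis by (simp add: algebra_simps)
    qed
    then show ?thesis
      by (intro bexI[of _ "\<lambda>a. \<omega>1 a + (\<omega> e - \<omega>1 e) * f a"] ballI
          add_in_predual[OF \<omega>1(1) scaleC_in_predual[OF f]])
  qed
qed

lemma weak_star_continuous_predual:
  fixes \<omega> :: "('h::complex_hilbert \<Rightarrow>\<^sub>L 'h) \<Rightarrow> complex"
  assumes lin: "linear_functional bounded_ops \<omega>" and cont: "continuous_map weak_star euclidean \<omega>"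
  shows "\<exists>\<omega>'\<in>predual_functionals. \<forall>a\<in>bounded_ops. \<omega> a = \<omega>' a"
proof -
  let ?V = "{a \<in> bounded_ops. \<omega> a \<in> ball 0 1}"
  have zero: "(0 :: 'h \<Rightarrow>\<^sub>L 'h) \<in> bounded_ops" by (rule subspace_0[OF subspace_bounded_ops])
  have "\<omega> (0 + 0) = \<omega> 0 + \<omega> 0" using lin zero unfolding linear_functional_def by blast
  then have "\<omega> 0 = 0" by simp
  moreover have "openin weak_star ?V"
    using openin_continuous_map_preimage[OF cont, of "ball 0 1"] by (simp add: topspace_weak_star)
  ultimately obtain F where F: "finite F" "F \<subseteq> predual_functionals"
    "{a \<in> bounded_ops. \<forall>f\<in>F. f a = 0} \<subseteq> ?V"
    using weak_star_neighbourhood[of ?V] zero by auto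
  have "\<omega> a = 0" if a: "a \<in> bounded_ops" "\<forall>f\<in>F. f a = 0" for a
  proof (rule ccontr)
    assume ne: "\<omega> a \<noteq> 0"
    have "(1 / \<omega> a) *\<^sub>C a \<in> bounded_ops" using a by (simp add: scaleC_in_bounded_ops)
    moreover have "f ((1 / \<omega> a) *\<^sub>C a) = 0" if "f \<in> F" for f
    proof -
      have "f \<in> predual_functionals" using that F by blast
      then show ?thesis using a that by (simp add: predual_scaleC)
    qed
    ultimately have "\<omega> ((1 / \<omega> a) *\<^sub>C a) \<in> ball 0 1" using F by blast
    moreover have "\<omega> ((1 / \<omega> a) *\<^sub>C a) = (1 / \<omega> a) * \<omega> a"
      using lin a unfolding linear_functional_def by blast
    ultimately show False using ne by simp
  qed
  then show ?thesis
    using F lin by (intro predual_of_kernels)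
      (auto intro: subspace_add[OF subspace_bounded_ops] scaleC_in_bounded_ops)
qed

text \<open>On bounded families the weak operator topology is as good as the weak-* topology, because the
  series are then dominated by a single summable one.\<close>

lemma predual_bounded_convergence:
  fixes g :: "'i \<Rightarrow> 'h::complex_hilbert \<Rightarrow>\<^sub>L 'h"
  assumes \<omega>: "\<omega> \<in> predual_functionals" and F: "F \<noteq> bot"
    and bound: "\<And>i. norm (g i) \<le> C"
    and lim: "\<And>x y. ((\<lambda>i. cinner (blinfun_apply (g i) x) y) \<longlongrightarrow> cinner (blinfun_apply R x) y) F"
  shows "((\<lambda>i. \<omega> (g i)) \<longlongrightarrow> \<omega> R) F"
proof -
  obtain x y where xy: "summable (\<lambda>n. (norm (x n))\<^sup>2)" "summable (\<lambda>n. (norm (y n))\<^sup>2)"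
    and eq: "\<And>a. \<omega> a = (\<Sum>n. cinner (blinfun_apply a (x n)) (y n))"
    using \<omega> by (rule predualE) blast
  have "cmod (cinner (g i (x k)) (y k)) \<le> C * (norm (x k) * norm (y k))" for i k
    by (rule order_trans[OF cinner_operator_bound mult_right_mono[OF bound]]) simp
  then have "eventually (\<lambda>(k, i). norm (cinner (g i (x k)) (y k)) \<le> C * (norm (x k) * norm (y k))) (at_top \<times>\<^sub>F F)"
    by (intro always_eventually) auto
  from tannerys_theorem[OF lim this summable_mult[OF summable_mult_of_squares[OF xy]] F]
  show ?thesis unfolding eq by (elim conjE)
qed

text \<open>By Tychonoff's theorem a bounded sequence of operators has a cluster point in the weak operator
  topology; it is the limit along a filter finer than the sequence.\<close>

lemma weak_operator_cluster_point:
  fixes g :: "nat \<Rightarrow> 'h::complex_hilbert \<Rightarrow>\<^sub>L 'h"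
  assumes g: "\<And>n. g n \<in> bounded_ops" and bound: "\<And>n. norm (g n) \<le> C"
  obtains F R where "F \<noteq> bot" "F \<le> sequentially" "R \<in> bounded_ops" "norm R \<le> C"
    "\<And>x y. ((\<lambda>n. cinner (blinfun_apply (g n) x) y) \<longlongrightarrow> cinner (blinfun_apply R x) y) F"
proof -
  define h :: "nat \<Rightarrow> 'h \<times> 'h \<Rightarrow> complex" where "h n = (\<lambda>(x, y). cinner (g n x) y)" for n
  define K :: "('h \<times> 'h \<Rightarrow> complex) set"
    where "K = PiE UNIV (\<lambda>(x, y). cball 0 (C * (norm x * norm y)))"
  have "compactin (product_topology (\<lambda>i. euclidean) UNIV) K"
    unfolding K_def compactin_PiE by auto
  then have "compact K"
    by (simp add: euclidean_product_topology)
  moreover have hK: "h n \<in> K" for n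
    using order_trans[OF cinner_operator_bound mult_right_mono[OF bound]]
    by (auto simp: K_def h_def)
  ultimately obtain f where "f \<in> K" and f: "inf (nhds f) (filtermap h sequentially) \<noteq> bot"
    unfolding compact_filter
    by (metis (mono_tags, lifting) always_eventually eventually_filtermap filtermap_bot_iff sequentially_bot)
  define F where "F = inf sequentially (filtercomap h (nhds f))"
  have F: "F \<noteq> bot"
  proof
    assume "F = bot"
    then obtain P Q where PQ: "eventually P sequentially" "eventually Q (filtercomap h (nhds f))"
      "\<And>n. P n \<Longrightarrow> Q n \<Longrightarrow> False"
      unfolding F_def trivial_limit_def eventually_inf by blast
    then obtain Q' where Q': "eventually Q' (nhds f)" "\<And>n. Q' (h n) \<Longrightarrow> Q n"
      unfolding eventually_filtercomap by blast
    have "eventually (\<lambda>z. \<not> Q' z) (filtermap h sequentially)"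
      unfolding eventually_filtermap by (rule eventually_mono[OF PQ(1)]) (use PQ Q' in blast)
    with Q'(1) have "eventually (\<lambda>z. False) (inf (nhds f) (filtermap h sequentially))"
      unfolding eventually_inf by blast
    then show False using f by (simp add: trivial_limit_def)
  qed
  have "filterlim h (nhds f) F"
    unfolding F_def by (rule filterlim_mono[OF filterlim_filtercomap order_refl inf_le2])
  then have lim: "((\<lambda>n. h n p) \<longlongrightarrow> f p) F" for p
    using continuous_on_tendsto_compose[OF continuous_on_product_coordinates[of p]] by auto
  then have lim': "((\<lambda>n. cinner (g n x) y) \<longlongrightarrow> f (x, y)) F" for x y
    using lim[of "(x, y)"] by (simp add: h_def)
  have uniq: "f (x, y) = l" if "((\<lambda>n. cinner (g n x) y) \<longlongrightarrow> l) F" for x y l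
    using tendsto_unique[OF F lim'[of x y] that] .
  have fb: "cmod (f (x, y)) \<le> max C 0 * norm x * norm y" for x y
  proof -
    have "cmod (f (x, y)) \<le> C * (norm x * norm y)"
      using \<open>f \<in> K\<close> by (auto simp: K_def PiE_iff)
    also have "\<dots> \<le> max C 0 * (norm x * norm y)" by (intro mult_right_mono) auto
    finally show ?thesis by (simp add: mult.assoc)
  qed
  obtain R :: "'h \<Rightarrow>\<^sub>L 'h" where R: "R \<in> bounded_ops" "\<And>x y. cinner (R x) y = f (x, y)"
    "norm R \<le> max (max C 0) 0"
  proof (rule operator_of_form[of "\<lambda>x y. f (x, y)" "max C 0"])
    show "f (x + x', y) = f (x, y) + f (x', y)" for x x' y
      by (rule uniq) (simp add: blinfun.add_right cinner_add_left tendsto_add lim')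
    show "f (x, y + y') = f (x, y) + f (x, y')" for x y y'
      by (rule uniq) (simp add: cinner_add_right tendsto_add lim')
    show "f (c *\<^sub>C x, y) = c * f (x, y)" for c x y
      by (rule uniq) (simp add: bounded_opsD[OF g] cinner_scaleC_left tendsto_mult_left lim')
    show "f (x, c *\<^sub>C y) = cnj c * f (x, y)" for c x y
      by (rule uniq) (simp add: cinner_scaleC_right tendsto_mult_left lim')
  qed (use fb in auto)
  have "C \<ge> 0" using bound[of 0] norm_ge_zero[of "g 0"] by linarith
  show ?thesis
    by (rule that[OF F _ R(1)]) (use R lim' \<open>C \<ge> 0\<close> in \<open>auto simp: F_def\<close>)
qed

section \<open>Positive functionals and the Cholesky decomposition\<close>

lemma scaleC_blinfun_add_right: "c *\<^sub>C (a + b) = c *\<^sub>C a + c *\<^sub>C b"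
  for a b :: "'a::real_normed_vector \<Rightarrow>\<^sub>L 'b::complex_hilbert"
  by (rule blinfun_eqI) (simp add: blinfun.add_left scaleC_add_right)

lemma scaleC_blinfun_add_left: "(c + d) *\<^sub>C a = c *\<^sub>C a + d *\<^sub>C a"
  for a :: "'a::real_normed_vector \<Rightarrow>\<^sub>L 'b::complex_hilbert"
  by (rule blinfun_eqI) (simp add: blinfun.add_left scaleC_add_left)

lemma scaleC_minus_one_blinfun: "(- 1) *\<^sub>C a = - a"
  for a :: "'a::real_normed_vector \<Rightarrow>\<^sub>L 'b::complex_hilbert"
  using of_real_scaleC_blinfun[of "- 1" a] by simp

lemma scaleC_one_blinfun: "1 *\<^sub>C a = a"
  for a :: "'a::real_normed_vector \<Rightarrow>\<^sub>L 'b::complex_hilbert"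
  using of_real_scaleC_blinfun[of 1 a] by simp

lemma scaleC_blinfun_minus: "c *\<^sub>C (- a) = - (c *\<^sub>C a)" "(- c) *\<^sub>C a = - (c *\<^sub>C a)"
  for a :: "'a::real_normed_vector \<Rightarrow>\<^sub>L 'b::complex_hilbert"
  using scaleC_scaleC_blinfun[of c "- 1" a] scaleC_scaleC_blinfun[of "- 1" c a]
  by (simp_all add: scaleC_minus_one_blinfun)

lemma scaleC_blinfun_zero: "c *\<^sub>C 0 = (0 :: 'a::real_normed_vector \<Rightarrow>\<^sub>L 'b::complex_hilbert)"
  by (rule blinfun_eqI) (simp add: scaleC.zero_right)

text \<open>The complex-linear functional with real part \<open>f\<close>.\<close>

definition complexify :: "(('h::complex_hilbert \<Rightarrow>\<^sub>L 'h) \<Rightarrow> real) \<Rightarrow> ('h \<Rightarrow>\<^sub>L 'h) \<Rightarrow> complex"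
  where "complexify f b = Complex (f b) (- f (\<i> *\<^sub>C b))"

lemma Re_complexify [simp]: "Re (complexify f b) = f b"
  by (simp add: complexify_def)

lemma complexify_add: "linear f \<Longrightarrow> complexify f (a + b) = complexify f a + complexify f b"
  by (simp add: complexify_def complex_eq_iff linear_add scaleC_blinfun_add_right)

lemma complexify_scaleC:
  assumes f: "linear f"
  shows "complexify f (c *\<^sub>C b) = c * complexify f b"
proof -
  have *: "f (d *\<^sub>C a) = Re d * f a + Im d * f (\<i> *\<^sub>C a)" for d a
  proof -
    have "d *\<^sub>C a = (of_real (Re d) + of_real (Im d) * \<i>) *\<^sub>C a"
      using complex_eq[of d] by (simp add: mult.commute)
    also have "\<dots> = Re d *\<^sub>R a + Im d *\<^sub>R (\<i> *\<^sub>C a)"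
      by (simp only: scaleC_blinfun_add_left scaleC_scaleC_blinfun[symmetric] of_real_scaleC_blinfun)
    finally show ?thesis by (simp add: linear_add[OF f] linear_scale[OF f])
  qed
  show ?thesis
    using *[of c b] *[of "\<i> * c" b]
    by (simp add: complexify_def complex_eq_iff scaleC_scaleC_blinfun)
qed

lemma norm_complexify_le:
  assumes f: "linear f" and le: "\<And>c. cmod c = 1 \<Longrightarrow> f (c *\<^sub>C b) \<le> K"
  shows "cmod (complexify f b) \<le> K"
proof (cases "complexify f b = 0")
  case True
  then show ?thesis
    using le[of 1] le[of "- 1"] linear_neg[OF f, of b]
    by (simp add: scaleC_one_blinfun scaleC_minus_one_blinfun)
next
  case False
  define w where "w = complexify f b"
  have w: "w \<noteq> 0" using False by (simp add: w_def)
  define c where "c = cnj w / of_real (cmod w)"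
  have "cmod c = 1" using w by (simp add: c_def norm_divide)
  moreover have "c * w = of_real (cmod w)"
    using w complex_norm_square[of w] by (simp add: c_def field_simps power2_eq_square)
  ultimately show ?thesis
    using le[of c] complexify_scaleC[OF f, of c b] by (metis Re_complexify Re_complex_of_real w_def)
qed

definition accretive :: "('h::complex_hilbert \<Rightarrow>\<^sub>L 'h) \<Rightarrow> bool"
  where "accretive a \<longleftrightarrow> (\<forall>x. 0 \<le> Re (cinner (blinfun_apply a x) x))"

lemma accretive_add: "accretive a \<Longrightarrow> accretive b \<Longrightarrow> accretive (a + b)"
  by (simp add: accretive_def blinfun.add_left cinner_add_left)

lemma accretive_scaleR: "accretive a \<Longrightarrow> r \<ge> 0 \<Longrightarrow> accretive (r *\<^sub>R a)"
  by (simp add: accretive_def blinfun.scaleR_left cinner_scaleR_left)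

lemma accretive_zero: "accretive 0"
  by (simp add: accretive_def)

lemma accretive_norm_diff: "norm b \<le> t \<Longrightarrow> accretive (t *\<^sub>R id_blinfun - b)"
proof -
  assume t: "norm b \<le> t"
  have "Re (cinner (b x) x) \<le> t * (norm x)\<^sup>2" for x
  proof -
    have "Re (cinner (b x) x) \<le> norm b * (norm x * norm x)"
      using order_trans[OF complex_Re_le_cmod cinner_operator_bound] .
    also have "\<dots> \<le> t * (norm x * norm x)" by (rule mult_right_mono[OF t]) simp
    finally show ?thesis by (simp add: power2_eq_square)
  qed
  then show ?thesis
    by (simp add: accretive_def blinfun.diff_left blinfun.scaleR_left cinner.diff_left
        cinner_scaleR_left Re_cinner_self)
qed

lemma accretive_coprojection: "coprojection Q \<Longrightarrow> accretive Q"
  by (simp add: accretive_def cinner_coprojection_self)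

lemma accretive_rank_one: "accretive (rank_one x x)"
  and accretive_i_rank_one: "accretive (\<i> *\<^sub>C rank_one x x)" "accretive (- (\<i> *\<^sub>C rank_one x x))"
proof -
  have "cinner (rank_one x x h) h = of_real ((cmod (cinner h x))\<^sup>2)" for h
    using cinner_commute[of x h] complex_norm_square[of "cinner h x"] by (simp add: cinner_scaleC_left)
  then show "accretive (rank_one x x)" "accretive (\<i> *\<^sub>C rank_one x x)" "accretive (- (\<i> *\<^sub>C rank_one x x))"
    by (simp_all add: accretive_def cinner_scaleC_left blinfun.minus_left cinner.minus_left)
qed

text \<open>This is the polarisation identity, applied to vectors of equal length.\<close>

lemma norm_le_numerical_radius:
  fixes a :: "'h::complex_hilbert \<Rightarrow>\<^sub>L 'h"
  assumes a: "a \<in> bounded_ops" and w: "w \<ge> 0"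
    and le: "\<And>x. cmod (cinner (blinfun_apply a x) x) \<le> w * (norm x)\<^sup>2"
  shows "norm a \<le> 2 * w"
proof (rule norm_blinfun_bound)
  fix x
  have form: "cmod (cinner (a x) y) \<le> w * ((norm x)\<^sup>2 + (norm y)\<^sup>2)" for y
  proof -
    define q where "q z = cinner (a z) z" for z
    have "4 * cinner (a x) y = (q (x + y) - q (x - y)) + \<i> * (q (x + \<i> *\<^sub>C y) - q (x - \<i> *\<^sub>C y))"
      unfolding q_def
      by (simp add: blinfun.add_right blinfun.diff_right cinner.add_left cinner.add_right
          cinner.diff_left cinner.diff_right bounded_opsD[OF a] cinner_scaleC_left cinner_scaleC_right
          algebra_simps)
    then have "4 * cmod (cinner (a x) y) = cmod ((q (x + y) - q (x - y)) + \<i> * (q (x + \<i> *\<^sub>C y) - q (x - \<i> *\<^sub>C y)))"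
      by (metis norm_mult norm_numeral)
    also have "\<dots> \<le> (cmod (q (x + y)) + cmod (q (x - y))) + (cmod (q (x + \<i> *\<^sub>C y)) + cmod (q (x - \<i> *\<^sub>C y)))"
    proof -
      have "cmod (\<i> * (q (x + \<i> *\<^sub>C y) - q (x - \<i> *\<^sub>C y))) \<le> cmod (q (x + \<i> *\<^sub>C y)) + cmod (q (x - \<i> *\<^sub>C y))"
        by (simp add: norm_mult norm_triangle_ineq4)
      then show ?thesis by (intro order_trans[OF norm_triangle_ineq] add_mono norm_triangle_ineq4)
    qed
    also have "\<dots> \<le> (w * (norm (x + y))\<^sup>2 + w * (norm (x - y))\<^sup>2) + (w * (norm (x + \<i> *\<^sub>C y))\<^sup>2 + w * (norm (x - \<i> *\<^sub>C y))\<^sup>2)"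
      unfolding q_def by (intro add_mono le)
    also have "\<dots> = 4 * (w * ((norm x)\<^sup>2 + (norm y)\<^sup>2))"
      by (simp add: norm_add_square norm_diff_square norm_scaleC algebra_simps)
    finally show ?thesis by simp
  qed
  show "norm (a x) \<le> 2 * w * norm x"
  proof (cases "a x = 0")
    case False
    define y where "y = (norm x / norm (a x)) *\<^sub>R a x"
    have "cinner (a x) y = of_real (norm x * norm (a x))"
      using False by (simp add: y_def cinner_scaleR_right cinner_self scaleR_conv_of_real power2_eq_square)
    moreover have "norm y = norm x" using False by (simp add: y_def)
    ultimately have "norm x * norm (a x) \<le> norm x * (2 * w * norm x)"
      using form[of y] by (simp add: norm_mult power2_eq_square algebra_simps)
    moreover have "norm x > 0" using False by auto
    ultimately show ?thesis by simp
  qed (use w in simp)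
qed (use w in simp)

text \<open>Only the values at operators of rank one matter: they say that \<open>f (rank_one x y)\<close> is the real part
  of a bounded positive semidefinite sesquilinear form in \<open>x\<close> and \<open>y\<close>. The condition on \<open>\<i>\<close> makes the
  quadratic form real. Unlike positivity on all accretive operators, this survives the subtraction
  of a vector functional in the next lemmas.\<close>

definition positive_form :: "(('h::complex_hilbert \<Rightarrow>\<^sub>L 'h) \<Rightarrow> real) \<Rightarrow> bool"
  where "positive_form f \<longleftrightarrow> linear f \<and> (\<forall>x. 0 \<le> f (rank_one x x)) \<and> (\<forall>x. f (\<i> *\<^sub>C rank_one x x) = 0) \<and>
    (\<exists>C. \<forall>b. \<bar>f b\<bar> \<le> C * norm b)"

lemma rank_one_add_add:
  "rank_one (x + y) (x + y) = rank_one x x + rank_one y y + (rank_one x y + rank_one y x)"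
  by (simp add: rank_one_add_left rank_one_add_right)

lemma rank_one_scaleR: "rank_one (r *\<^sub>R x) y = r *\<^sub>R rank_one x y" "rank_one x (r *\<^sub>R y) = r *\<^sub>R rank_one x y"
  using rank_one_scaleC_left[of "of_real r" x y] rank_one_scaleC_right[of x "of_real r" y]
  by (simp_all add: scaleC_of_real of_real_scaleC_blinfun)

lemma positive_form_symmetric:
  assumes "positive_form f"
  shows "f (rank_one y x) = f (rank_one x y)"
proof -
  have f: "linear f" and z: "\<And>x. f (\<i> *\<^sub>C rank_one x x) = 0"
    using assms by (auto simp: positive_form_def)
  have "f (\<i> *\<^sub>C rank_one x y) + f (\<i> *\<^sub>C rank_one y x) = 0" for x y
    using z[of "x + y"] z[of x] z[of y]
    by (simp add: rank_one_add_add scaleC_blinfun_add_right linear_add[OF f])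
  from this[of x "\<i> *\<^sub>C y"] show ?thesis
    by (simp add: rank_one_scaleC_left rank_one_scaleC_right scaleC_scaleC_blinfun
        scaleC_one_blinfun scaleC_minus_one_blinfun linear_neg[OF f])
qed

text \<open>Real scalars suffice here, since a phase can be moved into the vector \<open>x\<close>.\<close>

lemma positive_form_cauchy_schwarz:
  assumes pf: "positive_form f"
  shows "(f (rank_one x y))\<^sup>2 \<le> f (rank_one x x) * f (rank_one y y)"
proof -
  have f: "linear f" and pos: "\<And>x. 0 \<le> f (rank_one x x)"
    using pf by (auto simp: positive_form_def)
  define A B D where "A = f (rank_one x x)" and "B = f (rank_one x y)" and "D = f (rank_one y y)"
  have q: "0 \<le> A + 2 * t * B + t\<^sup>2 * D" for t
    using pos[of "x + t *\<^sub>R y"] positive_form_symmetric[OF pf, of y x]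
    by (simp add: rank_one_add_add rank_one_scaleR linear_add[OF f] linear_scale[OF f] A_def B_def D_def
        power2_eq_square algebra_simps)
  have "B\<^sup>2 \<le> A * D"
  proof (cases "D = 0")
    case True
    have "B = 0"
    proof (rule ccontr)
      assume "B \<noteq> 0"
      then show False using q[of "- (A + 1) / (2 * B)"] True by (simp add: field_simps)
    qed
    then show ?thesis using True by simp
  next
    case False
    then have "D > 0" using pos[of y] by (simp add: D_def)
    then have "0 \<le> A - B\<^sup>2 / D"
      using q[of "- B / D"] by (simp add: field_simps power2_eq_square)
    then show ?thesis using \<open>D > 0\<close> by (simp add: field_simps)
  qed
  then show ?thesis by (simp add: A_def B_def D_def)
qed

lemma predual_vector_real_linear: "linear (\<lambda>b :: 'h \<Rightarrow>\<^sub>L 'h::complex_hilbert. Re (cinner (blinfun_apply b v) v))"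
  by (rule linearI) (simp_all add: blinfun.add_left cinner_add_left blinfun.scaleR_left cinner_scaleR_left)

text \<open>One step of the Cholesky decomposition. A pivot \<open>e\<close> is chosen at which the form is at least
  half as large as anywhere on the unit sphere; the Schur complement is again positive by the
  Cauchy-Schwarz inequality.\<close>

lemma cholesky_step:
  assumes pf: "positive_form f"
  shows "\<exists>v. positive_form (\<lambda>b. f b - Re (cinner (blinfun_apply b v) v)) \<and>
    (\<forall>x. f (rank_one x x) \<le> 2 * (norm v)\<^sup>2 * (norm x)\<^sup>2)"
proof -
  have f: "linear f" and pos: "\<And>x. 0 \<le> f (rank_one x x)" and iz: "\<And>x. f (\<i> *\<^sub>C rank_one x x) = 0"
    using pf by (auto simp: positive_form_def)
  obtain C where C: "\<And>b. \<bar>f b\<bar> \<le> C * norm b" using pf by (auto simp: positive_form_def)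
  show ?thesis
  proof (cases "\<forall>x. f (rank_one x x) = 0")
    case True
    then show ?thesis using pf by (intro exI[of _ 0]) simp
  next
    case False
    define S where "S = Sup {f (rank_one x x) |x. norm x = 1}"
    have bdd: "bdd_above {f (rank_one x x) |x. norm x = 1}"
    proof (rule bdd_aboveI)
      fix s assume "s \<in> {f (rank_one x x) |x. norm x = 1}"
      then obtain x where x: "s = f (rank_one x x)" "norm x = 1" by blast
      have "s \<le> \<bar>C\<bar> * norm (rank_one x x)"
        using C[of "rank_one x x"] mult_right_mono[OF abs_ge_self[of C] norm_ge_zero[of "rank_one x x"]]
        by (simp add: x(1))
      also have "\<dots> \<le> \<bar>C\<bar> * 1"
        using norm_rank_one_le[of x x] x(2) by (intro mult_left_mono) auto
      finally show "s \<le> \<bar>C\<bar>" by simp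
    qed
    have norm1: "f (rank_one x x) = (norm x)\<^sup>2 * f (rank_one ((1 / norm x) *\<^sub>R x) ((1 / norm x) *\<^sub>R x))"
      if "x \<noteq> 0" for x
      using that by (simp add: rank_one_scaleR linear_scale[OF f] power2_eq_square)
    have upper: "f (rank_one x x) \<le> S * (norm x)\<^sup>2" for x
    proof (cases "x = 0")
      case True
      have "rank_one 0 0 = (0 :: 'a \<Rightarrow>\<^sub>L 'a)" by (rule blinfun_eqI) (simp add: scaleC.zero_left)
      then show ?thesis using True linear_0[OF f] by simp
    next
      case False
      have "f (rank_one ((1 / norm x) *\<^sub>R x) ((1 / norm x) *\<^sub>R x)) \<le> S"
        unfolding S_def by (rule cSup_upper[OF _ bdd]) (use False in auto)
      from mult_left_mono[OF this, of "(norm x)\<^sup>2"] show ?thesis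
        by (simp add: norm1[OF False] mult.commute)
    qed
    obtain x0 where x0: "f (rank_one x0 x0) > 0" using False pos by (metis less_eq_real_def)
    then have "S * (norm x0)\<^sup>2 > 0" using upper[of x0] by linarith
    then have S: "S > 0" by (simp add: zero_less_mult_iff)
    have "x0 \<noteq> 0" using \<open>S * (norm x0)\<^sup>2 > 0\<close> by auto
    then have "{f (rank_one x x) |x. norm x = 1} \<noteq> {}"
      by (auto intro!: exI[of _ "(1 / norm x0) *\<^sub>R x0"])
    then obtain e where e: "norm e = 1" "S / 2 < f (rank_one e e)"
      using less_cSupD[of "{f (rank_one x x) |x. norm x = 1}" "S / 2"] S unfolding S_def by fastforce
    define D where "D = f (rank_one e e)"
    have D: "D > 0" "S \<le> 2 * D" using e S by (simp_all add: D_def)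
    obtain w where w: "\<And>x. complexify f (rank_one x e) = cinner x w"
    proof (rule riesz[of "\<lambda>x. complexify f (rank_one x e)"])
      show "bounded_linear (\<lambda>x. complexify f (rank_one x e))"
      proof (rule bounded_linear_intro)
        show "complexify f (rank_one (x + y) e) = complexify f (rank_one x e) + complexify f (rank_one y e)" for x y
          by (simp add: rank_one_add_left complexify_add[OF f])
        show "complexify f (rank_one (r *\<^sub>R x) e) = r *\<^sub>R complexify f (rank_one x e)" for r x
          using complexify_scaleC[OF f, of "of_real r" "rank_one x e"]
          by (simp add: rank_one_scaleR of_real_scaleC_blinfun scaleR_conv_of_real)
        show "cmod (complexify f (rank_one x e)) \<le> norm x * \<bar>C\<bar>" for x
        proof (rule norm_complexify_le[OF f])
          fix c :: complex assume c: "cmod c = 1"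
          have "f (c *\<^sub>C rank_one x e) \<le> \<bar>C\<bar> * norm (c *\<^sub>C rank_one x e)"
            using C[of "c *\<^sub>C rank_one x e"]
              mult_right_mono[OF abs_ge_self[of C] norm_ge_zero[of "c *\<^sub>C rank_one x e"]] by simp
          also have "\<dots> \<le> \<bar>C\<bar> * norm x"
            using norm_rank_one_le[of x e] e(1) c by (intro mult_left_mono) (auto simp: norm_scaleC_blinfun)
          finally show "f (c *\<^sub>C rank_one x e) \<le> norm x * \<bar>C\<bar>" by (simp add: mult.commute)
        qed
      qed
      show "complexify f (rank_one (c *\<^sub>C x) e) = c * complexify f (rank_one x e)" for c x
        by (simp add: rank_one_scaleC_left complexify_scaleC[OF f])
    qed blast
    have cs: "(cmod (cinner x w))\<^sup>2 \<le> f (rank_one x x) * D" for x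
    proof (cases "cinner x w = 0")
      case True
      then show ?thesis using pos[of x] D by simp
    next
      case False
      define c where "c = cnj (cinner x w) / of_real (cmod (cinner x w))"
      have c: "cmod c = 1" using False by (simp add: c_def norm_divide)
      have "c * cinner x w = of_real (cmod (cinner x w))"
        using False complex_norm_square[of "cinner x w"] by (simp add: c_def field_simps power2_eq_square)
      then have "f (rank_one (c *\<^sub>C x) e) = cmod (cinner x w)"
        using arg_cong[OF w[of "c *\<^sub>C x"], of Re] by (simp add: cinner_scaleC_left)
      moreover have "rank_one (c *\<^sub>C x) (c *\<^sub>C x) = rank_one x x"
      proof -
        have "rank_one (c *\<^sub>C x) (c *\<^sub>C x) = (c * cnj c) *\<^sub>C rank_one x x"
          by (simp add: rank_one_scaleC_left rank_one_scaleC_right scaleC_scaleC_blinfun mult.commute)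
        also have "c * cnj c = 1" using c complex_norm_square[of c] by simp
        finally show ?thesis by (simp add: scaleC_one_blinfun)
      qed
      ultimately show ?thesis
        using positive_form_cauchy_schwarz[OF pf, of "c *\<^sub>C x" e] by (simp add: D_def)
    qed
    define v where "v = (1 / sqrt D) *\<^sub>R w"
    have xv: "(cmod (cinner x v))\<^sup>2 = (cmod (cinner x w))\<^sup>2 / D" for x
      using D by (simp add: v_def cinner_scaleR_right power_divide)
    have "D = cmod (cinner e w)"
    proof (rule antisym)
      show "D \<le> cmod (cinner e w)"
        using arg_cong[OF w[of e], of Re] complex_Re_le_cmod[of "cinner e w"] by (simp add: D_def)
      have "(cmod (cinner e w))\<^sup>2 \<le> D\<^sup>2" using cs[of e] by (simp add: D_def power2_eq_square)
      then show "cmod (cinner e w) \<le> D" by (rule power2_le_imp_le) (use D in simp)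
    qed
    also have "\<dots> \<le> norm w" using cinner_cauchy_schwarz[of e w] e(1) by simp
    finally have "D \<le> norm w" .
    then have "D * D \<le> (norm w)\<^sup>2" using D by (simp add: power2_eq_square mult_mono)
    moreover have "(norm w)\<^sup>2 = D * (norm v)\<^sup>2"
      using D by (simp add: v_def power_divide)
    ultimately have nv: "D \<le> (norm v)\<^sup>2" using D by simp
    have rv: "cinner (rank_one x x v) v = of_real ((cmod (cinner x v))\<^sup>2)" for x
      using cinner_commute[of v x] complex_norm_square[of "cinner x v"]
      by (simp add: cinner_scaleC_left mult.commute)
    have "positive_form (\<lambda>b. f b - Re (cinner (blinfun_apply b v) v))"
      unfolding positive_form_def
    proof (intro conjI allI)
      show "linear (\<lambda>b. f b - Re (cinner (blinfun_apply b v) v))"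
        by (rule linear_compose_sub[OF f predual_vector_real_linear])
      show "0 \<le> f (rank_one x x) - Re (cinner (rank_one x x v) v)" for x
        using cs[of x] D(1) unfolding rv xv by (simp add: field_simps)
      show "f (\<i> *\<^sub>C rank_one x x) - Re (cinner ((\<i> *\<^sub>C rank_one x x) v) v) = 0" for x
      proof -
        have "cinner ((\<i> *\<^sub>C rank_one x x) v) v = \<i> * cinner (rank_one x x v) v"
          by (simp only: scaleC_blinfun_apply cinner_scaleC_left)
        then show ?thesis unfolding rv by (simp add: iz)
      qed
      have "\<bar>f b - Re (cinner (b v) v)\<bar> \<le> (C + (norm v)\<^sup>2) * norm b" for b
      proof -
        have "\<bar>Re (cinner (b v) v)\<bar> \<le> norm b * (norm v * norm v)"
          by (rule order_trans[OF abs_Re_le_cmod cinner_operator_bound])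
        then show ?thesis using C[of b] by (simp add: power2_eq_square algebra_simps)
      qed
      then show "\<exists>C. \<forall>b. \<bar>f b - Re (cinner (blinfun_apply b v) v)\<bar> \<le> C * norm b" by blast
    qed
    moreover have "f (rank_one x x) \<le> 2 * (norm v)\<^sup>2 * (norm x)\<^sup>2" for x
      by (rule order_trans[OF upper mult_right_mono]) (use D nv in auto)
    ultimately show ?thesis by blast
  qed
qed

text \<open>Iterating this step exhausts the restriction to the finite rank operators of a positive
  functional: the trace of what has been split off never exceeds \<open>f(1)\<close>, so that the pivots tend
  to zero.\<close>

lemma positive_functional_normal_part:
  fixes f :: "('h::complex_hilbert \<Rightarrow>\<^sub>L 'h) \<Rightarrow> real"
  assumes f: "linear f" and pos: "\<And>b. accretive b \<Longrightarrow> 0 \<le> f b"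
  shows "\<exists>\<omega>\<in>predual_functionals. \<forall>k\<in>finite_rank. f k = Re (\<omega> k)"
proof -
  have bound: "\<bar>f b\<bar> \<le> f id_blinfun * norm b" for b
  proof -
    have "f b' \<le> f id_blinfun * norm b'" for b'
      using pos[OF accretive_norm_diff[of b' "norm b'"]]
      by (simp add: linear_diff[OF f] linear_scale[OF f] mult.commute)
    from this[of b] this[of "- b"] show ?thesis by (simp add: linear_neg[OF f] abs_le_iff)
  qed
  have pf: "positive_form f"
    unfolding positive_form_def
  proof (intro conjI allI f)
    show "f (\<i> *\<^sub>C rank_one x x) = 0" for x
      using pos[OF accretive_i_rank_one(1), of x] pos[OF accretive_i_rank_one(2), of x]
      by (simp add: linear_neg[OF f])
    show "\<exists>C. \<forall>b. \<bar>f b\<bar> \<le> C * norm b" using bound by blast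
  qed (rule pos[OF accretive_rank_one])
  define V :: "(('h \<Rightarrow>\<^sub>L 'h) \<Rightarrow> real) \<Rightarrow> 'h"
    where "V g = (SOME v. positive_form (\<lambda>b. g b - Re (cinner (blinfun_apply b v) v)) \<and>
      (\<forall>x. g (rank_one x x) \<le> 2 * (norm v)\<^sup>2 * (norm x)\<^sup>2))" for g
  have V: "positive_form (\<lambda>b. g b - Re (cinner (blinfun_apply b (V g)) (V g)))"
    "g (rank_one x x) \<le> 2 * (norm (V g))\<^sup>2 * (norm x)\<^sup>2" if "positive_form g" for g x
    using someI_ex[OF cholesky_step[OF that]] unfolding V_def[symmetric] by blast+
  define F where "F = rec_nat f (\<lambda>n g b. g b - Re (cinner (blinfun_apply b (V g)) (V g)))"
  define v where "v n = V (F n)" for n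
  have F0: "F 0 = f" and FS: "F (Suc n) = (\<lambda>b. F n b - Re (cinner (blinfun_apply b (v n)) (v n)))" for n
    by (simp_all add: F_def v_def)
  have Fpos: "positive_form (F n)" for n
    by (induction n) (simp_all add: F0 pf FS v_def V(1))
  have Feq: "F n b = f b - (\<Sum>i<n. Re (cinner (blinfun_apply b (v i)) (v i)))" for n b
    by (induction n) (simp_all add: F0 FS)
  have partial: "(\<Sum>i<n. (norm (v i))\<^sup>2) \<le> f id_blinfun" for n
  proof -
    obtain Q where Q: "coprojection Q" "\<forall>x\<in>v ` {..<n}. Q x = 0"
      using ex_coprojection[of "v ` {..<n}"] by auto
    obtain es where es: "id_blinfun - Q = (\<Sum>e\<leftarrow>es. rank_one e e)"
      using Q(1) by (auto simp: coprojection_def)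
    have lin: "linear (F n)" and Fp: "\<And>x. F n (rank_one x x) \<ge> 0"
      using Fpos[of n] by (auto simp: positive_form_def)
    have "0 \<le> F n (\<Sum>e\<leftarrow>es. rank_one e e)"
      by (induction es) (simp_all add: linear_0[OF lin] linear_add[OF lin] Fp)
    also have "\<dots> = f (id_blinfun - Q) - (\<Sum>i<n. (norm (v i))\<^sup>2)"
      unfolding es[symmetric] Feq using Q(2) by (simp add: blinfun.diff_left Re_cinner_self)
    also have "f (id_blinfun - Q) \<le> f id_blinfun"
      using pos[OF accretive_coprojection[OF Q(1)]] by (simp add: linear_diff[OF f])
    finally show ?thesis by simp
  qed
  have sv: "summable (\<lambda>n. (norm (v n))\<^sup>2)"
    by (rule summableI_nonneg_bounded[OF _ partial]) simp
  define \<omega> where "\<omega> b = (\<Sum>n. cinner (blinfun_apply b (v n)) (v n))" for b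
  have \<omega>: "\<omega> \<in> predual_functionals"
    by (rule predualI[OF sv sv]) (simp add: \<omega>_def)
  have rank_one: "f (rank_one x y) = Re (\<omega> (rank_one x y))" for x y
  proof -
    have Fb: "\<bar>F n (rank_one x y)\<bar> \<le> 2 * (norm (v n))\<^sup>2 * (norm x * norm y)" for n
    proof (rule power2_le_imp_le)
      have "(F n (rank_one x y))\<^sup>2 \<le> F n (rank_one x x) * F n (rank_one y y)"
        by (rule positive_form_cauchy_schwarz[OF Fpos])
      moreover have "F n (rank_one x x) * F n (rank_one y y) \<le>
          (2 * (norm (v n))\<^sup>2 * (norm x)\<^sup>2) * (2 * (norm (v n))\<^sup>2 * (norm y)\<^sup>2)"
        using Fpos[of n] V(2)[OF Fpos, of n] unfolding v_def
        by (intro mult_mono) (auto simp: positive_form_def)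
      moreover have "(2 * (norm (v n))\<^sup>2 * (norm x)\<^sup>2) * (2 * (norm (v n))\<^sup>2 * (norm y)\<^sup>2) =
          (2 * (norm (v n))\<^sup>2 * (norm x * norm y))\<^sup>2"
        by (simp add: power_mult_distrib power2_eq_square)
      ultimately show "\<bar>F n (rank_one x y)\<bar>\<^sup>2 \<le> (2 * (norm (v n))\<^sup>2 * (norm x * norm y))\<^sup>2"
        unfolding power2_abs by linarith
    qed simp
    have "(\<lambda>n. F n (rank_one x y)) \<longlonglongrightarrow> 0"
    proof (rule Lim_null_comparison)
      show "\<forall>\<^sub>F n in sequentially. norm (F n (rank_one x y)) \<le> 2 * (norm (v n))\<^sup>2 * (norm x * norm y)"
        using Fb by simp
      have "(\<lambda>n. 2 * (norm (v n))\<^sup>2 * (norm x * norm y)) \<longlonglongrightarrow> 2 * 0 * (norm x * norm y)"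
        by (intro tendsto_mult tendsto_const summable_LIMSEQ_zero[OF sv])
      then show "(\<lambda>n. 2 * (norm (v n))\<^sup>2 * (norm x * norm y)) \<longlonglongrightarrow> 0" by simp
    qed
    then have "(\<lambda>n. f (rank_one x y) - F n (rank_one x y)) \<longlonglongrightarrow> f (rank_one x y) - 0"
      by (intro tendsto_diff tendsto_const)
    moreover have "(\<lambda>n. \<Sum>i<n. cinner (rank_one x y (v i)) (v i)) \<longlonglongrightarrow> \<omega> (rank_one x y)"
      unfolding \<omega>_def by (rule summable_LIMSEQ[OF predual_functional_summable[OF sv sv]])
    then have "(\<lambda>n. \<Sum>i<n. Re (cinner (rank_one x y (v i)) (v i))) \<longlonglongrightarrow> Re (\<omega> (rank_one x y))"
      unfolding Re_sum[symmetric] by (rule tendsto_Re)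
    ultimately show ?thesis
      unfolding Feq by (simp add: LIMSEQ_unique)
  qed
  have "f k = Re (\<omega> k)" if "k \<in> finite_rank" for k
    using that
  proof (induction rule: finite_rank_induct)
    case subspace
    show ?case
      by (rule subspaceI) (simp_all add: linear_0[OF f] linear_add[OF f] linear_scale[OF f]
          predual_zero[OF \<omega>] predual_add[OF \<omega>] predual_scaleR[OF \<omega>])
  qed (rule rank_one)
  then show ?thesis using \<omega> by blast
qed

section \<open>Dual spaces of operator spaces\<close>

definition operator_space :: "('h::complex_hilbert \<Rightarrow>\<^sub>L 'h) set \<Rightarrow> bool"
  where "operator_space X \<longleftrightarrow> X \<subseteq> bounded_ops \<and> 0 \<in> X \<and>
    (\<forall>a\<in>X. \<forall>b\<in>X. a + b \<in> X) \<and> (\<forall>c. \<forall>a\<in>X. c *\<^sub>C a \<in> X)"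

lemma operator_space_bounded: "operator_space X \<Longrightarrow> a \<in> X \<Longrightarrow> a \<in> bounded_ops"
  and operator_space_zero: "operator_space X \<Longrightarrow> 0 \<in> X"
  and operator_space_add: "operator_space X \<Longrightarrow> a \<in> X \<Longrightarrow> b \<in> X \<Longrightarrow> a + b \<in> X"
  and operator_space_scaleC: "operator_space X \<Longrightarrow> a \<in> X \<Longrightarrow> c *\<^sub>C a \<in> X"
  by (auto simp: operator_space_def)

lemma operator_space_minus: "operator_space X \<Longrightarrow> a \<in> X \<Longrightarrow> - a \<in> X"
  using operator_space_scaleC[of X a "- 1"] by (simp add: scaleC_minus_one_blinfun)

lemma operator_space_diff: "operator_space X \<Longrightarrow> a \<in> X \<Longrightarrow> b \<in> X \<Longrightarrow> a - b \<in> X"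
  using operator_space_add[of X a "- b"] operator_space_minus[of X b] by simp

lemma operator_space_scaleR: "operator_space X \<Longrightarrow> a \<in> X \<Longrightarrow> r *\<^sub>R a \<in> X"
  using operator_space_scaleC[of X a "of_real r"] by (simp add: of_real_scaleC_blinfun)

lemma unital_subalgebra_operator_space: "unital_subalgebra A \<Longrightarrow> operator_space A"
proof -
  assume A: "unital_subalgebra A"
  then have "0 *\<^sub>C id_blinfun \<in> A" unfolding unital_subalgebra_def by blast
  moreover have "0 *\<^sub>C id_blinfun = (0 :: 'a \<Rightarrow>\<^sub>L 'a)"
    using of_real_scaleC_blinfun[of 0 "id_blinfun :: 'a \<Rightarrow>\<^sub>L 'a"] by simp
  ultimately show ?thesis using A by (simp add: unital_subalgebra_def operator_space_def)
qed

lemma op_dual_add: "\<phi> \<in> op_dual X \<Longrightarrow> a \<in> X \<Longrightarrow> b \<in> X \<Longrightarrow> \<phi> (a + b) = \<phi> a + \<phi> b"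
  and op_dual_scaleC: "\<phi> \<in> op_dual X \<Longrightarrow> a \<in> X \<Longrightarrow> \<phi> (c *\<^sub>C a) = c * \<phi> a"
  and op_dual_outside: "\<phi> \<in> op_dual X \<Longrightarrow> a \<notin> X \<Longrightarrow> \<phi> a = 0"
  and op_dual_ex_bound: "\<phi> \<in> op_dual X \<Longrightarrow> \<exists>C. \<forall>x\<in>X. cmod (\<phi> x) \<le> C * norm x"
  by (auto simp: op_dual_def dual_space_def linear_functional_def)

lemma op_dual_minus: "\<phi> \<in> op_dual X \<Longrightarrow> a \<in> X \<Longrightarrow> \<phi> (- a) = - \<phi> a"
  using op_dual_scaleC[of \<phi> X a "- 1"] by (simp add: scaleC_minus_one_blinfun)

lemma op_dual_diff:
  assumes "operator_space X" "\<phi> \<in> op_dual X" "a \<in> X" "b \<in> X"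
  shows "\<phi> (a - b) = \<phi> a - \<phi> b"
  using op_dual_add[OF assms(2,3) operator_space_minus[OF assms(1,4)]] op_dual_minus[OF assms(2,4)] by simp

lemma op_dual_zero: "operator_space X \<Longrightarrow> \<phi> \<in> op_dual X \<Longrightarrow> \<phi> 0 = 0"
  using op_dual_minus[of \<phi> X 0] operator_space_zero[of X] by simp

lemma restr_in_op_dual:
  assumes X: "operator_space X"
    and "\<And>a b. a \<in> X \<Longrightarrow> b \<in> X \<Longrightarrow> f (a + b) = f a + f b"
    and "\<And>c a. a \<in> X \<Longrightarrow> f (c *\<^sub>C a) = c * f a"
    and "\<And>a. a \<in> X \<Longrightarrow> cmod (f a) \<le> C * norm a"
  shows "restr X f \<in> op_dual X"
  using assms(2-4) operator_space_add[OF X] operator_space_scaleC[OF X]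
  by (auto simp: op_dual_def dual_space_def linear_functional_def restr_def intro!: exI[of _ C])

lemma add_in_op_dual:
  assumes X: "operator_space X" and "\<phi> \<in> op_dual X" "\<psi> \<in> op_dual X"
  shows "\<phi> + \<psi> \<in> op_dual X"
proof -
  obtain C D where "\<And>x. x \<in> X \<Longrightarrow> cmod (\<phi> x) \<le> C * norm x" "\<And>x. x \<in> X \<Longrightarrow> cmod (\<psi> x) \<le> D * norm x"
    using assms op_dual_ex_bound by metis
  then have "cmod (\<phi> x + \<psi> x) \<le> (C + D) * norm x" if "x \<in> X" for x
    using norm_triangle_ineq[of "\<phi> x" "\<psi> x"] that by (fastforce simp: distrib_right)
  then have "restr X (\<lambda>a. \<phi> a + \<psi> a) \<in> op_dual X"
    using assms by (intro restr_in_op_dual) (auto simp: op_dual_add op_dual_scaleC distrib_left)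
  moreover have "restr X (\<lambda>a. \<phi> a + \<psi> a) = \<phi> + \<psi>"
    using assms by (auto simp: restr_def fun_eq_iff op_dual_outside)
  ultimately show ?thesis by simp
qed

lemma scaleC_in_op_dual:
  assumes X: "operator_space X" and "\<phi> \<in> op_dual X"
  shows "c *\<^sub>C \<phi> \<in> op_dual X"
proof -
  obtain C where "\<And>x. x \<in> X \<Longrightarrow> cmod (\<phi> x) \<le> C * norm x"
    using assms op_dual_ex_bound by metis
  then have "cmod (c * \<phi> x) \<le> (cmod c * C) * norm x" if "x \<in> X" for x
    using that by (simp add: norm_mult mult.assoc mult_left_mono)
  then have "restr X (\<lambda>a. c * \<phi> a) \<in> op_dual X"
    using assms by (intro restr_in_op_dual) (auto simp: op_dual_add op_dual_scaleC distrib_left)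
  moreover have "restr X (\<lambda>a. c * \<phi> a) = c *\<^sub>C \<phi>"
    using assms by (auto simp: restr_def fun_eq_iff op_dual_outside scaleC_fun_def scaleC_complex_def)
  ultimately show ?thesis by simp
qed

lemma op_dual_bound:
  assumes X: "operator_space X" and \<phi>: "\<phi> \<in> op_dual X" and x: "x \<in> X"
  shows "cmod (\<phi> x) \<le> dual_norm norm X \<phi> * norm x"
proof (cases "x = 0")
  case True
  then show ?thesis using op_dual_zero[OF X \<phi>] by simp
next
  case False
  obtain C where C: "\<And>x. x \<in> X \<Longrightarrow> cmod (\<phi> x) \<le> C * norm x"
    using op_dual_ex_bound[OF \<phi>] by blast
  have bdd: "bdd_above {cmod (\<phi> x) |x. x \<in> X \<and> norm x \<le> 1}"
  proof (rule bdd_aboveI)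
    fix s assume "s \<in> {cmod (\<phi> x) |x. x \<in> X \<and> norm x \<le> 1}"
    then obtain y where y: "s = cmod (\<phi> y)" "y \<in> X" "norm y \<le> 1" by blast
    have "s \<le> \<bar>C\<bar> * norm y"
      using C[OF y(2)] mult_right_mono[OF abs_ge_self[of C] norm_ge_zero[of y]] by (simp add: y(1))
    also have "\<dots> \<le> \<bar>C\<bar> * 1" using y(3) by (intro mult_left_mono) auto
    finally show "s \<le> \<bar>C\<bar>" by simp
  qed
  have "cmod (\<phi> (complex_of_real (1 / norm x) *\<^sub>C x)) \<le> dual_norm norm X \<phi>"
    unfolding dual_norm_def
  proof (rule cSup_upper[OF _ bdd])
    have "complex_of_real (1 / norm x) *\<^sub>C x \<in> X" "norm (complex_of_real (1 / norm x) *\<^sub>C x) \<le> 1"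
      using False by (simp_all add: operator_space_scaleC[OF X x] norm_scaleC_blinfun norm_divide)
    then show "cmod (\<phi> (complex_of_real (1 / norm x) *\<^sub>C x)) \<in> {cmod (\<phi> x) |x. x \<in> X \<and> norm x \<le> 1}"
      by blast
  qed
  then show ?thesis
    using False by (simp add: op_dual_scaleC[OF \<phi> x] norm_mult norm_divide field_simps)
qed

lemma dual_norm_le:
  assumes "operator_space X" "\<And>x. x \<in> X \<Longrightarrow> cmod (\<phi> x) \<le> K * norm x" "K \<ge> 0"
  shows "dual_norm norm X \<phi> \<le> K"
  unfolding dual_norm_def
proof (rule cSup_least)
  show "{cmod (\<phi> x) |x. x \<in> X \<and> norm x \<le> 1} \<noteq> {}"
    using operator_space_zero[OF assms(1)] by (auto intro!: exI[of _ 0])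
  fix s assume "s \<in> {cmod (\<phi> x) |x. x \<in> X \<and> norm x \<le> 1}"
  then obtain x where x: "s = cmod (\<phi> x)" "x \<in> X" "norm x \<le> 1" by blast
  have "s \<le> K * norm x" using assms(2)[OF x(2)] by (simp add: x(1))
  also have "\<dots> \<le> K * 1" by (rule mult_left_mono[OF x(3) assms(3)])
  finally show "s \<le> K" by simp
qed

lemma dual_norm_nonneg:
  assumes X: "operator_space X" and \<phi>: "\<phi> \<in> op_dual X"
  shows "0 \<le> dual_norm norm X \<phi>"
proof (rule ccontr)
  assume neg: "\<not> 0 \<le> dual_norm norm X \<phi>"
  have z: "\<phi> x = 0" if "x \<in> X" for x
  proof -
    have "dual_norm norm X \<phi> * norm x \<le> 0" using neg by (intro mult_nonpos_nonneg) simp_all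
    then have "cmod (\<phi> x) \<le> 0" using op_dual_bound[OF X \<phi> that] by linarith
    then show ?thesis by simp
  qed
  have "{cmod (\<phi> x) |x. x \<in> X \<and> norm x \<le> 1} = {0}"
    using operator_space_zero[OF X] by (auto simp: z intro!: exI[of _ 0])
  then show False using neg by (simp add: dual_norm_def)
qed

text \<open>The bounds prescribed for the real part \<open>f\<close> are \<open>f v \<le> Re (\<phi> a) + \<parallel>\<phi>\<parallel> \<parallel>v - a\<parallel>\<close>. The choice
  \<open>v = a\<close> makes \<open>f\<close> an extension, and \<open>a = 0\<close> gives the estimate of its norm.\<close>

lemma hahn_banach_extension:
  assumes X: "operator_space X" and Y: "operator_space Y" and XY: "X \<subseteq> Y" and \<phi>: "\<phi> \<in> op_dual X"
  shows "\<exists>\<psi>\<in>op_dual Y. (\<forall>x\<in>X. \<psi> x = \<phi> x) \<and> (\<forall>y\<in>Y. cmod (\<psi> y) \<le> dual_norm norm X \<phi> * norm y)"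
proof -
  let ?N = "dual_norm norm X \<phi>"
  have N: "?N \<ge> 0" by (rule dual_norm_nonneg[OF X \<phi>])
  define G where "G = {(v :: 'a \<Rightarrow>\<^sub>L 'a, s). \<exists>a\<in>X. Re (\<phi> a) + ?N * norm (v - a) \<le> s}"
  obtain f where f: "linear f" and fG: "\<And>v s. (v, s) \<in> G \<Longrightarrow> f v \<le> s"
  proof (rule linear_respecting_bounds[of G])
    fix v s w t assume "(v, s) \<in> G" "(w, t) \<in> G"
    then obtain a b where ab: "a \<in> X" "Re (\<phi> a) + ?N * norm (v - a) \<le> s"
      "b \<in> X" "Re (\<phi> b) + ?N * norm (w - b) \<le> t" by (auto simp: G_def)
    have "norm ((v + w) - (a + b)) \<le> norm (v - a) + norm (w - b)"
      by (rule norm_diff_triangle_ineq)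
    then have "?N * norm ((v + w) - (a + b)) \<le> ?N * norm (v - a) + ?N * norm (w - b)"
      using mult_left_mono[OF _ N] by (fastforce simp: distrib_left)
    then have "Re (\<phi> (a + b)) + ?N * norm ((v + w) - (a + b)) \<le> s + t"
      using ab by (simp add: op_dual_add[OF \<phi>])
    then show "(v + w, s + t) \<in> G"
      using operator_space_add[OF X ab(1,3)] by (auto simp: G_def)
  next
    fix v s and r :: real assume "(v, s) \<in> G" and r: "r > 0"
    then obtain a where a: "a \<in> X" "Re (\<phi> a) + ?N * norm (v - a) \<le> s" by (auto simp: G_def)
    have "\<phi> (r *\<^sub>R a) = r * \<phi> a"
      using op_dual_scaleC[OF \<phi> a(1), of "of_real r"] by (simp add: of_real_scaleC_blinfun)
    moreover have "norm (r *\<^sub>R v - r *\<^sub>R a) = r * norm (v - a)"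
      using r by (simp flip: scaleR_diff_right)
    ultimately have "Re (\<phi> (r *\<^sub>R a)) + ?N * norm (r *\<^sub>R v - r *\<^sub>R a) = r * (Re (\<phi> a) + ?N * norm (v - a))"
      by (simp add: algebra_simps)
    also have "\<dots> \<le> r * s" using a(2) r by simp
    finally show "(r *\<^sub>R v, r * s) \<in> G"
      using operator_space_scaleR[OF X a(1)] by (auto simp: G_def)
  next
    show "\<exists>s. (v, s) \<in> G" for v
      using operator_space_zero[OF X] by (auto simp: G_def)
  next
    fix s assume "(0, s) \<in> G"
    then obtain a where a: "a \<in> X" "Re (\<phi> a) + ?N * norm a \<le> s" by (auto simp: G_def)
    moreover have "- Re (\<phi> a) \<le> ?N * norm a"
      using op_dual_bound[OF X \<phi> a(1)] abs_Re_le_cmod[of "\<phi> a"] by linarith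
    ultimately show "s \<ge> 0" by linarith
  qed blast
  have le: "f a \<le> Re (\<phi> a)" if "a \<in> X" for a
    using that by (intro fG) (auto simp: G_def intro!: bexI[of _ a])
  have eq: "f a = Re (\<phi> a)" if "a \<in> X" for a
    using le[OF that] le[OF operator_space_minus[OF X that]]
    by (simp add: linear_neg[OF f] op_dual_minus[OF \<phi> that])
  have bound: "cmod (complexify f v) \<le> ?N * norm v" for v
  proof (rule norm_complexify_le[OF f])
    fix c :: complex assume "cmod c = 1"
    then show "f (c *\<^sub>C v) \<le> ?N * norm v"
      using operator_space_zero[OF X] op_dual_zero[OF X \<phi>]
      by (intro fG) (auto simp: G_def norm_scaleC_blinfun intro!: bexI[of _ 0])
  qed
  have "restr Y (complexify f) \<in> op_dual Y"
    by (rule restr_in_op_dual[OF Y, where C = ?N]) (simp_all add: complexify_add[OF f] complexify_scaleC[OF f] bound)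
  moreover have "complexify f a = \<phi> a" if "a \<in> X" for a
    using that eq[of "\<i> *\<^sub>C a"] operator_space_scaleC[OF X that, of \<i>]
    by (simp add: complexify_def complex_eq_iff eq op_dual_scaleC[OF \<phi> that])
  ultimately show ?thesis
    using XY bound by (intro bexI[of _ "restr Y (complexify f)"]) (auto simp: restr_def)
qed

section \<open>The Lebesgue decomposition\<close>

text \<open>Two functionals of the predual that agree on the finite rank operators agree on \<open>B(H)\<close>, so the
  choice is unique there; on maps that are merely real-linear the value is arbitrary.\<close>

definition normal_part :: "(('h::complex_hilbert \<Rightarrow>\<^sub>L 'h) \<Rightarrow> complex) \<Rightarrow> ('h \<Rightarrow>\<^sub>L 'h) \<Rightarrow> complex"
  where "normal_part \<phi> = (SOME \<omega>. \<omega> \<in> predual_functionals \<and> (\<forall>k\<in>finite_rank. \<phi> k = \<omega> k))"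

lemma predual_finite_rank_unique:
  assumes "\<omega> \<in> predual_functionals" "\<omega>' \<in> predual_functionals" "\<And>k. k \<in> finite_rank \<Longrightarrow> \<omega> k = \<omega>' k"
    and "a \<in> bounded_ops"
  shows "\<omega> a = \<omega>' a"
  using predual_zero_on_finite_rank[OF diff_in_predual[OF assms(1,2)] _ assms(4)] assms(3) by simp

locale operators_with_compacts =
  fixes T :: "('h::complex_hilbert \<Rightarrow>\<^sub>L 'h) set"
  assumes T: "unital_cstar_algebra T" and compacts: "compact_ops \<subseteq> T"
begin

lemma T_space: "operator_space T"
  using T by (simp add: unital_cstar_algebra_def unital_subalgebra_operator_space)

lemma T_id: "id_blinfun \<in> T"
  and T_compose: "a \<in> T \<Longrightarrow> b \<in> T \<Longrightarrow> a o\<^sub>L b \<in> T"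
  and T_adj: "a \<in> T \<Longrightarrow> adj a \<in> T"
  and T_bounded: "a \<in> T \<Longrightarrow> a \<in> bounded_ops"
  using T by (auto simp: unital_cstar_algebra_def unital_subalgebra_def)

lemma T_finite_rank: "k \<in> finite_rank \<Longrightarrow> k \<in> T"
  using compacts finite_rank_compact by blast

text \<open>A bounded functional is a combination of four positive ones, one for each of the directions
  \<open>1\<close>, \<open>\<i>\<close>, \<open>-1\<close>, \<open>-\<i>\<close>. They arise from a single extension to \<open>B\<^sup>4\<close> of the functional
  \<open>(a, \<i> a, - a, - \<i> a) \<mapsto> Re (\<phi> a)\<close>.\<close>

lemma ex_normal_part:
  assumes \<phi>: "\<phi> \<in> op_dual T"
  shows "\<exists>\<omega>. \<omega> \<in> predual_functionals \<and> (\<forall>k\<in>finite_rank. \<phi> k = \<omega> k)"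
proof -
  let ?I = "id_blinfun :: 'h \<Rightarrow>\<^sub>L 'h"
  define d :: "4 \<Rightarrow> complex"
    where "d j = (if j = 1 then 1 else if j = 2 then \<i> else if j = 3 then - 1 else - \<i>)" for j
  have d: "d 1 = 1" "d 2 = \<i>" "d 3 = - 1" "d 4 = - \<i>" by (simp_all add: d_def)
  define C where "C = 4 * dual_norm norm T \<phi>"
  have C: "C \<ge> 0" using dual_norm_nonneg[OF T_space \<phi>] by (simp add: C_def)
  \<comment> \<open>A positive \<open>f\<close> on \<open>B\<^sup>4\<close> that sends \<open>(d j a)\<close> to \<open>Re (\<phi> a)\<close> has value at most \<open>Re (\<phi> a) + C t\<close> at
    \<open>u\<close> if all \<open>u j - d j a\<close> are below \<open>t\<close>, where \<open>C\<close> bounds the value at the unit. The factor \<open>4\<close> in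
    \<open>C\<close> compares norm and numerical range.\<close>
  define G where "G = {(u :: ('h \<Rightarrow>\<^sub>L 'h) ^ 4, s). \<exists>a\<in>T. \<exists>t\<ge>0.
    (\<forall>j. accretive (t *\<^sub>R ?I - u $ j + d j *\<^sub>C a)) \<and> Re (\<phi> a) + C * t \<le> s}"
  have GI: "(u, s) \<in> G" if "a \<in> T" "t \<ge> 0" "\<And>j. accretive (t *\<^sub>R ?I - u $ j + d j *\<^sub>C a)"
    "Re (\<phi> a) + C * t \<le> s" for u s a t
    using that unfolding G_def by blast
  have GE: "\<exists>a t. a \<in> T \<and> t \<ge> 0 \<and> (\<forall>j. accretive (t *\<^sub>R ?I - u $ j + d j *\<^sub>C a)) \<and> Re (\<phi> a) + C * t \<le> s"
    if "(u, s) \<in> G" for u s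
    using that unfolding G_def by blast
  obtain f where f: "linear f" and fG: "\<And>v s. (v, s) \<in> G \<Longrightarrow> f v \<le> s"
  proof (rule linear_respecting_bounds[of G])
    fix v s w t' assume "(v, s) \<in> G" "(w, t') \<in> G"
    obtain a t where a: "a \<in> T" "t \<ge> 0" "\<forall>j. accretive (t *\<^sub>R ?I - v $ j + d j *\<^sub>C a)" "Re (\<phi> a) + C * t \<le> s"
      using GE[OF \<open>(v, s) \<in> G\<close>] by blast
    obtain b r where b: "b \<in> T" "r \<ge> 0" "\<forall>j. accretive (r *\<^sub>R ?I - w $ j + d j *\<^sub>C b)" "Re (\<phi> b) + C * r \<le> t'"
      using GE[OF \<open>(w, t') \<in> G\<close>] by blast
    show "(v + w, s + t') \<in> G"
    proof (rule GI[of "a + b" "t + r"])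
      show "accretive ((t + r) *\<^sub>R ?I - (v + w) $ j + d j *\<^sub>C (a + b))" for j
        using accretive_add[OF a(3)[rule_format, of j] b(3)[rule_format, of j]]
        by (simp add: scaleC_blinfun_add_right algebra_simps)
      show "Re (\<phi> (a + b)) + C * (t + r) \<le> s + t'"
        using a(4) b(4) by (simp add: op_dual_add[OF \<phi> a(1) b(1)] distrib_left)
    qed (use a b operator_space_add[OF T_space] in simp_all)
  next
    fix v s and r :: real assume "(v, s) \<in> G" and r: "r > 0"
    obtain a t where a: "a \<in> T" "t \<ge> 0" "\<forall>j. accretive (t *\<^sub>R ?I - v $ j + d j *\<^sub>C a)" "Re (\<phi> a) + C * t \<le> s"
      using GE[OF \<open>(v, s) \<in> G\<close>] by blast
    have r0: "r \<ge> 0" using r by simp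
    show "(r *\<^sub>R v, r * s) \<in> G"
    proof (rule GI[of "r *\<^sub>R a" "r * t"])
      have "d j *\<^sub>C (r *\<^sub>R a) = r *\<^sub>R (d j *\<^sub>C a)" for j
        by (simp add: scaleC_scaleC_blinfun mult.commute flip: of_real_scaleC_blinfun)
      then show "accretive ((r * t) *\<^sub>R ?I - (r *\<^sub>R v) $ j + d j *\<^sub>C (r *\<^sub>R a))" for j
        using accretive_scaleR[OF a(3)[rule_format, of j] r0] by (simp add: algebra_simps)
      have "\<phi> (r *\<^sub>R a) = r * \<phi> a"
        using op_dual_scaleC[OF \<phi> a(1), of "of_real r"] by (simp add: of_real_scaleC_blinfun)
      then show "Re (\<phi> (r *\<^sub>R a)) + C * (r * t) \<le> r * s"
        using mult_left_mono[OF a(4) r0] by (simp add: algebra_simps)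
    qed (use a r operator_space_scaleR[OF T_space] in simp_all)
  next
    fix v :: "('h \<Rightarrow>\<^sub>L 'h) ^ 4"
    let ?t = "\<Sum>i\<in>UNIV. norm (v $ i)"
    have "(v, Re (\<phi> 0) + C * ?t) \<in> G"
    proof (rule GI[OF operator_space_zero[OF T_space]])
      show "accretive (?t *\<^sub>R ?I - v $ j + d j *\<^sub>C 0)" for j
        using accretive_norm_diff[of "v $ j" ?t] member_le_sum[of j UNIV "\<lambda>i. norm (v $ i)"]
        by (simp add: scaleC_blinfun_zero)
    qed (simp_all add: sum_nonneg)
    then show "\<exists>s. (v, s) \<in> G" by blast
  next
    fix s assume "(0, s) \<in> G"
    then obtain a t where a: "a \<in> T" "t \<ge> 0" "\<forall>j. accretive (t *\<^sub>R ?I + d j *\<^sub>C a)" "Re (\<phi> a) + C * t \<le> s"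
      using GE[of 0 s] by auto
    have "cmod (cinner (a x) x) \<le> (2 * t) * (norm x)\<^sup>2" for x
    proof -
      have "0 \<le> t * (norm x)\<^sup>2 + Re (d j * cinner (a x) x)" for j
        using a(3)[rule_format, of j]
        by (auto simp: accretive_def blinfun.add_left blinfun.scaleR_left cinner.add_left
            cinner_scaleR_left cinner_scaleC_left Re_cinner_self)
      from this[of 1] this[of 2] this[of 3] this[of 4]
      have "\<bar>Re (cinner (a x) x)\<bar> \<le> t * (norm x)\<^sup>2" "\<bar>Im (cinner (a x) x)\<bar> \<le> t * (norm x)\<^sup>2"
        unfolding d by (simp_all add: abs_le_iff)
      then show ?thesis using cmod_le[of "cinner (a x) x"] by linarith
    qed
    then have na: "norm a \<le> 4 * t"
      using norm_le_numerical_radius[OF T_bounded[OF a(1)], of "2 * t"] a(2) by simp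
    have "- Re (\<phi> a) \<le> dual_norm norm T \<phi> * norm a"
      using op_dual_bound[OF T_space \<phi> a(1)] abs_Re_le_cmod[of "\<phi> a"] by linarith
    also have "\<dots> \<le> dual_norm norm T \<phi> * (4 * t)"
      by (rule mult_left_mono[OF na dual_norm_nonneg[OF T_space \<phi>]])
    finally show "s \<ge> 0" using a(4) by (simp add: C_def)
  qed blast
  have le: "f (\<chi> j. d j *\<^sub>C a) \<le> Re (\<phi> a)" if "a \<in> T" for a
    by (intro fG GI[of a 0]) (simp_all add: that accretive_zero)
  have eq: "Re (\<phi> a) = f (\<chi> j. d j *\<^sub>C a)" if "a \<in> T" for a
  proof -
    have "(\<chi> j. d j *\<^sub>C (- a)) = - (\<chi> j. d j *\<^sub>C a)"
      by (simp add: vec_eq_iff scaleC_blinfun_minus)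
    then show ?thesis
      using le[OF that] le[OF operator_space_minus[OF T_space that]]
      by (simp add: linear_neg[OF f] op_dual_minus[OF \<phi> that])
  qed
  define F where "F j u = f (axis j u)" for j u
  have lin: "linear (F j)" for j
  proof (rule linearI)
    have "axis j (u + w) = axis j u + axis j w" for u w :: "'h \<Rightarrow>\<^sub>L 'h"
      by (simp add: vec_eq_iff axis_def)
    then show "F j (u + w) = F j u + F j w" for u w
      by (simp add: F_def linear_add[OF f])
    have "axis j (r *\<^sub>R u) = r *\<^sub>R axis j u" for r and u :: "'h \<Rightarrow>\<^sub>L 'h"
      by (simp add: vec_eq_iff axis_def)
    then show "F j (r *\<^sub>R u) = r *\<^sub>R F j u" for r u
      by (simp add: F_def linear_scale[OF f])
  qed
  have pos: "0 \<le> F j u" if "accretive u" for j u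
  proof -
    have "F j (- u) \<le> 0"
      unfolding F_def
    proof (rule fG, rule GI[OF operator_space_zero[OF T_space] order_refl])
      show "accretive (0 *\<^sub>R ?I - axis j (- u) $ i + d i *\<^sub>C 0)" for i
        using that by (simp add: axis_def scaleC_blinfun_zero accretive_zero)
    qed (simp add: op_dual_zero[OF T_space \<phi>])
    then show ?thesis by (simp add: linear_neg[OF lin])
  qed
  have "\<exists>W. \<forall>j. W j \<in> predual_functionals \<and> (\<forall>k\<in>finite_rank. F j k = Re (W j k))"
    using positive_functional_normal_part[OF lin pos] unfolding Bex_def by (intro choice) blast
  then obtain W where W: "\<And>j. W j \<in> predual_functionals" "\<And>j k. k \<in> finite_rank \<Longrightarrow> F j k = Re (W j k)"
    by auto
  define \<omega> where "\<omega> a = d 1 * W 1 a + d 2 * W 2 a + d 3 * W 3 a + d 4 * W 4 a" for a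
  have \<omega>: "\<omega> \<in> predual_functionals"
    unfolding \<omega>_def by (intro add_in_predual scaleC_in_predual W)
  have re: "Re (\<phi> k) = Re (\<omega> k)" if k: "k \<in> finite_rank" for k
  proof -
    have "(\<chi> j. d j *\<^sub>C k) = (\<Sum>j\<in>UNIV. axis j (d j *\<^sub>C k))"
      by (simp add: vec_eq_iff axis_def)
    then have "Re (\<phi> k) = (\<Sum>j\<in>UNIV. F j (d j *\<^sub>C k))"
      by (simp add: eq[OF T_finite_rank[OF k]] linear_sum[OF f] F_def)
    then show ?thesis
      by (simp add: sum_4 \<omega>_def W(2) scaleC_finite_rank[OF k] predual_scaleC[OF W(1)])
  qed
  have "\<phi> k = \<omega> k" if k: "k \<in> finite_rank" for k
    using re[OF k] re[OF scaleC_finite_rank[OF k], of \<i>]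
    by (simp add: complex_eq_iff op_dual_scaleC[OF \<phi> T_finite_rank[OF k]] predual_scaleC[OF \<omega>])
  then show ?thesis using \<omega> by blast
qed

lemma normal_part_predual: "\<phi> \<in> op_dual T \<Longrightarrow> normal_part \<phi> \<in> predual_functionals"
  and normal_part_finite_rank: "\<phi> \<in> op_dual T \<Longrightarrow> k \<in> finite_rank \<Longrightarrow> normal_part \<phi> k = \<phi> k"
  using someI_ex[OF ex_normal_part] unfolding normal_part_def[symmetric] by auto

lemma normal_part_eqI:
  assumes "\<phi> \<in> op_dual T" "\<omega> \<in> predual_functionals" "\<And>k. k \<in> finite_rank \<Longrightarrow> \<phi> k = \<omega> k" "a \<in> bounded_ops"
  shows "normal_part \<phi> a = \<omega> a"
  by (rule predual_finite_rank_unique[OF normal_part_predual[OF assms(1)] assms(2) _ assms(4)])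
    (simp add: normal_part_finite_rank assms)

lemma normal_part_add:
  assumes "\<phi> \<in> op_dual T" "\<psi> \<in> op_dual T" "a \<in> bounded_ops"
  shows "normal_part (\<phi> + \<psi>) a = normal_part \<phi> a + normal_part \<psi> a"
  using assms by (intro normal_part_eqI add_in_op_dual T_space add_in_predual normal_part_predual)
    (simp_all add: normal_part_finite_rank)

lemma normal_part_scaleC:
  assumes "\<phi> \<in> op_dual T" "a \<in> bounded_ops"
  shows "normal_part (c *\<^sub>C \<phi>) a = c * normal_part \<phi> a"
  using assms by (intro normal_part_eqI scaleC_in_op_dual T_space scaleC_in_predual normal_part_predual)
    (simp_all add: normal_part_finite_rank scaleC_fun_def scaleC_complex_def)

lemma norm_compose_complement_le:
  assumes "coprojection Q"
  shows "norm (a o\<^sub>L (id_blinfun - Q)) \<le> norm a"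
proof -
  have "norm (a o\<^sub>L (id_blinfun - Q)) \<le> norm a * norm (id_blinfun - Q)"
    by (rule norm_blinfun_compose)
  also have "\<dots> \<le> norm a * 1"
    by (rule mult_left_mono[OF norm_coprojection_le(2)[OF assms]]) simp
  finally show ?thesis by simp
qed

text \<open>Up to a small error the value at \<open>a\<close> is that of \<open>\<phi>\<close> at the operator \<open>a (1 - Q)\<close>, whose norm is at
  most that of \<open>a\<close>.\<close>

lemma normal_part_bound:
  assumes \<phi>: "\<phi> \<in> op_dual T" and a: "a \<in> bounded_ops"
  shows "cmod (normal_part \<phi> a) \<le> dual_norm norm T \<phi> * norm a"
proof -
  let ?\<omega> = "normal_part \<phi>" and ?N = "dual_norm norm T \<phi>"
  note \<omega> = normal_part_predual[OF \<phi>]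
  have "cmod (?\<omega> a) \<le> ?N * norm a + e" if e: "e > 0" for e
  proof -
    let ?d = "e / (norm a + 1)"
    have d: "?d > 0" using e by (simp add: add_nonneg_pos)
    have de: "?d * norm a \<le> e" using e by (simp add: field_simps add_pos_nonneg)
    obtain X where "finite X" "\<And>Q. coprojection Q \<Longrightarrow> \<forall>x\<in>X. Q x = 0 \<Longrightarrow> cmod (?\<omega> (a o\<^sub>L Q)) \<le> ?d * norm a"
      using predual_small_at_infinity[OF \<omega> d] by blast
    then obtain Q where Q: "coprojection Q" "cmod (?\<omega> (a o\<^sub>L Q)) \<le> ?d * norm a"
      using ex_coprojection[of X] by blast
    let ?k = "a o\<^sub>L (id_blinfun - Q)"
    have k: "?k \<in> finite_rank"
      by (rule compose_finite_rank[OF a coprojection_complement_finite_rank[OF Q(1)]])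
    have "?\<omega> a = ?\<omega> (a o\<^sub>L Q) + ?\<omega> ?k"
      unfolding predual_add[OF \<omega>, symmetric] by simp
    also have "?\<omega> ?k = \<phi> ?k" by (rule normal_part_finite_rank[OF \<phi> k])
    finally have "cmod (?\<omega> a) \<le> cmod (?\<omega> (a o\<^sub>L Q)) + cmod (\<phi> ?k)"
      by (simp add: norm_triangle_ineq)
    moreover have "cmod (\<phi> ?k) \<le> ?N * norm ?k" by (rule op_dual_bound[OF T_space \<phi> T_finite_rank[OF k]])
    moreover have "?N * norm ?k \<le> ?N * norm a"
      by (rule mult_left_mono[OF norm_compose_complement_le[OF Q(1)] dual_norm_nonneg[OF T_space \<phi>]])
    ultimately show ?thesis using Q(2) de by linarith
  qed
  then show ?thesis by (rule field_le_epsilon)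
qed

lemma restr_predual:
  assumes \<omega>: "\<omega> \<in> predual_functionals"
  shows "restr T \<omega> \<in> op_dual T"
proof -
  obtain C where "\<And>a. cmod (\<omega> a) \<le> C * norm a" using predual_bounded[OF \<omega>] by blast
  then show ?thesis
    by (intro restr_in_op_dual[OF T_space, where C = C]) (simp_all add: predual_add[OF \<omega>] predual_scaleC[OF \<omega>])
qed

lemma normal_part_restr_predual:
  assumes "\<omega> \<in> predual_functionals" "a \<in> bounded_ops"
  shows "normal_part (restr T \<omega>) a = \<omega> a"
  using assms by (intro normal_part_eqI restr_predual) (simp_all add: restr_def T_finite_rank)

end

lemma restr_apply: "x \<in> X \<Longrightarrow> restr X f x = f x"
  by (simp add: restr_def)

lemma restr_cong: "(\<And>x. x \<in> X \<Longrightarrow> f x = g x) \<Longrightarrow> restr X f = restr X g"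
  by (auto simp: restr_def)

section \<open>Operators as elements of the bidual\<close>

lemma op_bidual_add: "\<Lambda> \<in> op_bidual X \<Longrightarrow> \<phi> \<in> op_dual X \<Longrightarrow> \<psi> \<in> op_dual X \<Longrightarrow> \<Lambda> (\<phi> + \<psi>) = \<Lambda> \<phi> + \<Lambda> \<psi>"
  and op_bidual_scaleC: "\<Lambda> \<in> op_bidual X \<Longrightarrow> \<phi> \<in> op_dual X \<Longrightarrow> \<Lambda> (c *\<^sub>C \<phi>) = c * \<Lambda> \<phi>"
  and op_bidual_ex_bound: "\<Lambda> \<in> op_bidual X \<Longrightarrow> \<exists>C. \<forall>\<phi>\<in>op_dual X. cmod (\<Lambda> \<phi>) \<le> C * dual_norm norm X \<phi>"
  by (auto simp: op_bidual_def dual_space_def linear_functional_def)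

lemma restr_in_op_bidual:
  assumes X: "operator_space X"
    and "\<And>\<phi> \<psi>. \<phi> \<in> op_dual X \<Longrightarrow> \<psi> \<in> op_dual X \<Longrightarrow> F (\<phi> + \<psi>) = F \<phi> + F \<psi>"
    and "\<And>c \<phi>. \<phi> \<in> op_dual X \<Longrightarrow> F (c *\<^sub>C \<phi>) = c * F \<phi>"
    and "\<And>\<phi>. \<phi> \<in> op_dual X \<Longrightarrow> cmod (F \<phi>) \<le> C * dual_norm norm X \<phi>"
  shows "restr (op_dual X) F \<in> op_bidual X"
  using assms(2-4) add_in_op_dual[OF X] scaleC_in_op_dual[OF X]
  by (auto simp: op_bidual_def dual_space_def linear_functional_def restr_def intro!: exI[of _ C])

text \<open>The weak-* continuous functionals are those of the predual.\<close>

lemma abs_cont_iff: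
  assumes X: "operator_space X"
  shows "\<phi> \<in> abs_cont X \<longleftrightarrow> \<phi> \<in> op_dual X \<and> (\<exists>\<omega>\<in>predual_functionals. \<forall>x\<in>X. \<omega> x = \<phi> x)"
proof
  assume "\<phi> \<in> abs_cont X"
  then obtain \<omega> where \<phi>: "\<phi> \<in> op_dual X" and \<omega>: "linear_functional bounded_ops \<omega>"
    "continuous_map weak_star euclidean \<omega>" "\<forall>x\<in>X. \<omega> x = \<phi> x" by (auto simp: abs_cont_def)
  obtain \<omega>' where "\<omega>' \<in> predual_functionals" "\<forall>a\<in>bounded_ops. \<omega> a = \<omega>' a"
    using weak_star_continuous_predual[OF \<omega>(1,2)] by auto
  then show "\<phi> \<in> op_dual X \<and> (\<exists>\<omega>\<in>predual_functionals. \<forall>x\<in>X. \<omega> x = \<phi> x)"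
    using \<phi> \<omega>(3) operator_space_bounded[OF X] by (intro conjI bexI[of _ \<omega>']) auto
next
  assume "\<phi> \<in> op_dual X \<and> (\<exists>\<omega>\<in>predual_functionals. \<forall>x\<in>X. \<omega> x = \<phi> x)"
  then obtain \<omega> where \<omega>: "\<phi> \<in> op_dual X" "\<omega> \<in> predual_functionals" "\<forall>x\<in>X. \<omega> x = \<phi> x" by auto
  have "linear_functional bounded_ops \<omega>"
    by (simp add: linear_functional_def predual_add[OF \<omega>(2)] predual_scaleC[OF \<omega>(2)])
  with \<omega> predual_weak_star_continuous[OF \<omega>(2)] show "\<phi> \<in> abs_cont X"
    by (auto simp: abs_cont_def)
qed

lemma adj_add: "a \<in> bounded_ops \<Longrightarrow> b \<in> bounded_ops \<Longrightarrow> adj (a + b) = adj a + adj b"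
  by (rule adj_eqI) (simp_all add: subspace_add[OF subspace_bounded_ops] blinfun.add_left
      cinner.add_left cinner.add_right cinner_adj_left)

lemma adj_scaleC: "a \<in> bounded_ops \<Longrightarrow> adj (c *\<^sub>C a) = cnj c *\<^sub>C adj a"
  by (rule adj_eqI) (simp_all add: scaleC_in_bounded_ops cinner_scaleC_left cinner_scaleC_right cinner_adj_left)

lemma adj_id: "adj id_blinfun = id_blinfun"
  by (rule adj_eqI) (simp_all add: id_in_bounded_ops)

lemma adj_diff:
  assumes "a \<in> bounded_ops" "b \<in> bounded_ops"
  shows "adj (a - b) = adj a - adj b"
  by (rule adj_eqI) (simp_all add: assms subspace_diff[OF subspace_bounded_ops] blinfun.diff_left
      cinner.diff_left cinner.diff_right cinner_adj_left)

lemma adj_rank_one: "adj (rank_one x y) = rank_one y x"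
proof (rule adj_eqI[OF rank_one_bounded])
  show "cinner (rank_one y x h) k = cinner h (rank_one x y k)" for h k
    using cinner_commute[of y k] by (simp add: cinner_scaleC_left cinner_scaleC_right)
qed

lemma adj_finite_rank:
  assumes "k \<in> finite_rank"
  shows "adj k \<in> finite_rank"
proof -
  from assms have "k \<in> bounded_ops \<and> adj k \<in> finite_rank"
  proof (induction rule: finite_rank_induct)
    case subspace
    have z: "adj (0 :: 'a \<Rightarrow>\<^sub>L 'a) = 0"
      by (rule adj_eqI) (simp_all add: subspace_0[OF subspace_bounded_ops])
    have r: "adj (r *\<^sub>R a) = r *\<^sub>R adj a" if "a \<in> bounded_ops" for r and a :: "'a \<Rightarrow>\<^sub>L 'a"
      using adj_scaleC[OF that, of "of_real r"] by (simp add: of_real_scaleC_blinfun)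
    show ?case
      by (rule subspaceI) (simp_all add: z r adj_add subspace_0 subspace_add subspace_scale
          subspace_bounded_ops subspace_finite_rank)
  qed (simp add: rank_one_bounded adj_rank_one rank_one_in_finite_rank)
  then show ?thesis by simp
qed

text \<open>Normal functionals are evaluated at \<open>R\<close>, and singular ones are mapped to zero. Since the finite
  rank operators form an ideal, translates of normal functionals are normal and those of singular
  ones are singular; this makes the map from \<open>R\<close> to its normal element a homomorphism of
  *-algebras.\<close>

definition normal_element :: "('h::complex_hilbert \<Rightarrow>\<^sub>L 'h) set \<Rightarrow> ('h \<Rightarrow>\<^sub>L 'h) \<Rightarrow> 'h bidual"
  where "normal_element T R = restr (op_dual T) (\<lambda>\<phi>. normal_part \<phi> R)"

context operators_with_compacts
begin

lemma normal_element_apply: "\<phi> \<in> op_dual T \<Longrightarrow> normal_element T R \<phi> = normal_part \<phi> R"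
  by (simp add: normal_element_def restr_def)

lemma normal_element_in_bidual:
  assumes R: "R \<in> bounded_ops"
  shows "normal_element T R \<in> op_bidual T"
  unfolding normal_element_def
  by (rule restr_in_op_bidual[OF T_space, where C = "norm R"])
    (use normal_part_bound[OF _ R] in \<open>simp_all add: normal_part_add[OF _ _ R] normal_part_scaleC[OF _ R] mult.commute\<close>)

lemma normal_element_diff:
  assumes "R \<in> bounded_ops" "S \<in> bounded_ops"
  shows "normal_element T R - normal_element T S = normal_element T (R - S)"
  by (auto simp: normal_element_def restr_def fun_eq_iff predual_diff[OF normal_part_predual])

lemma shift_bound:
  assumes \<phi>: "\<phi> \<in> op_dual T" and a: "a \<in> T" and b: "b \<in> T"
  shows "cmod (\<phi> (a o\<^sub>L b)) \<le> (dual_norm norm T \<phi> * norm a) * norm b"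
proof -
  have "cmod (\<phi> (a o\<^sub>L b)) \<le> dual_norm norm T \<phi> * norm (a o\<^sub>L b)"
    by (rule op_dual_bound[OF T_space \<phi> T_compose[OF a b]])
  also have "\<dots> \<le> dual_norm norm T \<phi> * (norm a * norm b)"
    by (rule mult_left_mono[OF norm_blinfun_compose dual_norm_nonneg[OF T_space \<phi>]])
  finally show ?thesis by (simp add: mult.assoc)
qed

lemma scaleC_compose: "(c *\<^sub>C a) o\<^sub>L b = c *\<^sub>C (a o\<^sub>L b)" for a b :: "'h \<Rightarrow>\<^sub>L 'h"
  by (rule blinfun_eqI) simp

lemma compose_scaleC: "a \<in> T \<Longrightarrow> a o\<^sub>L (c *\<^sub>C b) = c *\<^sub>C (a o\<^sub>L b)"
  by (rule blinfun_eqI) (simp add: bounded_opsD[OF T_bounded])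

lemma shift_in_op_dual:
  assumes \<phi>: "\<phi> \<in> op_dual T" and a: "a \<in> T"
  shows "restr T (\<lambda>b. \<phi> (a o\<^sub>L b)) \<in> op_dual T"
  by (rule restr_in_op_dual[OF T_space _ _ shift_bound[OF \<phi> a]])
    (simp_all add: op_dual_add[OF \<phi>] T_compose a compose_scaleC op_dual_scaleC[OF \<phi>])

lemma dual_norm_shift_le:
  assumes \<phi>: "\<phi> \<in> op_dual T" and a: "a \<in> T"
  shows "dual_norm norm T (restr T (\<lambda>b. \<phi> (a o\<^sub>L b))) \<le> dual_norm norm T \<phi> * norm a"
  by (rule dual_norm_le[OF T_space]) (simp_all add: restr_def shift_bound[OF \<phi> a] dual_norm_nonneg[OF T_space \<phi>])

lemma bidual_act_in_op_dual:
  assumes \<Gamma>: "\<Gamma> \<in> op_bidual T" and \<phi>: "\<phi> \<in> op_dual T"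
  shows "bidual_act T \<Gamma> \<phi> \<in> op_dual T"
proof -
  define sh where "sh a = restr T (\<lambda>b. \<phi> (a o\<^sub>L b))" for a
  obtain C where C: "\<And>\<psi>. \<psi> \<in> op_dual T \<Longrightarrow> cmod (\<Gamma> \<psi>) \<le> C * dual_norm norm T \<psi>"
    using op_bidual_ex_bound[OF \<Gamma>] by blast
  have sh: "sh a \<in> op_dual T" if "a \<in> T" for a
    unfolding sh_def by (rule shift_in_op_dual[OF \<phi> that])
  have sh_add: "sh (a + b) = sh a + sh b" if "a \<in> T" "b \<in> T" for a b
    using that by (auto simp: sh_def restr_def fun_eq_iff op_dual_add[OF \<phi>] T_compose)
  have sh_scale: "sh (c *\<^sub>C a) = c *\<^sub>C sh a" if "a \<in> T" for c a
    using that by (auto simp: sh_def restr_def fun_eq_iff scaleC_compose op_dual_scaleC[OF \<phi>] T_compose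
        scaleC_fun_def scaleC_complex_def)
  have "restr T (\<lambda>a. \<Gamma> (sh a)) \<in> op_dual T"
  proof (rule restr_in_op_dual[OF T_space])
    fix a assume a: "a \<in> T"
    have "cmod (\<Gamma> (sh a)) \<le> \<bar>C\<bar> * dual_norm norm T (sh a)"
      using C[OF sh[OF a]] mult_right_mono[OF abs_ge_self[of C] dual_norm_nonneg[OF T_space sh[OF a]]] by linarith
    also have "\<dots> \<le> \<bar>C\<bar> * (dual_norm norm T \<phi> * norm a)"
      unfolding sh_def by (rule mult_left_mono[OF dual_norm_shift_le[OF \<phi> a]]) simp
    finally show "cmod (\<Gamma> (sh a)) \<le> (\<bar>C\<bar> * dual_norm norm T \<phi>) * norm a" by (simp add: mult.assoc)
  qed (simp_all add: sh_add sh_scale sh op_bidual_add[OF \<Gamma>] op_bidual_scaleC[OF \<Gamma>])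
  then show ?thesis by (simp add: bidual_act_def sh_def)
qed

lemma right_translate_in_predual:
  assumes "\<phi> \<in> op_dual T"
  shows "(\<lambda>a. normal_part \<phi> (a o\<^sub>L R)) \<in> predual_functionals"
  using compose_in_predual[OF normal_part_predual[OF assms] id_in_bounded_ops, of R] by simp

lemma left_translate_in_predual:
  assumes "\<phi> \<in> op_dual T" "S \<in> bounded_ops"
  shows "(\<lambda>a. normal_part \<phi> (S o\<^sub>L a)) \<in> predual_functionals"
  using compose_in_predual[OF normal_part_predual[OF assms(1)] assms(2), of id_blinfun] by simp

lemma normal_part_shift:
  assumes \<phi>: "\<phi> \<in> op_dual T" and a: "a \<in> T" and R: "R \<in> bounded_ops"
  shows "normal_part (restr T (\<lambda>b. \<phi> (a o\<^sub>L b))) R = normal_part \<phi> (a o\<^sub>L R)"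
proof (rule normal_part_eqI[OF shift_in_op_dual[OF \<phi> a] left_translate_in_predual[OF \<phi> T_bounded[OF a]] _ R])
  fix k :: "'h \<Rightarrow>\<^sub>L 'h" assume k: "k \<in> finite_rank"
  show "restr T (\<lambda>b. \<phi> (a o\<^sub>L b)) k = normal_part \<phi> (a o\<^sub>L k)"
    using normal_part_finite_rank[OF \<phi> compose_finite_rank[OF T_bounded[OF a] k]] T_finite_rank[OF k]
    by (simp add: restr_def)
qed

lemma bidual_act_normal_element:
  assumes \<phi>: "\<phi> \<in> op_dual T" and R: "R \<in> bounded_ops"
  shows "bidual_act T (normal_element T R) \<phi> = restr T (\<lambda>a. normal_part \<phi> (a o\<^sub>L R))"
  unfolding bidual_act_def
  by (rule restr_cong) (simp add: normal_element_apply[OF shift_in_op_dual[OF \<phi>]] normal_part_shift[OF \<phi> _ R])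

lemma arens_normal_element:
  assumes R: "R \<in> bounded_ops" and S: "S \<in> bounded_ops"
  shows "arens T (normal_element T R) (normal_element T S) = normal_element T (R o\<^sub>L S)"
proof
  fix \<phi>
  show "arens T (normal_element T R) (normal_element T S) \<phi> = normal_element T (R o\<^sub>L S) \<phi>"
  proof (cases "\<phi> \<in> op_dual T")
    case True
    note tr = right_translate_in_predual[OF True, of S]
    show ?thesis
      using True normal_part_restr_predual[OF tr R]
      by (simp add: arens_def restr_def[of "op_dual T"] bidual_act_normal_element[OF True S]
          normal_element_apply[OF restr_predual[OF tr]] normal_element_apply[OF True])
  qed (simp add: arens_def normal_element_def restr_def)
qed

lemma bidual_star_normal_element:
  assumes R: "R \<in> bounded_ops"
  shows "bidual_star T (normal_element T R) = normal_element T (adj R)"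
proof
  fix \<phi>
  show "bidual_star T (normal_element T R) \<phi> = normal_element T (adj R) \<phi>"
  proof (cases "\<phi> \<in> op_dual T")
    case True
    let ?\<psi> = "restr T (\<lambda>a. cnj (\<phi> (adj a)))"
    have \<psi>: "?\<psi> \<in> op_dual T"
    proof (rule restr_in_op_dual[OF T_space])
      fix a assume a: "a \<in> T"
      have "cmod (\<phi> (adj a)) \<le> dual_norm norm T \<phi> * norm (adj a)"
        by (rule op_dual_bound[OF T_space True T_adj[OF a]])
      also have "\<dots> \<le> dual_norm norm T \<phi> * norm a"
        by (rule mult_left_mono[OF norm_adj_le[OF T_bounded[OF a]] dual_norm_nonneg[OF T_space True]])
      finally show "cmod (cnj (\<phi> (adj a))) \<le> dual_norm norm T \<phi> * norm a" by simp
    qed (simp_all add: adj_add adj_scaleC T_bounded op_dual_add[OF True] op_dual_scaleC[OF True] T_adj)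
    obtain \<omega> where \<omega>: "\<omega> \<in> predual_functionals" "\<forall>a\<in>bounded_ops. \<omega> a = cnj (normal_part \<phi> (adj a))"
      using adj_in_predual[OF normal_part_predual[OF True]] by (elim bexE)
    have "normal_part ?\<psi> R = \<omega> R"
    proof (rule normal_part_eqI[OF \<psi> \<omega>(1) _ R])
      fix k :: "'h \<Rightarrow>\<^sub>L 'h" assume k: "k \<in> finite_rank"
      show "?\<psi> k = \<omega> k"
        using \<omega>(2) finite_rank_bounded[OF k] T_finite_rank[OF k] normal_part_finite_rank[OF True adj_finite_rank[OF k]]
        by (simp add: restr_def)
    qed
    then show ?thesis
      using True \<omega>(2) R by (simp add: bidual_star_def restr_def[of "op_dual T"]
          normal_element_apply[OF \<psi>] normal_element_apply[OF True])
  qed (simp add: bidual_star_def normal_element_def restr_def)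
qed

lemma projection_normal_element:
  assumes "P \<in> bounded_ops" "P o\<^sub>L P = P" "adj P = P"
  shows "projection T (normal_element T P)"
  using assms by (simp add: projection_def normal_element_in_bidual arens_normal_element bidual_star_normal_element)

lemma bidual_le_normal_element:
  assumes P: "P \<in> bounded_ops" "P o\<^sub>L P = P" "adj P = P"
  shows "bidual_le T (normal_element T P) (normal_element T id_blinfun)"
proof -
  let ?R = "id_blinfun - P"
  have R: "?R \<in> bounded_ops" by (rule subspace_diff[OF subspace_bounded_ops id_in_bounded_ops P(1)])
  have "arens T (bidual_star T (normal_element T ?R)) (normal_element T ?R) = normal_element T ?R"
    using P by (simp add: bidual_star_normal_element[OF R] adj_diff id_in_bounded_ops adj_id
        arens_normal_element[OF R R])
  then show ?thesis
    unfolding bidual_le_def normal_element_diff[OF id_in_bounded_ops P(1)]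
    using normal_element_in_bidual[OF R] by (intro bexI[of _ "normal_element T ?R"]) simp_all
qed

text \<open>Both sides map \<open>\<phi>\<close> to the value of \<open>\<Lambda>\<close> at the normal part of \<open>\<phi>\<close>: on the left this is seen by approximating
  the unit by a projection \<open>P\<close> of finite rank, because \<open>b \<mapsto> \<phi> (P b)\<close> converges in norm to the normal
  part of \<open>\<phi>\<close>.\<close>

lemma normal_element_id_central:
  assumes \<Lambda>: "\<Lambda> \<in> op_bidual T"
  shows "arens T (normal_element T id_blinfun) \<Lambda> = arens T \<Lambda> (normal_element T id_blinfun)"
proof
  fix \<phi>
  show "arens T (normal_element T id_blinfun) \<Lambda> \<phi> = arens T \<Lambda> (normal_element T id_blinfun) \<phi>"
  proof (cases "\<phi> \<in> op_dual T")
    case False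
    then show ?thesis by (simp add: arens_def restr_def)
  next
    case \<phi>: True
    define \<psi> where "\<psi> = bidual_act T \<Lambda> \<phi>"
    have \<psi>: "\<psi> \<in> op_dual T" unfolding \<psi>_def by (rule bidual_act_in_op_dual[OF \<Lambda> \<phi>])
    let ?\<phi>n = "restr T (normal_part \<phi>)"
    have \<phi>n: "?\<phi>n \<in> op_dual T" by (rule restr_predual[OF normal_part_predual[OF \<phi>]])
    obtain C where C: "\<And>\<psi>. \<psi> \<in> op_dual T \<Longrightarrow> cmod (\<Lambda> \<psi>) \<le> C * dual_norm norm T \<psi>"
      using op_bidual_ex_bound[OF \<Lambda>] by blast
    have "cmod (normal_part \<psi> id_blinfun - \<Lambda> ?\<phi>n) \<le> (1 + \<bar>C\<bar>) * e" if e: "e > 0" for e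
    proof -
      obtain X where X: "finite X" "\<forall>Q a. coprojection Q \<longrightarrow> (\<forall>x\<in>X. blinfun_apply Q x = 0) \<longrightarrow>
          cmod (normal_part \<psi> (a o\<^sub>L Q)) \<le> e * norm a \<and> cmod (normal_part \<psi> (Q o\<^sub>L a)) \<le> e * norm a"
        using predual_small_at_infinity[OF normal_part_predual[OF \<psi>] e] by (elim exE conjE)
      obtain Y where Y: "finite Y" "\<forall>Q a. coprojection Q \<longrightarrow> (\<forall>x\<in>Y. blinfun_apply Q x = 0) \<longrightarrow>
          cmod (normal_part \<phi> (a o\<^sub>L Q)) \<le> e * norm a \<and> cmod (normal_part \<phi> (Q o\<^sub>L a)) \<le> e * norm a"
        using predual_small_at_infinity[OF normal_part_predual[OF \<phi>] e] by (elim exE conjE)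
      obtain Q :: "'h \<Rightarrow>\<^sub>L 'h" where Q: "coprojection Q" "\<forall>x\<in>X \<union> Y. Q x = 0"
        using ex_coprojection[of "X \<union> Y"] X(1) Y(1) by auto
      let ?P = "id_blinfun - Q"
      have P: "?P \<in> finite_rank" by (rule coprojection_complement_finite_rank[OF Q(1)])
      have "cmod (normal_part \<psi> (id_blinfun o\<^sub>L Q)) \<le> e * norm (id_blinfun :: 'h \<Rightarrow>\<^sub>L 'h)"
        using X(2) Q by blast
      also have "\<dots> \<le> e * 1" using e by (intro mult_left_mono norm_id_blinfun_le) simp
      finally have 1: "cmod (normal_part \<psi> Q) \<le> e" by simp
      have 2: "cmod (normal_part \<phi> (Q o\<^sub>L b)) \<le> e * norm b" for b
        using Y(2) Q by blast
      \<comment> \<open>Left multiplication by \<open>P\<close> turns \<open>\<phi>\<close> into a functional that is close to its normal part,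
        and \<open>\<Lambda>\<close> evaluates it to the value at \<open>P\<close> of \<open>\<psi>\<close>.\<close>
      let ?\<chi> = "restr T (\<lambda>b. normal_part \<phi> (Q o\<^sub>L b))" and ?sh = "restr T (\<lambda>b. \<phi> (?P o\<^sub>L b))"
      have \<chi>: "?\<chi> \<in> op_dual T"
        by (rule restr_predual[OF left_translate_in_predual[OF \<phi> coprojection_bounded[OF Q(1)]]])
      have sh: "?sh \<in> op_dual T" by (rule shift_in_op_dual[OF \<phi> T_finite_rank[OF P]])
      have "?\<phi>n = ?sh + ?\<chi>"
      proof
        fix b
        show "?\<phi>n b = (?sh + ?\<chi>) b"
        proof (cases "b \<in> T")
          case True
          have "normal_part \<phi> b = normal_part \<phi> (?P o\<^sub>L b) + normal_part \<phi> (Q o\<^sub>L b)"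
            unfolding predual_add[OF normal_part_predual[OF \<phi>], symmetric] by simp
          then show ?thesis
            using True normal_part_finite_rank[OF \<phi> finite_rank_compose[OF T_bounded[OF True] P]]
            by (simp only: restr_def if_True plus_fun_def)
        qed (simp add: restr_def)
      qed
      then have "\<Lambda> ?\<phi>n = \<Lambda> ?sh + \<Lambda> ?\<chi>" using op_bidual_add[OF \<Lambda> sh \<chi>] by simp
      moreover have "\<Lambda> ?sh = \<psi> ?P"
        by (simp only: \<psi>_def bidual_act_def restr_apply[OF T_finite_rank[OF P]])
      moreover have "normal_part \<psi> id_blinfun = normal_part \<psi> Q + \<psi> ?P"
        using predual_add[OF normal_part_predual[OF \<psi>], of Q ?P] normal_part_finite_rank[OF \<psi> P] by simp
      ultimately have "normal_part \<psi> id_blinfun - \<Lambda> ?\<phi>n = normal_part \<psi> Q - \<Lambda> ?\<chi>" by simp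
      moreover have "cmod (\<Lambda> ?\<chi>) \<le> \<bar>C\<bar> * e"
      proof -
        have "cmod (\<Lambda> ?\<chi>) \<le> \<bar>C\<bar> * dual_norm norm T ?\<chi>"
          using C[OF \<chi>] mult_right_mono[OF abs_ge_self[of C] dual_norm_nonneg[OF T_space \<chi>]] by linarith
        also have "\<dots> \<le> \<bar>C\<bar> * e"
          using e by (intro mult_left_mono dual_norm_le[OF T_space]) (simp_all add: restr_def 2)
        finally show ?thesis .
      qed
      moreover have "cmod (normal_part \<psi> Q - \<Lambda> ?\<chi>) \<le> cmod (normal_part \<psi> Q) + cmod (\<Lambda> ?\<chi>)"
        by (rule norm_triangle_ineq4)
      ultimately show ?thesis using 1 by (simp only: distrib_right)
    qed
    note close = this
    have "cmod (normal_part \<psi> id_blinfun - \<Lambda> ?\<phi>n) \<le> 0 + e" if "e > 0" for e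
      using close[of "e / (1 + \<bar>C\<bar>)"] that by (simp add: add_pos_nonneg)
    then have "cmod (normal_part \<psi> id_blinfun - \<Lambda> ?\<phi>n) \<le> 0" by (rule field_le_epsilon)
    then have "normal_part \<psi> id_blinfun = \<Lambda> ?\<phi>n" by simp
    then show ?thesis
      using \<phi> normal_element_apply[OF \<psi>] bidual_act_normal_element[OF \<phi> id_in_bounded_ops]
      by (simp add: arens_def restr_def[of "op_dual T"] \<psi>_def)
  qed
qed

theorem lebesgue_projection_normal_element: "lebesgue_projection T (normal_element T id_blinfun)"
  unfolding lebesgue_projection_def
proof (intro conjI ballI)
  show "projection T (normal_element T id_blinfun)"
    by (rule projection_normal_element) (simp_all add: id_in_bounded_ops adj_id)
  have act: "bidual_act T (normal_element T id_blinfun) \<phi> = restr T (normal_part \<phi>)" if "\<phi> \<in> op_dual T" for \<phi>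
    using bidual_act_normal_element[OF that id_in_bounded_ops] by simp
  show "abs_cont T = bidual_act T (normal_element T id_blinfun) ` op_dual T"
  proof (intro equalityI subsetI)
    fix \<phi> assume "\<phi> \<in> abs_cont T"
    then obtain \<omega> where \<phi>: "\<phi> \<in> op_dual T" and \<omega>: "\<omega> \<in> predual_functionals" "\<forall>x\<in>T. \<omega> x = \<phi> x"
      unfolding abs_cont_iff[OF T_space] by (elim conjE bexE)
    have "normal_part \<phi> a = \<phi> a" if a: "a \<in> T" for a
      using normal_part_eqI[OF \<phi> \<omega>(1) _ T_bounded[OF a]] \<omega>(2) T_finite_rank a by auto
    then have "restr T (normal_part \<phi>) = \<phi>"
      by (auto simp: restr_def fun_eq_iff op_dual_outside[OF \<phi>])
    then show "\<phi> \<in> bidual_act T (normal_element T id_blinfun) ` op_dual T"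
      using act[OF \<phi>] \<phi> by (intro image_eqI[of _ _ \<phi>]) simp_all
  next
    fix \<psi> assume "\<psi> \<in> bidual_act T (normal_element T id_blinfun) ` op_dual T"
    then obtain \<phi> where \<phi>: "\<phi> \<in> op_dual T" "\<psi> = restr T (normal_part \<phi>)" using act by auto
    show "\<psi> \<in> abs_cont T"
      unfolding abs_cont_iff[OF T_space] \<phi>(2)
      using restr_predual[OF normal_part_predual[OF \<phi>(1)]] normal_part_predual[OF \<phi>(1)]
      by (intro conjI bexI[of _ "normal_part \<phi>"]) (simp_all add: restr_def)
  qed
qed (rule normal_element_id_central)

lemma normal_element_id_nonzero:
  fixes x :: 'h
  assumes "x \<noteq> 0"
  shows "normal_element T id_blinfun \<noteq> 0"
proof
  assume z: "normal_element T id_blinfun = 0"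
  let ?\<omega> = "\<lambda>a. cinner (blinfun_apply a x) x"
  have "normal_element T id_blinfun (restr T ?\<omega>) = ?\<omega> id_blinfun"
    by (simp add: normal_element_apply restr_predual normal_part_restr_predual vector_functional_in_predual
        id_in_bounded_ops)
  then show False using z assms by (simp add: cinner_self)
qed

text \<open>In infinite dimension an operator of finite rank has a kernel, so that the unit has distance one
  from the finite rank operators. The functional that vanishes on the latter and has value one at
  the unit is therefore bounded on their span, and extends.\<close>

lemma ex_singular_functional:
  assumes inf_dim: "\<not> (\<exists>B :: 'h set. finite B \<and> span B = UNIV)"
  shows "\<exists>\<sigma>\<in>op_dual T. (\<forall>k\<in>finite_rank. \<sigma> k = 0) \<and> \<sigma> id_blinfun \<noteq> 0"
proof -
  let ?I = "id_blinfun :: 'h \<Rightarrow>\<^sub>L 'h"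
  have dist: "cmod c \<le> norm (k + c *\<^sub>C ?I)" if k: "k \<in> finite_rank" for k c
  proof -
    obtain Y where Y: "finite Y" "\<And>h. (\<forall>y\<in>Y. cinner h y = 0) \<Longrightarrow> k h = 0"
      using finite_rank_kernel[OF k] by auto
    obtain Q :: "'h \<Rightarrow>\<^sub>L 'h" where Q: "coprojection Q" "\<forall>y\<in>Y. Q y = 0"
      using ex_coprojection[OF Y(1)] by auto
    obtain x where x: "Q x \<noteq> 0"
      using coprojection_nonzero[OF Q(1) inf_dim] blinfun_eqI[of Q 0] by auto
    have "k (Q x) = 0" using Q by (intro Y(2)) (simp add: cinner_coprojection[OF Q(1)])
    then have "cmod c * norm (Q x) \<le> norm (k + c *\<^sub>C ?I) * norm (Q x)"
      using norm_blinfun[of "k + c *\<^sub>C ?I" "Q x"] by (simp add: blinfun.add_left norm_scaleC)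
    then show ?thesis using x by simp
  qed
  define X where "X = {k + c *\<^sub>C ?I |k c. k \<in> finite_rank}"
  define \<phi> where "\<phi> x = (SOME c. x - c *\<^sub>C ?I \<in> finite_rank)" for x
  have \<phi>: "\<phi> (k + c *\<^sub>C ?I) = c" if k: "k \<in> finite_rank" for k c
    unfolding \<phi>_def
  proof (rule some_equality)
    show "k + c *\<^sub>C ?I - c *\<^sub>C ?I \<in> finite_rank" using k by simp
    fix e assume "k + c *\<^sub>C ?I - e *\<^sub>C ?I \<in> finite_rank"
    then have "k - (k + c *\<^sub>C ?I - e *\<^sub>C ?I) \<in> finite_rank" by (rule subspace_diff[OF subspace_finite_rank k])
    moreover have "k - (k + c *\<^sub>C ?I - e *\<^sub>C ?I) + (c - e) *\<^sub>C ?I = 0"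
      by (rule blinfun_eqI) (simp add: blinfun.bilinear_simps scaleC.diff_left)
    ultimately show "e = c" using dist[of "k - (k + c *\<^sub>C ?I - e *\<^sub>C ?I)" "c - e"] by simp
  qed
  have add: "(k + c *\<^sub>C ?I) + (l + e *\<^sub>C ?I) = (k + l) + (c + e) *\<^sub>C ?I" for k l c e
    by (simp add: scaleC_blinfun_add_left)
  have scale: "e *\<^sub>C (k + c *\<^sub>C ?I) = e *\<^sub>C k + (e * c) *\<^sub>C ?I" for k c e
    by (simp add: scaleC_blinfun_add_right scaleC_scaleC_blinfun)
  note F = subspace_add[OF subspace_finite_rank] scaleC_finite_rank
  have X0: "k \<in> X" if "k \<in> finite_rank" for k
  proof -
    have "k = k + 0 *\<^sub>C ?I" by (rule blinfun_eqI) (simp add: blinfun.add_left scaleC.zero_left)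
    then show ?thesis using that unfolding X_def by blast
  qed
  have XT: "X \<subseteq> T"
    using operator_space_add[OF T_space T_finite_rank operator_space_scaleC[OF T_space T_id]] by (auto simp: X_def)
  have X: "operator_space X"
    unfolding operator_space_def
  proof (intro conjI ballI allI)
    show "X \<subseteq> bounded_ops" using XT T_bounded by blast
    show "0 \<in> X" by (rule X0[OF subspace_0[OF subspace_finite_rank]])
    show "x + y \<in> X" if "x \<in> X" "y \<in> X" for x y
      using that unfolding X_def by (clarsimp simp only: add mem_Collect_eq) (blast intro: F)
    show "c *\<^sub>C x \<in> X" if "x \<in> X" for c x
      using that unfolding X_def by (clarsimp simp only: scale mem_Collect_eq) (blast intro: F)
  qed
  have "restr X \<phi> \<in> op_dual X"
  proof (rule restr_in_op_dual[OF X, where C = 1])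
    show "\<phi> (x + y) = \<phi> x + \<phi> y" if "x \<in> X" "y \<in> X" for x y
      using that unfolding X_def by (auto simp only: add \<phi> F)
    show "\<phi> (c *\<^sub>C x) = c * \<phi> x" if "x \<in> X" for c x
      using that unfolding X_def by (auto simp only: scale \<phi> F)
    show "cmod (\<phi> x) \<le> 1 * norm x" if "x \<in> X" for x
      using that dist unfolding X_def by (auto simp: \<phi>)
  qed
  from hahn_banach_extension[OF X T_space XT this]
  obtain \<sigma> where \<sigma>: "\<sigma> \<in> op_dual T" "\<And>x. x \<in> X \<Longrightarrow> \<sigma> x = \<phi> x"
    by (auto simp: restr_apply)
  have "\<sigma> k = 0" if k: "k \<in> finite_rank" for k
    using \<sigma>(2)[OF X0[OF k]] \<phi>[OF k, of 0] of_real_scaleC_blinfun[of 0 ?I] by simp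
  moreover have "\<sigma> ?I = 1"
  proof -
    have I: "?I = 0 + 1 *\<^sub>C ?I" by (simp add: scaleC_one_blinfun)
    have "?I \<in> X" using I subspace_0[OF subspace_finite_rank] unfolding X_def by blast
    then show ?thesis using \<sigma>(2) I \<phi>[OF subspace_0[OF subspace_finite_rank], of 1] by simp
  qed
  ultimately show ?thesis using \<sigma>(1) by (intro bexI[of _ \<sigma>]) simp_all
qed

lemma normal_element_not_one:
  assumes inf_dim: "\<not> (\<exists>B :: 'h set. finite B \<and> span B = UNIV)" and R: "R \<in> bounded_ops"
  shows "normal_element T R \<noteq> bidual_one T"
proof
  assume eq: "normal_element T R = bidual_one T"
  obtain \<sigma> where \<sigma>: "\<sigma> \<in> op_dual T" "\<forall>k\<in>finite_rank. \<sigma> k = 0" "\<sigma> id_blinfun \<noteq> 0"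
    using ex_singular_functional[OF inf_dim] by auto
  have "normal_part \<sigma> R = 0"
    using normal_part_eqI[OF \<sigma>(1) zero_in_predual _ R] \<sigma>(2) by simp
  then show False
    using fun_cong[OF eq, of \<sigma>] \<sigma> by (simp add: normal_element_apply bidual_one_def restr_def)
qed

text \<open>The annihilation of \<open>A\<^sup>\<bottom>\<close> makes the value at an extension of \<open>\<eta> \<in> A\<^sup>*\<close> independent of the
  extension. Extensions that preserve the norm show that it is bounded in \<open>\<eta>\<close>.\<close>

lemma normal_element_from_subspace:
  assumes A: "operator_space A" "A \<subseteq> T" and P: "P \<in> bounded_ops"
    and ann: "\<And>\<phi>. \<phi> \<in> op_dual T \<Longrightarrow> (\<And>a. a \<in> A \<Longrightarrow> \<phi> a = 0) \<Longrightarrow> normal_part \<phi> P = 0"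
  shows "\<exists>p\<in>op_bidual A. bidual_incl A T p = normal_element T P \<and>
    (\<forall>\<phi>\<in>op_dual T. p (restr A \<phi>) = normal_part \<phi> P)"
proof -
  define E where "E \<eta> = (SOME \<psi>. \<psi> \<in> op_dual T \<and> (\<forall>x\<in>A. \<psi> x = \<eta> x) \<and>
    (\<forall>y\<in>T. cmod (\<psi> y) \<le> dual_norm norm A \<eta> * norm y))" for \<eta> :: "('h \<Rightarrow>\<^sub>L 'h) \<Rightarrow> complex"
  have E: "E \<eta> \<in> op_dual T" "x \<in> A \<Longrightarrow> E \<eta> x = \<eta> x" "y \<in> T \<Longrightarrow> cmod (E \<eta> y) \<le> dual_norm norm A \<eta> * norm y"
    if "\<eta> \<in> op_dual A" for \<eta> x y
    using someI_ex[OF hahn_banach_extension[OF A(1) T_space A(2) that, unfolded Bex_def]]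
    unfolding E_def[symmetric] by blast+
  have same: "normal_part \<phi> P = normal_part (E \<eta>) P"
    if \<eta>: "\<eta> \<in> op_dual A" and \<phi>: "\<phi> \<in> op_dual T" "\<And>x. x \<in> A \<Longrightarrow> \<phi> x = \<eta> x" for \<eta> \<phi>
  proof -
    let ?m = "(- 1) *\<^sub>C E \<eta>"
    have m: "?m \<in> op_dual T" by (rule scaleC_in_op_dual[OF T_space E(1)[OF \<eta>]])
    have "normal_part (\<phi> + ?m) P = 0"
    proof (rule ann[OF add_in_op_dual[OF T_space \<phi>(1) m]])
      show "(\<phi> + ?m) a = 0" if "a \<in> A" for a
        using \<phi>(2)[OF that] E(2)[OF \<eta> that] by (simp add: scaleC_fun_def scaleC_complex_def)
    qed
    then show ?thesis
      by (simp only: normal_part_add[OF \<phi>(1) m P] normal_part_scaleC[OF E(1)[OF \<eta>] P]) simp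
  qed
  define p where "p = restr (op_dual A) (\<lambda>\<eta>. normal_part (E \<eta>) P)"
  have restrA: "restr A \<phi> \<in> op_dual A" if \<phi>: "\<phi> \<in> op_dual T" for \<phi>
    by (rule restr_in_op_dual[OF A(1), where C = "dual_norm norm T \<phi>"])
      (simp_all add: subsetD[OF A(2)] op_dual_bound[OF T_space \<phi>] op_dual_add[OF \<phi>] op_dual_scaleC[OF \<phi>])
  have p: "p (restr A \<phi>) = normal_part \<phi> P" if \<phi>: "\<phi> \<in> op_dual T" for \<phi>
  proof -
    have "normal_part \<phi> P = normal_part (E (restr A \<phi>)) P"
      by (rule same[OF restrA[OF \<phi>] \<phi>]) (simp add: restr_def)
    then show ?thesis using restrA[OF \<phi>] by (simp add: p_def restr_def[of "op_dual A"])
  qed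
  have "p \<in> op_bidual A"
    unfolding p_def
  proof (rule restr_in_op_bidual[OF A(1)])
    fix \<eta> \<xi> assume \<eta>: "\<eta> \<in> op_dual A" and \<xi>: "\<xi> \<in> op_dual A"
    have "normal_part (E \<eta> + E \<xi>) P = normal_part (E (\<eta> + \<xi>)) P"
      by (rule same[OF add_in_op_dual[OF A(1) \<eta> \<xi>] add_in_op_dual[OF T_space E(1)[OF \<eta>] E(1)[OF \<xi>]]])
        (simp add: E(2)[OF \<eta>] E(2)[OF \<xi>])
    then show "normal_part (E (\<eta> + \<xi>)) P = normal_part (E \<eta>) P + normal_part (E \<xi>) P"
      by (simp add: normal_part_add[OF E(1)[OF \<eta>] E(1)[OF \<xi>] P])
  next
    fix c \<eta> assume \<eta>: "\<eta> \<in> op_dual A"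
    have "normal_part (c *\<^sub>C E \<eta>) P = normal_part (E (c *\<^sub>C \<eta>)) P"
      by (rule same[OF scaleC_in_op_dual[OF A(1) \<eta>] scaleC_in_op_dual[OF T_space E(1)[OF \<eta>]]])
        (simp add: E(2)[OF \<eta>] scaleC_fun_def scaleC_complex_def)
    then show "normal_part (E (c *\<^sub>C \<eta>)) P = c * normal_part (E \<eta>) P"
      by (simp add: normal_part_scaleC[OF E(1)[OF \<eta>] P])
  next
    fix \<eta> assume \<eta>: "\<eta> \<in> op_dual A"
    have "dual_norm norm T (E \<eta>) \<le> dual_norm norm A \<eta>"
      by (rule dual_norm_le[OF T_space E(3)[OF \<eta>] dual_norm_nonneg[OF A(1) \<eta>]])
    then show "cmod (normal_part (E \<eta>) P) \<le> norm P * dual_norm norm A \<eta>"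
      using normal_part_bound[OF E(1)[OF \<eta>] P] mult_right_mono[of "dual_norm norm T (E \<eta>)" "dual_norm norm A \<eta>" "norm P"]
      by (simp add: mult.commute)
  qed
  moreover have "bidual_incl A T p = normal_element T P"
    by (auto simp: bidual_incl_def normal_element_def restr_def[of "op_dual T"] p)
  ultimately show ?thesis using p by (intro bexI[of _ p]) auto
qed

end

section \<open>Absolutely continuous characters\<close>

definition operator_power :: "('h::real_normed_vector \<Rightarrow>\<^sub>L 'h) \<Rightarrow> nat \<Rightarrow> 'h \<Rightarrow>\<^sub>L 'h"
  where "operator_power a n = ((o\<^sub>L) a ^^ n) id_blinfun"

lemma operator_power_0 [simp]: "operator_power a 0 = id_blinfun"
  and operator_power_Suc [simp]: "operator_power a (Suc n) = a o\<^sub>L operator_power a n"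
  by (simp_all add: operator_power_def)

lemma norm_operator_power_le:
  assumes "norm a \<le> B"
  shows "norm (operator_power a n) \<le> B ^ n"
proof (induction n)
  case 0
  show ?case by (simp add: norm_id_blinfun_le)
next
  case (Suc n)
  have "norm (a o\<^sub>L operator_power a n) \<le> norm a * norm (operator_power a n)"
    by (rule norm_blinfun_compose)
  also have "\<dots> \<le> B * B ^ n"
    by (intro mult_mono assms Suc.IH order_trans[OF norm_ge_zero assms] norm_ge_zero)
  finally show ?case by simp
qed

lemma operator_power_in: "id_blinfun \<in> A \<Longrightarrow> (\<And>b. b \<in> A \<Longrightarrow> a o\<^sub>L b \<in> A) \<Longrightarrow> operator_power a n \<in> A"
  by (induction n) simp_all

lemma blinfun_compose_assoc: "(a o\<^sub>L b) o\<^sub>L c = a o\<^sub>L (b o\<^sub>L c)"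
  by (rule blinfun_eqI) simp

lemma operator_power_commute: "operator_power a n o\<^sub>L a = a o\<^sub>L operator_power a n"
  by (induction n) (simp_all add: blinfun_compose_assoc)

lemma operator_power_finite_rank_diff:
  assumes u: "u \<in> bounded_ops" and v: "v \<in> bounded_ops" and uv: "u - v \<in> finite_rank"
  shows "operator_power u n - operator_power v n \<in> finite_rank"
proof (induction n)
  case 0
  show ?case by (simp add: subspace_0[OF subspace_finite_rank])
next
  case (Suc n)
  have "operator_power v n \<in> bounded_ops"
    using v by (intro operator_power_in id_in_bounded_ops compose_in_bounded_ops)
  then have "(u o\<^sub>L (operator_power u n - operator_power v n)) + ((u - v) o\<^sub>L operator_power v n) \<in> finite_rank"
    by (intro subspace_add[OF subspace_finite_rank] compose_finite_rank[OF u Suc.IH] finite_rank_compose uv)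
  then show ?case by simp
qed

text \<open>The square of the norm of \<open>x - s a x\<close> is expanded. For small \<open>s\<close> the term of first order decides,
  so that a lower bound on the real part of \<open>a\<close> makes \<open>1 - s a\<close> almost a contraction.\<close>

lemma norm_id_minus_le:
  fixes a :: "'h::complex_hilbert \<Rightarrow>\<^sub>L 'h"
  assumes acc: "accretive (a - r *\<^sub>R id_blinfun)" and s: "s \<ge> 0" and B: "B \<ge> 0"
    and le: "1 - 2 * s * r + s\<^sup>2 * (norm a)\<^sup>2 \<le> B\<^sup>2"
  shows "norm (id_blinfun - s *\<^sub>R a) \<le> B"
proof (rule norm_blinfun_bound[OF B])
  fix x
  have 1: "r * (norm x)\<^sup>2 \<le> Re (cinner x (a x))"
    using acc cinner_commute[of x "a x"]
    by (simp add: accretive_def blinfun.diff_left blinfun.scaleR_left cinner.diff_left cinner_scaleR_left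
        Re_cinner_self)
  have 2: "(norm (a x))\<^sup>2 \<le> (norm a)\<^sup>2 * (norm x)\<^sup>2"
    using power_mono[OF norm_blinfun[of a x], of 2] by (simp add: power_mult_distrib)
  have "(norm (x - s *\<^sub>R a x))\<^sup>2 = (norm x)\<^sup>2 + s\<^sup>2 * (norm (a x))\<^sup>2 - 2 * (s * Re (cinner x (a x)))"
    using s by (simp add: norm_diff_square cinner_scaleR_right power_mult_distrib)
  also have "\<dots> \<le> (norm x)\<^sup>2 + s\<^sup>2 * ((norm a)\<^sup>2 * (norm x)\<^sup>2) - 2 * (s * (r * (norm x)\<^sup>2))"
    using mult_left_mono[OF 1 s] mult_left_mono[OF 2, of "s\<^sup>2"] by simp
  also have "\<dots> = (1 - 2 * s * r + s\<^sup>2 * (norm a)\<^sup>2) * (norm x)\<^sup>2"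
    by (simp add: algebra_simps)
  also have "\<dots> \<le> B\<^sup>2 * (norm x)\<^sup>2"
    by (rule mult_right_mono[OF le]) simp
  finally have "(norm (x - s *\<^sub>R a x))\<^sup>2 \<le> (B * norm x)\<^sup>2" by (simp add: power_mult_distrib)
  then have "norm (x - s *\<^sub>R a x) \<le> B * norm x"
    by (rule power2_le_imp_le) (simp add: B)
  then show "norm ((id_blinfun - s *\<^sub>R a) x) \<le> B * norm x"
    by (simp add: blinfun.diff_left blinfun.scaleR_left)
qed

text \<open>If the range and the kernel were not orthogonal, a vector of the range could be shortened by adding
  an element of the kernel, although \<open>P\<close> maps the sum back to the vector.\<close>

lemma contractive_idempotent_self_adjoint:
  fixes P :: "'h::complex_hilbert \<Rightarrow>\<^sub>L 'h"
  assumes P: "P \<in> bounded_ops" and idem: "P o\<^sub>L P = P" and contr: "norm P \<le> 1"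
  shows "adj P = P"
proof -
  have PP: "P (P x) = P x" for x
    using blinfun_apply_blinfun_compose[of P P x] idem by simp
  have orth: "cinner (P x) (y - P y) = 0" for x y
  proof (rule ccontr)
    define u v where "u = P x" and "v = y - P y"
    define c where "c = cinner u v"
    assume "cinner (P x) (y - P y) \<noteq> 0"
    then have c: "c \<noteq> 0" by (simp add: c_def u_def v_def)
    then have v: "norm v > 0" by (auto simp: c_def)
    define s where "s = 1 / (norm v)\<^sup>2"
    define l where "l = - (of_real s * c)"
    have "P (u + l *\<^sub>C v) = u"
      by (simp add: blinfun.add_right bounded_opsD[OF P] u_def v_def blinfun.diff_right PP scaleC.zero_right)
    then have "norm u \<le> norm P * norm (u + l *\<^sub>C v)"
      using norm_blinfun[of P "u + l *\<^sub>C v"] by simp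
    also have "\<dots> \<le> 1 * norm (u + l *\<^sub>C v)" by (rule mult_right_mono[OF contr]) simp
    finally have "(norm u)\<^sup>2 \<le> (norm (u + l *\<^sub>C v))\<^sup>2" by (simp add: power_mono)
    also have "\<dots> = (norm u)\<^sup>2 + (cmod l * norm v)\<^sup>2 + 2 * Re (cnj l * c)"
      by (simp add: norm_add_square norm_scaleC cinner_scaleC_right c_def)
    also have "cnj l * c = - of_real (s * (cmod c)\<^sup>2)"
      using complex_norm_square[of c] by (simp add: l_def mult.commute mult.left_commute)
    also have "(cmod l * norm v)\<^sup>2 = s * (cmod c)\<^sup>2"
    proof -
      have "s > 0" "s * (norm v)\<^sup>2 = 1" using v by (simp_all add: s_def)
      moreover have "(cmod l * norm v)\<^sup>2 = s * (s * (norm v)\<^sup>2) * (cmod c)\<^sup>2"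
        using \<open>s > 0\<close> by (simp add: l_def norm_mult power2_eq_square)
      ultimately show ?thesis by simp
    qed
    finally have "s * (cmod c)\<^sup>2 \<le> 0" by simp
    moreover have "s * (cmod c)\<^sup>2 > 0" using v c by (simp add: s_def)
    ultimately show False by linarith
  qed
  have "cinner (P x) y = cinner (P x) (P y)" for x y
    using orth[of x y] by (simp add: cinner.diff_right)
  moreover from this have "cinner x (P y) = cinner (P x) (P y)" for x y
    by (metis cinner_commute)
  ultimately show ?thesis by (intro adj_eqI[OF P]) simp
qed

text \<open>The Cesaro means \<open>M n\<close> of the powers of \<open>R\<close> almost absorb \<open>R\<close>, so that a cluster point satisfies
  \<open>R P = P\<close>. Hence \<open>M n P = P\<close> for all \<open>n\<close>, and in the limit \<open>P P = P\<close>. The means start with the first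
  power, because the zeroth one would not have the property that is to be passed on to \<open>P\<close>.\<close>

lemma mean_ergodic_projection:
  fixes R :: "'h::complex_hilbert \<Rightarrow>\<^sub>L 'h"
  assumes R: "R \<in> bounded_ops" and contr: "norm R \<le> 1"
  defines "M \<equiv> \<lambda>n. (1 / real (Suc n)) *\<^sub>R (\<Sum>i<Suc n. operator_power R (Suc i))"
  obtains F P where "F \<noteq> bot" "P \<in> bounded_ops" "P o\<^sub>L P = P" "adj P = P" "\<And>n. norm (M n) \<le> 1"
    "\<And>x y. ((\<lambda>n. cinner (blinfun_apply (M n) x) y) \<longlongrightarrow> cinner (blinfun_apply P x) y) F"
proof -
  have pow: "norm (operator_power R n) \<le> 1" for n
    using norm_operator_power_le[OF contr, of n] by simp
  have powb: "operator_power R n \<in> bounded_ops" for n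
    using R by (intro operator_power_in id_in_bounded_ops compose_in_bounded_ops)
  have Mb: "M n \<in> bounded_ops" for n
    unfolding M_def by (intro subspace_scale[OF subspace_bounded_ops] subspace_sum[OF subspace_bounded_ops] powb)
  have Mn: "norm (M n) \<le> 1" for n
  proof -
    have "norm (\<Sum>i<Suc n. operator_power R (Suc i)) \<le> (\<Sum>i<Suc n. 1)"
      by (rule order_trans[OF norm_sum sum_mono[OF pow]])
    then show ?thesis unfolding M_def by (simp add: divide_le_eq)
  qed
  obtain F P where F: "F \<noteq> bot" "F \<le> sequentially" and P: "P \<in> bounded_ops" "norm P \<le> 1"
    and lim: "\<And>x y. ((\<lambda>n. cinner (M n x) y) \<longlongrightarrow> cinner (P x) y) F"
    by (rule weak_operator_cluster_point[of M 1, OF Mb Mn]) blast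
  have shift: "norm ((R o\<^sub>L M n) - M n) \<le> 2 * (1 / real (Suc n))" for n
  proof -
    have "(R o\<^sub>L (\<Sum>i<m. operator_power R (Suc i))) - (\<Sum>i<m. operator_power R (Suc i))
        = operator_power R (Suc m) - R" for m
      by (induction m) (simp_all add: algebra_simps)
    then have eq: "(R o\<^sub>L M n) - M n = (1 / real (Suc n)) *\<^sub>R (operator_power R (Suc (Suc n)) - R)"
      unfolding M_def by (simp only: compose_linear scaleR_diff_right[symmetric])
    have "norm (operator_power R (Suc (Suc n)) - R) \<le> 2"
      using norm_triangle_ineq4[of "operator_power R (Suc (Suc n))" R] pow[of "Suc (Suc n)"] contr by linarith
    then have "norm (operator_power R (Suc (Suc n)) - R) * (1 / real (Suc n)) \<le> 2 * (1 / real (Suc n))"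
      by (rule mult_right_mono) simp
    then show ?thesis unfolding eq norm_scaleR by (simp only: mult.commute abs_of_nonneg zero_le_divide_1_iff of_nat_0_le_iff)
  qed
  have RP: "R (P x) = P x" for x
  proof (rule cinner_eqI)
    fix y
    have "((\<lambda>n. cinner (((R o\<^sub>L M n) - M n) x) y) \<longlongrightarrow> 0) F"
    proof (rule tendsto_mono[OF F(2)], rule Lim_null_comparison)
      have "cmod (cinner (((R o\<^sub>L M n) - M n) x) y) \<le> 2 * (1 / real (Suc n)) * (norm x * norm y)" for n
        by (rule order_trans[OF cinner_operator_bound mult_right_mono[OF shift]]) simp
      then show "\<forall>\<^sub>F n in sequentially. cmod (cinner (((R o\<^sub>L M n) - M n) x) y) \<le> 2 * (1 / real (Suc n)) * (norm x * norm y)"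
        by simp
      have "(\<lambda>n. 2 * (1 / real (Suc n)) * (norm x * norm y)) \<longlonglongrightarrow> 2 * 0 * (norm x * norm y)"
        by (intro tendsto_mult tendsto_const LIMSEQ_Suc[OF lim_1_over_n[where 'a = real]])
      then show "(\<lambda>n. 2 * (1 / real (Suc n)) * (norm x * norm y)) \<longlonglongrightarrow> 0" by simp
    qed
    moreover have "cinner (((R o\<^sub>L M n) - M n) x) y = cinner (M n x) (adj R y) - cinner (M n x) y" for n
      by (simp add: blinfun.diff_left cinner.diff_left cinner_adj_right[OF R])
    ultimately have "((\<lambda>n. cinner (M n x) (adj R y) - cinner (M n x) y) \<longlongrightarrow> 0) F" by (simp only:)
    then have "cinner (P x) (adj R y) - cinner (P x) y = 0"
      by (rule tendsto_unique[OF F(1) tendsto_diff[OF lim lim]])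
    then show "cinner (R (P x)) y = cinner (P x) y" by (simp add: cinner_adj_right[OF R])
  qed
  have powP: "operator_power R n (P x) = P x" for n x
    by (induction n) (simp_all add: RP)
  have MP: "M n (P x) = P x" for n x
  proof -
    have "(\<Sum>i<m. operator_power R (Suc i)) (P x) = real m *\<^sub>R P x" for m
      by (induction m) (simp_all add: blinfun.add_left powP RP scaleR_left_distrib)
    from this[of "Suc n"] show ?thesis unfolding M_def by (simp add: blinfun.scaleR_left)
  qed
  have "P (P x) = P x" for x
  proof (rule cinner_eqI)
    show "cinner (P (P x)) y = cinner (P x) y" for y
      using tendsto_unique[OF F(1) lim[of "P x" y], of "cinner (P x) y"] by (simp add: MP)
  qed
  then have idem: "P o\<^sub>L P = P" by (intro blinfun_eqI) simp
  show ?thesis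
    by (rule that[OF F(1) P(1) idem contractive_idempotent_self_adjoint[OF P(1) idem P(2)] Mn lim])
qed

lemma dual_norm_eq_one:
  assumes X: "operator_space X" and \<phi>: "\<phi> \<in> op_dual X" and "id_blinfun \<in> X" "\<phi> id_blinfun = 1"
    and le: "\<And>x. x \<in> X \<Longrightarrow> cmod (\<phi> x) \<le> norm x"
  shows "dual_norm norm X \<phi> = 1"
proof (rule antisym)
  show "dual_norm norm X \<phi> \<le> 1"
    using le by (intro dual_norm_le[OF X]) simp_all
  have "1 \<le> dual_norm norm X \<phi> * norm (id_blinfun :: 'a \<Rightarrow>\<^sub>L 'a)"
    using op_dual_bound[OF X \<phi> assms(3)] assms(4) by simp
  also have "\<dots> \<le> dual_norm norm X \<phi> * 1"
    by (rule mult_left_mono[OF norm_id_blinfun_le dual_norm_nonneg[OF X \<phi>]])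
  finally show "1 \<le> dual_norm norm X \<phi>" by simp
qed

locale bounded_character =
  fixes A :: "('h::complex_hilbert \<Rightarrow>\<^sub>L 'h) set" and \<kappa> :: "('h \<Rightarrow>\<^sub>L 'h) \<Rightarrow> complex"
  assumes A: "unital_subalgebra A" and \<kappa>: "\<kappa> \<in> op_dual A" and char: "character A \<kappa>"
begin

lemma A_space: "operator_space A"
  by (rule unital_subalgebra_operator_space[OF A])

lemma A_id: "id_blinfun \<in> A"
  and A_compose: "a \<in> A \<Longrightarrow> b \<in> A \<Longrightarrow> a o\<^sub>L b \<in> A"
  using A by (auto simp: unital_subalgebra_def)

lemma \<kappa>_id: "\<kappa> id_blinfun = 1"
  and \<kappa>_compose: "a \<in> A \<Longrightarrow> b \<in> A \<Longrightarrow> \<kappa> (a o\<^sub>L b) = \<kappa> a * \<kappa> b"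
  using char by (auto simp: character_def)

lemma \<kappa>_scaleR: "a \<in> A \<Longrightarrow> \<kappa> (r *\<^sub>R a) = r * \<kappa> a"
  using op_dual_scaleC[OF \<kappa>, of a "of_real r"] by (simp add: of_real_scaleC_blinfun)

lemma A_power: "a \<in> A \<Longrightarrow> operator_power a n \<in> A"
  by (intro operator_power_in A_id A_compose)

lemma \<kappa>_power: "a \<in> A \<Longrightarrow> \<kappa> (operator_power a n) = \<kappa> a ^ n"
  by (induction n) (simp_all add: \<kappa>_id \<kappa>_compose A_power)

text \<open>A bounded character is contractive, because the bound also holds for all powers.\<close>

lemma \<kappa>_contractive:
  assumes a: "a \<in> A"
  shows "cmod (\<kappa> a) \<le> norm a"
proof (rule ccontr)
  let ?N = "dual_norm norm A \<kappa>"
  assume "\<not> cmod (\<kappa> a) \<le> norm a"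
  then have less: "norm a < cmod (\<kappa> a)" by simp
  have "a \<noteq> 0" using less op_dual_zero[OF A_space \<kappa>] by auto
  then have na: "norm a > 0" by simp
  have pow: "(cmod (\<kappa> a) / norm a) ^ n \<le> ?N" for n
  proof -
    have "cmod (\<kappa> a) ^ n = cmod (\<kappa> (operator_power a n))" by (simp add: \<kappa>_power[OF a] norm_power)
    also have "\<dots> \<le> ?N * norm (operator_power a n)" by (rule op_dual_bound[OF A_space \<kappa> A_power[OF a]])
    also have "\<dots> \<le> ?N * norm a ^ n"
      by (rule mult_left_mono[OF norm_operator_power_le[OF order_refl] dual_norm_nonneg[OF A_space \<kappa>]])
    finally show ?thesis using na by (simp add: power_divide divide_le_eq)
  qed
  have "1 < cmod (\<kappa> a) / norm a" using less na by simp
  then obtain n where "?N < (cmod (\<kappa> a) / norm a) ^ n" using real_arch_pow by blast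
  then show False using pow[of n] by simp
qed

text \<open>If \<open>a\<close> is accretive then \<open>\<parallel>1 - s a\<parallel>\<close> exceeds one only to second order in \<open>s\<close>, whereas
  \<open>\<bar>1 - s \<kappa>(a)\<bar>\<close> would do so to first order if the real part of \<open>\<kappa>(a)\<close> were negative.\<close>

lemma \<kappa>_accretive:
  assumes a: "a \<in> A" and acc: "accretive a"
  shows "0 \<le> Re (\<kappa> a)"
proof (rule ccontr)
  assume neg: "\<not> 0 \<le> Re (\<kappa> a)"
  have le: "- 2 * Re (\<kappa> a) \<le> s * (norm a)\<^sup>2" if s: "s > 0" for s
  proof -
    let ?B = "sqrt (1 + s\<^sup>2 * (norm a)\<^sup>2)"
    have "norm (id_blinfun - s *\<^sub>R a) \<le> ?B"
      by (rule norm_id_minus_le[where r = 0]) (use acc s in simp_all)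
    moreover have "cmod (\<kappa> (id_blinfun - s *\<^sub>R a)) \<le> norm (id_blinfun - s *\<^sub>R a)"
      by (intro \<kappa>_contractive operator_space_diff[OF A_space] A_id operator_space_scaleR[OF A_space] a)
    moreover have "\<kappa> (id_blinfun - s *\<^sub>R a) = 1 - s * \<kappa> a"
      by (simp add: op_dual_diff[OF A_space \<kappa>] A_id operator_space_scaleR[OF A_space a] \<kappa>_id \<kappa>_scaleR[OF a])
    moreover have "1 - s * Re (\<kappa> a) \<le> cmod (1 - s * \<kappa> a)"
      using complex_Re_le_cmod[of "1 - s * \<kappa> a"] by simp
    ultimately have "1 - s * Re (\<kappa> a) \<le> ?B" by simp
    moreover have "1 - s * Re (\<kappa> a) \<ge> 0"
      using neg s mult_nonneg_nonpos[of s "Re (\<kappa> a)"] by simp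
    ultimately have "(1 - s * Re (\<kappa> a))\<^sup>2 \<le> ?B\<^sup>2" by (rule power_mono)
    also have "?B\<^sup>2 = 1 + s\<^sup>2 * (norm a)\<^sup>2" by simp
    finally have "- 2 * (s * Re (\<kappa> a)) \<le> s\<^sup>2 * (norm a)\<^sup>2 - (s * Re (\<kappa> a))\<^sup>2"
      by (simp add: power2_diff)
    also have "\<dots> \<le> s\<^sup>2 * (norm a)\<^sup>2" by simp
    finally have "s * (- 2 * Re (\<kappa> a)) \<le> s * (s * (norm a)\<^sup>2)" by (simp add: power2_eq_square algebra_simps)
    then show ?thesis using s by (rule mult_left_le_imp_le)
  qed
  have pos: "(norm a)\<^sup>2 + 1 > 0" by (simp add: add_nonneg_pos)
  then have "- Re (\<kappa> a) / ((norm a)\<^sup>2 + 1) > 0" using neg by (intro divide_pos_pos) simp_all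
  from le[OF this] have "- 2 * Re (\<kappa> a) \<le> - Re (\<kappa> a) * ((norm a)\<^sup>2 / ((norm a)\<^sup>2 + 1))" by simp
  also have "\<dots> \<le> - Re (\<kappa> a) * 1"
    using neg pos by (intro mult_left_mono) (simp_all add: divide_le_eq)
  finally show False using neg by simp
qed

end

locale gleason_whitney_character = operators_with_compacts T + bounded_character A \<kappa>
  for T A :: "('h::complex_hilbert \<Rightarrow>\<^sub>L 'h) set" and \<kappa> +
  assumes AT: "A \<subseteq> T" and \<kappa>_ac: "\<kappa> \<in> abs_cont A" and GW: "gleason_whitney A T"
begin

text \<open>This is the dual form of the Gleason-Whitney property. If there is no such \<open>a\<close>, the Hahn-Banach
  theorem gives a functional of norm one that extends \<open>\<kappa>\<close> and has real part at least \<open>\<epsilon>\<close> at all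
  coprojections. It has to be weak-* continuous, but then it is small at suitable coprojections.\<close>

lemma accretive_peak:
  assumes \<epsilon>: "\<epsilon> > 0"
  shows "\<exists>a\<in>A. \<exists>k\<in>finite_rank. accretive a \<and> accretive (a + k - id_blinfun) \<and> Re (\<kappa> a) < \<epsilon>"
proof (rule ccontr)
  let ?I = "id_blinfun :: 'h \<Rightarrow>\<^sub>L 'h"
  assume "\<not> ?thesis"
  then have H: "\<epsilon> \<le> Re (\<kappa> a)" if "a \<in> A" "k \<in> finite_rank" "accretive a" "accretive (a + k - ?I)" for a k
    using that by (meson not_le)
  note A0 = operator_space_zero[OF A_space] and F0 = subspace_0[OF subspace_finite_rank]
  \<comment> \<open>Bounds with \<open>r = 0\<close> make \<open>f\<close> positive and an extension of \<open>Re \<kappa>\<close>. Those with \<open>a = 0\<close>, \<open>r = 1\<close>, \<open>b = - Q\<close> and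
    \<open>k = 1 - Q\<close> say that \<open>f\<close> is at least \<open>\<epsilon>\<close> at the coprojection \<open>Q\<close>.\<close>
  define G where "G = {(b :: 'h \<Rightarrow>\<^sub>L 'h, s). \<exists>a\<in>A. \<exists>k\<in>finite_rank. \<exists>r\<ge>0.
    accretive (a - b) \<and> accretive (a - b + k - r *\<^sub>R ?I) \<and> Re (\<kappa> a) - \<epsilon> * r \<le> s}"
  have GI: "(b, s) \<in> G" if "a \<in> A" "k \<in> finite_rank" "r \<ge> 0" "accretive (a - b)"
    "accretive (a - b + k - r *\<^sub>R ?I)" "Re (\<kappa> a) - \<epsilon> * r \<le> s" for a b k r s
    using that unfolding G_def by blast
  have GE: "\<exists>a k r. a \<in> A \<and> k \<in> finite_rank \<and> r \<ge> 0 \<and> accretive (a - b) \<and>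
    accretive (a - b + k - r *\<^sub>R ?I) \<and> Re (\<kappa> a) - \<epsilon> * r \<le> s" if "(b, s) \<in> G" for b s
    using that unfolding G_def by blast
  obtain f where f: "linear f" and fG: "\<And>v s. (v, s) \<in> G \<Longrightarrow> f v \<le> s"
  proof (rule linear_respecting_bounds[of G])
    fix v s w t assume "(v, s) \<in> G" "(w, t) \<in> G"
    obtain a k r where a: "a \<in> A" "k \<in> finite_rank" "r \<ge> 0" "accretive (a - v)"
      "accretive (a - v + k - r *\<^sub>R ?I)" "Re (\<kappa> a) - \<epsilon> * r \<le> s" using GE[OF \<open>(v, s) \<in> G\<close>] by blast
    obtain b l q where b: "b \<in> A" "l \<in> finite_rank" "q \<ge> 0" "accretive (b - w)"
      "accretive (b - w + l - q *\<^sub>R ?I)" "Re (\<kappa> b) - \<epsilon> * q \<le> t" using GE[OF \<open>(w, t) \<in> G\<close>] by blast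
    show "(v + w, s + t) \<in> G"
    proof (rule GI[of "a + b" "k + l" "r + q"])
      show "Re (\<kappa> (a + b)) - \<epsilon> * (r + q) \<le> s + t"
        using a(6) b(6) by (simp add: op_dual_add[OF \<kappa> a(1) b(1)] distrib_left)
      show "accretive (a + b - (v + w))" "accretive (a + b - (v + w) + (k + l) - (r + q) *\<^sub>R ?I)"
        using accretive_add[OF a(4) b(4)] accretive_add[OF a(5) b(5)] by (simp_all add: algebra_simps)
    qed (use a b operator_space_add[OF A_space] subspace_add[OF subspace_finite_rank] in simp_all)
  next
    fix v s and c :: real assume "(v, s) \<in> G" and c: "c > 0"
    obtain a k r where a: "a \<in> A" "k \<in> finite_rank" "r \<ge> 0" "accretive (a - v)"
      "accretive (a - v + k - r *\<^sub>R ?I)" "Re (\<kappa> a) - \<epsilon> * r \<le> s" using GE[OF \<open>(v, s) \<in> G\<close>] by blast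
    have c0: "c \<ge> 0" using c by simp
    show "(c *\<^sub>R v, c * s) \<in> G"
    proof (rule GI[of "c *\<^sub>R a" "c *\<^sub>R k" "c * r"])
      show "Re (\<kappa> (c *\<^sub>R a)) - \<epsilon> * (c * r) \<le> c * s"
        using mult_left_mono[OF a(6) c0] by (simp add: \<kappa>_scaleR[OF a(1)] algebra_simps)
      show "accretive (c *\<^sub>R a - c *\<^sub>R v)" "accretive (c *\<^sub>R a - c *\<^sub>R v + c *\<^sub>R k - (c * r) *\<^sub>R ?I)"
        using accretive_scaleR[OF a(4) c0] accretive_scaleR[OF a(5) c0] by (simp_all add: algebra_simps)
    qed (use a c0 operator_space_scaleR[OF A_space] subspace_scale[OF subspace_finite_rank] in simp_all)
  next
    show "\<exists>s. (v, s) \<in> G" for v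
      by (intro exI[of _ "Re (\<kappa> (norm v *\<^sub>R ?I))"] GI[of "norm v *\<^sub>R ?I" 0 0])
        (simp_all add: F0 accretive_norm_diff operator_space_scaleR[OF A_space A_id])
  next
    fix s assume "(0, s) \<in> G"
    obtain a k r where a: "a \<in> A" "k \<in> finite_rank" "r \<ge> 0" "accretive a"
      "accretive (a + k - r *\<^sub>R ?I)" "Re (\<kappa> a) - \<epsilon> * r \<le> s" using GE[OF \<open>(0, s) \<in> G\<close>] by auto
    show "s \<ge> 0"
    proof (cases "r = 0")
      case True
      then show ?thesis using a(6) \<kappa>_accretive[OF a(1,4)] by simp
    next
      case False
      then have r: "r > 0" using a(3) by simp
      have "\<epsilon> \<le> Re (\<kappa> ((1 / r) *\<^sub>R a))"
      proof (rule H[of _ "(1 / r) *\<^sub>R k"])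
        show "accretive ((1 / r) *\<^sub>R a)" using accretive_scaleR[OF a(4)] r by simp
        show "accretive ((1 / r) *\<^sub>R a + (1 / r) *\<^sub>R k - ?I)"
          using accretive_scaleR[OF a(5), of "1 / r"] r by (simp add: scaleR_add_right scaleR_diff_right)
      qed (use a operator_space_scaleR[OF A_space] subspace_scale[OF subspace_finite_rank] in simp_all)
      then have "\<epsilon> * r \<le> Re (\<kappa> a)" using r by (simp add: \<kappa>_scaleR[OF a(1)] field_simps)
      then show ?thesis using a(6) by simp
    qed
  qed blast
  have le: "f a \<le> Re (\<kappa> a)" if "a \<in> A" for a
    by (rule fG, rule GI[of a 0 0]) (simp_all add: that F0 accretive_zero)
  have eq: "f a = Re (\<kappa> a)" if "a \<in> A" for a
    using le[OF that] le[OF operator_space_minus[OF A_space that]]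
    by (simp add: linear_neg[OF f] op_dual_minus[OF \<kappa> that])
  have ext: "complexify f a = \<kappa> a" if "a \<in> A" for a
    using that eq[of "\<i> *\<^sub>C a"] operator_space_scaleC[OF A_space that, of \<i>]
    by (simp add: complexify_def complex_eq_iff eq op_dual_scaleC[OF \<kappa> that])
  have bound: "cmod (complexify f b) \<le> 1 * norm b" for b
  proof (rule norm_complexify_le[OF f])
    fix c :: complex assume c: "cmod c = 1"
    show "f (c *\<^sub>C b) \<le> 1 * norm b"
      by (rule fG, rule GI[of "norm b *\<^sub>R ?I" 0 0])
        (simp_all add: F0 accretive_norm_diff norm_scaleC_blinfun c operator_space_scaleR[OF A_space A_id]
          \<kappa>_scaleR[OF A_id] \<kappa>_id)
  qed
  define \<psi> where "\<psi> = restr T (complexify f)"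
  have \<psi>: "\<psi> \<in> op_dual T"
    unfolding \<psi>_def
    by (rule restr_in_op_dual[OF T_space _ _ bound]) (simp_all add: complexify_add[OF f] complexify_scaleC[OF f])
  have \<psi>A: "\<psi> a = \<kappa> a" if "a \<in> A" for a
    using that AT ext by (auto simp: \<psi>_def restr_def)
  have "dual_norm norm T \<psi> = 1"
    by (rule dual_norm_eq_one[OF T_space \<psi> T_id])
      (use bound in \<open>simp_all add: \<psi>A A_id \<kappa>_id, simp add: \<psi>_def restr_def\<close>)
  moreover have "dual_norm norm A \<kappa> = 1"
    by (rule dual_norm_eq_one[OF A_space \<kappa> A_id \<kappa>_id \<kappa>_contractive])
  ultimately have "\<psi> \<in> abs_cont T"
    using GW \<kappa>_ac \<psi> \<psi>A unfolding gleason_whitney_def by metis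
  then obtain \<omega> where \<omega>: "\<omega> \<in> predual_functionals" "\<forall>x\<in>T. \<omega> x = \<psi> x"
    unfolding abs_cont_iff[OF T_space] by (elim conjE bexE)
  have "\<epsilon> / 2 > 0" using \<epsilon> by simp
  from predual_small_at_infinity[OF \<omega>(1) this]
  obtain X where X: "finite X" "\<forall>Q a. coprojection Q \<longrightarrow> (\<forall>x\<in>X. blinfun_apply Q x = 0) \<longrightarrow>
      cmod (\<omega> (a o\<^sub>L Q)) \<le> \<epsilon> / 2 * norm a \<and> cmod (\<omega> (Q o\<^sub>L a)) \<le> \<epsilon> / 2 * norm a"
    by (elim exE conjE)
  obtain Q :: "'h \<Rightarrow>\<^sub>L 'h" where Q: "coprojection Q" "\<forall>x\<in>X. Q x = 0"
    using ex_coprojection[OF X(1)] by auto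
  have P: "?I - Q \<in> finite_rank" by (rule coprojection_complement_finite_rank[OF Q(1)])
  have "f (- Q) \<le> - \<epsilon>"
    by (rule fG, rule GI[of 0 "?I - Q" 1])
      (simp_all add: A0 P accretive_coprojection[OF Q(1)] accretive_zero op_dual_zero[OF A_space \<kappa>])
  then have "\<epsilon> \<le> f Q" by (simp add: linear_neg[OF f])
  also have "f Q = Re (\<omega> Q)"
  proof -
    have "?I - (?I - Q) \<in> T" by (rule operator_space_diff[OF T_space T_id T_finite_rank[OF P]])
    then have "Q \<in> T" by simp
    then show ?thesis using \<omega>(2) by (simp add: \<psi>_def restr_def)
  qed
  also have "Re (\<omega> Q) \<le> \<epsilon> / 2 * norm ?I"
  proof -
    have "cmod (\<omega> (?I o\<^sub>L Q)) \<le> \<epsilon> / 2 * norm ?I" using X(2) Q by blast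
    then show ?thesis using complex_Re_le_cmod[of "\<omega> Q"] by simp
  qed
  also have "\<epsilon> / 2 * norm ?I \<le> \<epsilon> / 2 * 1"
    using \<epsilon> by (intro mult_left_mono norm_id_blinfun_le) simp
  finally show False using \<epsilon> by simp
qed

text \<open>The operators \<open>exp(-t a)\<close>, with \<open>a\<close> as above and \<open>t\<close> large, are contractions on which \<open>\<kappa>\<close> is close
  to one, while modulo finite rank operators their norm is at most \<open>exp(-t)\<close>. They are replaced by
  the polynomials \<open>(1 - t a / n)\<^sup>n\<close>.\<close>

lemma contractive_peak:
  assumes \<delta>: "0 < \<delta>" "\<delta> \<le> 1"
  shows "\<exists>g\<in>A. \<exists>k\<in>finite_rank. norm g \<le> 1 \<and> norm (g - k) \<le> \<delta> \<and> cmod (\<kappa> g - 1) \<le> 2 * \<delta>"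
proof -
  let ?I = "id_blinfun :: 'h \<Rightarrow>\<^sub>L 'h"
  define t where "t = 2 / \<delta>"
  have t: "t > 0" using \<delta> by (simp add: t_def)
  have "t \<le> exp t" using exp_ge_add_one_self[of t] by linarith
  then have expt: "exp (- t) \<le> \<delta> / 2"
    using t \<delta> by (simp add: exp_minus t_def field_simps)
  obtain a0 k where a0: "a0 \<in> A" "k \<in> finite_rank" "accretive a0" "accretive (a0 + k - ?I)" "Re (\<kappa> a0) < \<delta> / t"
    using accretive_peak[of "\<delta> / t"] \<delta> t by auto
  \<comment> \<open>A skew-adjoint scalar does not affect accretivity and makes the value of \<open>\<kappa>\<close> real.\<close>
  define a where "a = a0 - (\<i> * of_real (Im (\<kappa> a0))) *\<^sub>C ?I"
  define b where "b = a + k"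
  define \<alpha> where "\<alpha> = Re (\<kappa> a0)"
  have iI: "(\<i> * of_real (Im (\<kappa> a0))) *\<^sub>C ?I \<in> A" by (rule operator_space_scaleC[OF A_space A_id])
  have aA: "a \<in> A" unfolding a_def by (rule operator_space_diff[OF A_space a0(1) iI])
  have \<kappa>a: "\<kappa> a = of_real \<alpha>"
    by (simp add: a_def op_dual_diff[OF A_space \<kappa> a0(1) iI] op_dual_scaleC[OF \<kappa> A_id] \<kappa>_id \<alpha>_def complex_eq_iff)
  have acc: "accretive a" "accretive (b - 1 *\<^sub>R ?I)"
    using a0(3,4) by (simp_all add: accretive_def a_def b_def blinfun.diff_left blinfun.add_left cinner.diff_left
        cinner.add_left cinner_scaleC_left cinner_self)
  have \<alpha>: "0 \<le> \<alpha>" "\<alpha> < \<delta> / t" using \<kappa>_accretive[OF aA acc(1)] \<kappa>a a0(5) by (simp_all add: \<alpha>_def)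
  define M where "M = max (norm a) (norm b)"
  have M: "norm a \<le> M" "norm b \<le> M" "0 \<le> M" by (auto simp: M_def max_def intro: order_trans[OF norm_ge_zero])
  have ln: "ln (1 + \<delta>) > 0" using \<delta> by simp
  \<comment> \<open>With this \<open>n\<close> the errors of second order add up to a factor of at most \<open>1 + \<delta>\<close>.\<close>
  obtain n :: nat where n: "max (max 1 (t\<^sup>2 * M\<^sup>2 / (2 * ln (1 + \<delta>)))) (t * \<alpha>) < real n"
    using reals_Archimedean2 by blast
  then have n0: "real n > 0" and n1: "t\<^sup>2 * M\<^sup>2 / (2 * ln (1 + \<delta>)) < real n" and n2: "t * \<alpha> < real n" by auto
  define s where "s = t / n"
  have s: "s > 0" "real n * s = t" using t n0 by (simp_all add: s_def)
  have small: "real n * (s\<^sup>2 * M\<^sup>2 / 2) \<le> ln (1 + \<delta>)"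
  proof -
    have "real n * (s\<^sup>2 * M\<^sup>2 / 2) = t\<^sup>2 * M\<^sup>2 / (2 * real n)"
      using n0 by (simp add: s_def power2_eq_square)
    also have "\<dots> \<le> ln (1 + \<delta>)" using n1 ln n0 by (simp add: field_simps)
    finally show ?thesis .
  qed
  have exp2: "exp (real n * (s\<^sup>2 * M\<^sup>2 / 2)) \<le> 1 + \<delta>"
  proof -
    have "exp (real n * (s\<^sup>2 * M\<^sup>2 / 2)) \<le> exp (ln (1 + \<delta>))" using small by simp
    then show ?thesis using \<delta> by simp
  qed
  have est: "norm (?I - s *\<^sub>R c) \<le> exp (- (s * r) + s\<^sup>2 * M\<^sup>2 / 2)"
    if "accretive (c - r *\<^sub>R ?I)" "norm c \<le> M" for c r
  proof (rule norm_id_minus_le[OF that(1)])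
    have "1 - 2 * s * r + s\<^sup>2 * (norm c)\<^sup>2 \<le> 1 + (- (2 * s * r) + s\<^sup>2 * M\<^sup>2)"
      using that(2) by (simp add: mult_left_mono power_mono)
    also have "\<dots> \<le> exp (- (2 * s * r) + s\<^sup>2 * M\<^sup>2)" by (rule exp_ge_add_one_self)
    also have "\<dots> = (exp (- (s * r) + s\<^sup>2 * M\<^sup>2 / 2))\<^sup>2"
      by (simp add: power2_eq_square flip: exp_add)
    finally show "1 - 2 * s * r + s\<^sup>2 * (norm c)\<^sup>2 \<le> (exp (- (s * r) + s\<^sup>2 * M\<^sup>2 / 2))\<^sup>2" .
  qed (use s in simp_all)
  define g where "g = operator_power (?I - s *\<^sub>R a) n"
  define h where "h = operator_power (?I - s *\<^sub>R b) n"
  have uA: "?I - s *\<^sub>R a \<in> A"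
    by (intro operator_space_diff[OF A_space A_id] operator_space_scaleR[OF A_space aA])
  have gA: "g \<in> A" unfolding g_def by (rule A_power[OF uA])
  have "norm g \<le> (exp (- (s * 0) + s\<^sup>2 * M\<^sup>2 / 2)) ^ n"
    unfolding g_def by (rule norm_operator_power_le[OF est]) (use acc M in simp_all)
  also have "\<dots> = exp (real n * (s\<^sup>2 * M\<^sup>2 / 2))"
    by (simp only: exp_of_nat_mult mult_zero_right minus_zero add_0)
  also have "\<dots> \<le> 1 + \<delta>" by (rule exp2)
  finally have ng: "norm g \<le> 1 + \<delta>" .
  have "norm h \<le> (exp (- (s * 1) + s\<^sup>2 * M\<^sup>2 / 2)) ^ n"
    unfolding h_def by (rule norm_operator_power_le[OF est]) (use acc M in simp_all)
  also have "\<dots> = exp (real n * (- (s * 1) + s\<^sup>2 * M\<^sup>2 / 2))" by (rule exp_of_nat_mult[symmetric])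
  also have "real n * (- (s * 1) + s\<^sup>2 * M\<^sup>2 / 2) = - t + real n * (s\<^sup>2 * M\<^sup>2 / 2)"
    using s(2) by (simp add: algebra_simps)
  also have "exp (- t + real n * (s\<^sup>2 * M\<^sup>2 / 2)) = exp (- t) * exp (real n * (s\<^sup>2 * M\<^sup>2 / 2))" by (rule exp_add)
  also have "\<dots> \<le> (\<delta> / 2) * 2"
    using expt exp2 \<delta> by (intro mult_mono) auto
  finally have nh: "norm h \<le> \<delta>" by simp
  have gh: "g - h \<in> finite_rank"
    unfolding g_def h_def
  proof (rule operator_power_finite_rank_diff)
    have "(?I - s *\<^sub>R a) - (?I - s *\<^sub>R b) = s *\<^sub>R k" by (simp add: b_def algebra_simps)
    then show "(?I - s *\<^sub>R a) - (?I - s *\<^sub>R b) \<in> finite_rank"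
      using subspace_scale[OF subspace_finite_rank a0(2)] by simp
    have bb: "b \<in> bounded_ops"
      unfolding b_def by (rule subspace_add[OF subspace_bounded_ops operator_space_bounded[OF A_space aA] finite_rank_bounded[OF a0(2)]])
    show "?I - s *\<^sub>R a \<in> bounded_ops" by (rule operator_space_bounded[OF A_space uA])
    show "?I - s *\<^sub>R b \<in> bounded_ops"
      by (intro subspace_diff[OF subspace_bounded_ops] subspace_scale[OF subspace_bounded_ops] id_in_bounded_ops bb)
  qed
  have \<kappa>g: "\<kappa> g = of_real ((1 - s * \<alpha>) ^ n)"
    unfolding g_def \<kappa>_power[OF uA]
    by (simp add: op_dual_diff[OF A_space \<kappa> A_id operator_space_scaleR[OF A_space aA]] \<kappa>_id \<kappa>_scaleR[OF aA] \<kappa>a)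
  have s\<alpha>: "0 \<le> s * \<alpha>" "s * \<alpha> \<le> 1" using s \<alpha> n2 n0 by (simp_all add: s_def field_simps)
  have "1 - \<delta> \<le> 1 - t * \<alpha>" using \<alpha>(2) t by (simp add: field_simps)
  also have "\<dots> = 1 + real n * (- (s * \<alpha>))" using s(2) by (simp add: mult.assoc[symmetric])
  also have "\<dots> \<le> (1 + - (s * \<alpha>)) ^ n" by (rule Bernoulli_inequality) (use s\<alpha> in simp)
  finally have lower: "1 - \<delta> \<le> (1 - s * \<alpha>) ^ n" by simp
  have upper: "(1 - s * \<alpha>) ^ n \<le> 1" using s\<alpha> by (intro power_le_one) simp_all
  \<comment> \<open>Dividing by \<open>1 + \<delta>\<close> turns \<open>g\<close> into a contraction.\<close>
  define q where "q = 1 / (1 + \<delta>)"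
  have q: "0 \<le> q" "q \<le> 1" "q * (1 + \<delta>) = 1" using \<delta> by (simp_all add: q_def)
  show ?thesis
  proof (intro bexI conjI)
    show "q *\<^sub>R g \<in> A" by (rule operator_space_scaleR[OF A_space gA])
    show "q *\<^sub>R (g - h) \<in> finite_rank" by (rule subspace_scale[OF subspace_finite_rank gh])
    show "norm (q *\<^sub>R g) \<le> 1" using mult_left_mono[OF ng q(1)] q by simp
    have "q *\<^sub>R g - q *\<^sub>R (g - h) = q *\<^sub>R h" by (simp add: scaleR_diff_right)
    moreover have "q * norm h \<le> 1 * \<delta>" using q nh by (intro mult_mono) auto
    ultimately show "norm (q *\<^sub>R g - q *\<^sub>R (g - h)) \<le> \<delta>" using q by simp
    have "\<kappa> (q *\<^sub>R g) - 1 = of_real (q * (1 - s * \<alpha>) ^ n - 1)" by (simp add: \<kappa>_scaleR[OF gA] \<kappa>g)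
    then have "cmod (\<kappa> (q *\<^sub>R g) - 1) = \<bar>q * (1 - s * \<alpha>) ^ n - 1\<bar>" by (simp only: norm_of_real)
    moreover have "q * (1 - s * \<alpha>) ^ n \<le> 1 * 1" using q upper s\<alpha> by (intro mult_mono) simp_all
    moreover have "q * (1 - \<delta>) \<le> q * (1 - s * \<alpha>) ^ n" by (rule mult_left_mono[OF lower q(1)])
    moreover have "q * (1 - \<delta>) = 1 - 2 * (q * \<delta>)" using q(3) by (simp add: algebra_simps)
    moreover have "q * \<delta> \<le> 1 * \<delta>" using q \<delta> by (intro mult_right_mono) auto
    ultimately show "cmod (\<kappa> (q *\<^sub>R g) - 1) \<le> 2 * \<delta>" by linarith
  qed
qed

text \<open>For these operators \<open>S\<close> the element of the bidual given by \<open>S\<close> lies in \<open>A\<^sup>\<bottom>\<^sup>\<bottom>\<close> (take \<open>c = 0\<close>) and has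
  value one at \<open>\<kappa>\<close> (take \<open>c = 1\<close>). The operator \<open>b\<close> makes the property pass to products.\<close>

definition peaking :: "('h \<Rightarrow>\<^sub>L 'h) \<Rightarrow> bool"
  where "peaking S \<longleftrightarrow> S \<in> bounded_ops \<and> (\<forall>c. \<forall>\<phi>\<in>op_dual T. (\<forall>b\<in>A. \<phi> b = c * \<kappa> b) \<longrightarrow>
    (\<forall>b\<in>A. normal_part \<phi> (S o\<^sub>L b) = c * \<kappa> b))"

lemma peakingD:
  "peaking S \<Longrightarrow> \<phi> \<in> op_dual T \<Longrightarrow> (\<And>b. b \<in> A \<Longrightarrow> \<phi> b = c * \<kappa> b) \<Longrightarrow> b \<in> A \<Longrightarrow> normal_part \<phi> (S o\<^sub>L b) = c * \<kappa> b"
  by (simp add: peaking_def)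

lemma normal_part_weak_limit:
  fixes g :: "'i \<Rightarrow> 'h \<Rightarrow>\<^sub>L 'h" and R b :: "'h \<Rightarrow>\<^sub>L 'h"
  assumes \<phi>: "\<phi> \<in> op_dual T" and S: "S \<in> bounded_ops" and F: "F \<noteq> bot" and bound: "\<And>n. norm (g n) \<le> C"
    and lim: "\<And>x y. ((\<lambda>n. cinner (blinfun_apply (g n) x) y) \<longlongrightarrow> cinner (blinfun_apply R x) y) F"
  shows "((\<lambda>n. normal_part \<phi> (S o\<^sub>L g n o\<^sub>L b)) \<longlongrightarrow> normal_part \<phi> (S o\<^sub>L R o\<^sub>L b)) F"
  by (rule predual_bounded_convergence[where g = g and C = C and R = R,
        OF compose_in_predual[OF normal_part_predual[OF \<phi>] S, of b] F bound lim])

text \<open>A cluster point \<open>R\<close> of the contractions just constructed inherits their values in the limit: they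
  become small modulo finite rank, and singular parts vanish at finite rank operators. The same limit, taken behind
  an arbitrary \<open>S\<close>, shows that products with \<open>R\<close> stay peaking.\<close>

lemma ex_peaking_contraction:
  "\<exists>R. peaking R \<and> norm R \<le> 1 \<and> (\<forall>S. peaking S \<longrightarrow> peaking (S o\<^sub>L R))"
proof -
  have "\<exists>g k. g \<in> A \<and> k \<in> finite_rank \<and> norm g \<le> 1 \<and> norm (g - k) \<le> 1 / real (Suc n) \<and>
      cmod (\<kappa> g - 1) \<le> 2 * (1 / real (Suc n))" for n
    using contractive_peak[of "1 / real (Suc n)"] by auto
  then obtain g k where g: "\<And>n. g n \<in> A" "\<And>n. k n \<in> finite_rank" "\<And>n. norm (g n) \<le> 1"
    "\<And>n. norm (g n - k n) \<le> 1 / real (Suc n)" "\<And>n. cmod (\<kappa> (g n) - 1) \<le> 2 * (1 / real (Suc n))"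
    by metis
  have gb: "g n \<in> bounded_ops" for n by (rule operator_space_bounded[OF A_space g(1)])
  obtain F R where F: "F \<noteq> bot" "F \<le> sequentially" and R: "R \<in> bounded_ops" "norm R \<le> 1"
    and lim: "\<And>x y. ((\<lambda>n. cinner (g n x) y) \<longlongrightarrow> cinner (R x) y) F"
    by (rule weak_operator_cluster_point[of g 1, OF gb g(3)]) blast
  have inv: "(\<lambda>n. 1 / real (Suc n)) \<longlonglongrightarrow> 0"
    by (rule LIMSEQ_Suc[OF lim_1_over_n[where 'a = real]])
  have "(\<lambda>n. \<kappa> (g n) - 1) \<longlonglongrightarrow> 0"
    by (rule Lim_null_comparison[OF _ tendsto_mult_right_zero[OF inv, of 2]]) (use g(5) in simp)
  then have "(\<lambda>n. \<kappa> (g n) - 1 + 1) \<longlonglongrightarrow> 0 + 1" by (intro tendsto_add tendsto_const)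
  then have \<kappa>g: "((\<lambda>n. \<kappa> (g n)) \<longlongrightarrow> 1) F" by (intro tendsto_mono[OF F(2)]) simp
  have character_lim: "((\<lambda>n. c * \<kappa> (g n o\<^sub>L b)) \<longlongrightarrow> c * \<kappa> b) F" if "b \<in> A" for b c
  proof -
    have "((\<lambda>n. c * (\<kappa> (g n) * \<kappa> b)) \<longlongrightarrow> c * (1 * \<kappa> b)) F"
      by (intro tendsto_mult tendsto_const \<kappa>g)
    then show ?thesis by (simp add: \<kappa>_compose g(1) that)
  qed
  have "peaking R"
    unfolding peaking_def
  proof (intro conjI R(1) allI ballI impI)
    fix c \<phi> b assume \<phi>: "\<phi> \<in> op_dual T" and eq: "\<forall>b\<in>A. \<phi> b = c * \<kappa> b" and b: "b \<in> A"
    let ?N = "dual_norm norm T \<phi>"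
    note \<omega> = normal_part_predual[OF \<phi>]
    have bb: "b \<in> bounded_ops" by (rule operator_space_bounded[OF A_space b])
    \<comment> \<open>The singular part of \<open>\<phi>\<close> is small at \<open>g n b\<close>, as it only depends on this operator modulo
      finite rank.\<close>
    have sing: "cmod (normal_part \<phi> (g n o\<^sub>L b) - \<phi> (g n o\<^sub>L b)) \<le> (1 / real (Suc n)) * (2 * ?N * norm b)" for n
    proof -
      let ?d = "(g n - k n) o\<^sub>L b"
      have kb: "k n o\<^sub>L b \<in> finite_rank" by (rule finite_rank_compose[OF bb g(2)])
      have gbT: "g n o\<^sub>L b \<in> T" using A_compose[OF g(1) b] AT by blast
      have d: "?d = (g n o\<^sub>L b) - (k n o\<^sub>L b)" by simp
      have dT: "?d \<in> T" unfolding d by (rule operator_space_diff[OF T_space gbT T_finite_rank[OF kb]])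
      have "normal_part \<phi> (g n o\<^sub>L b) - \<phi> (g n o\<^sub>L b) = normal_part \<phi> ?d - \<phi> ?d"
        unfolding d predual_diff[OF \<omega>] op_dual_diff[OF T_space \<phi> gbT T_finite_rank[OF kb]]
        by (simp add: normal_part_finite_rank[OF \<phi> kb])
      also have "cmod \<dots> \<le> cmod (normal_part \<phi> ?d) + cmod (\<phi> ?d)" by (rule norm_triangle_ineq4)
      also have "\<dots> \<le> ?N * norm ?d + ?N * norm ?d"
        by (intro add_mono normal_part_bound[OF \<phi> T_bounded[OF dT]] op_dual_bound[OF T_space \<phi> dT])
      also have "\<dots> = 2 * ?N * norm ?d" by simp
      also have "\<dots> \<le> 2 * ?N * (1 / real (Suc n) * norm b)"
      proof (rule mult_left_mono)
        have "norm ?d \<le> norm (g n - k n) * norm b" by (rule norm_blinfun_compose)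
        also have "\<dots> \<le> 1 / real (Suc n) * norm b" by (rule mult_right_mono[OF g(4)]) simp
        finally show "norm ?d \<le> 1 / real (Suc n) * norm b" .
      qed (simp add: dual_norm_nonneg[OF T_space \<phi>])
      finally show ?thesis by (simp add: mult.commute mult.left_commute)
    qed
    have "(\<lambda>n. normal_part \<phi> (g n o\<^sub>L b) - \<phi> (g n o\<^sub>L b)) \<longlonglongrightarrow> 0"
      by (rule Lim_null_comparison[OF _ tendsto_mult_left_zero[OF inv, of "2 * ?N * norm b"]]) (use sing in simp)
    then have "((\<lambda>n. normal_part \<phi> (g n o\<^sub>L b) - \<phi> (g n o\<^sub>L b)) \<longlongrightarrow> 0) F"
      by (rule tendsto_mono[OF F(2)])
    moreover have "((\<lambda>n. \<phi> (g n o\<^sub>L b)) \<longlongrightarrow> c * \<kappa> b) F"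
      using character_lim[OF b, of c] eq A_compose[OF g(1) b] by simp
    ultimately have "((\<lambda>n. (normal_part \<phi> (g n o\<^sub>L b) - \<phi> (g n o\<^sub>L b)) + \<phi> (g n o\<^sub>L b)) \<longlongrightarrow> 0 + c * \<kappa> b) F"
      by (rule tendsto_add)
    then have "((\<lambda>n. normal_part \<phi> (g n o\<^sub>L b)) \<longlongrightarrow> c * \<kappa> b) F" by simp
    moreover have "((\<lambda>n. normal_part \<phi> (g n o\<^sub>L b)) \<longlongrightarrow> normal_part \<phi> (R o\<^sub>L b)) F"
      using normal_part_weak_limit[OF \<phi> id_in_bounded_ops F(1) g(3) lim, of b] by simp
    ultimately show "normal_part \<phi> (R o\<^sub>L b) = c * \<kappa> b" using tendsto_unique[OF F(1)] by blast
  qed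
  moreover have "peaking (S o\<^sub>L R)" if S: "peaking S" for S
    unfolding peaking_def
  proof (intro conjI allI ballI impI)
    have Sb: "S \<in> bounded_ops" using S by (simp add: peaking_def)
    then show "S o\<^sub>L R \<in> bounded_ops" by (rule compose_in_bounded_ops[OF _ R(1)])
    fix c \<phi> b assume \<phi>: "\<phi> \<in> op_dual T" and eq: "\<forall>b\<in>A. \<phi> b = c * \<kappa> b" and b: "b \<in> A"
    have "normal_part \<phi> (S o\<^sub>L g n o\<^sub>L b) = c * \<kappa> (g n o\<^sub>L b)" for n
      using peakingD[OF S \<phi> _ A_compose[OF g(1) b], of c] eq by (simp add: blinfun_compose_assoc)
    then have "((\<lambda>n. normal_part \<phi> (S o\<^sub>L g n o\<^sub>L b)) \<longlongrightarrow> c * \<kappa> b) F"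
      using character_lim[OF b, of c] by simp
    moreover have "((\<lambda>n. normal_part \<phi> (S o\<^sub>L g n o\<^sub>L b)) \<longlongrightarrow> normal_part \<phi> (S o\<^sub>L R o\<^sub>L b)) F"
      by (rule normal_part_weak_limit[OF \<phi> Sb F(1) g(3) lim])
    ultimately show "normal_part \<phi> (S o\<^sub>L R o\<^sub>L b) = c * \<kappa> b" using tendsto_unique[OF F(1)] by blast
  qed
  ultimately show ?thesis using R(2) by blast
qed

lemma ex_peaking_projection: "\<exists>P. peaking P \<and> P o\<^sub>L P = P \<and> adj P = P"
proof -
  obtain R where R: "peaking R" "norm R \<le> 1" "\<And>S. peaking S \<Longrightarrow> peaking (S o\<^sub>L R)"
    using ex_peaking_contraction by auto
  have Rb: "R \<in> bounded_ops" using R(1) by (simp add: peaking_def)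
  have pow: "peaking (operator_power R (Suc i))" for i
  proof (induction i)
    case 0
    show ?case using R(1) by simp
  next
    case (Suc i)
    then have "peaking (operator_power R (Suc i) o\<^sub>L R)" by (rule R(3))
    then show ?case by (simp only: operator_power_commute operator_power_Suc[of R "Suc i"])
  qed
  define M where "M n = (1 / real (Suc n)) *\<^sub>R (\<Sum>i<Suc n. operator_power R (Suc i))" for n
  obtain F P where F: "F \<noteq> bot" and P: "P \<in> bounded_ops" "P o\<^sub>L P = P" "adj P = P"
    and M: "\<And>n. norm (M n) \<le> 1" "\<And>x y. ((\<lambda>n. cinner (M n x) y) \<longlongrightarrow> cinner (P x) y) F"
    using mean_ergodic_projection[OF Rb R(2)] unfolding M_def by blast
  have "peaking P"
    unfolding peaking_def
  proof (intro conjI P(1) allI ballI impI)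
    fix c \<phi> b assume \<phi>: "\<phi> \<in> op_dual T" and eq: "\<forall>b\<in>A. \<phi> b = c * \<kappa> b" and b: "b \<in> A"
    note \<omega> = right_translate_in_predual[OF \<phi>, of b]
    have "normal_part \<phi> ((\<Sum>i<m. operator_power R (Suc i)) o\<^sub>L b) = real m * (c * \<kappa> b)" for m
    proof (induction m)
      case 0
      show ?case using predual_zero[OF normal_part_predual[OF \<phi>]] by simp
    next
      case (Suc m)
      have "normal_part \<phi> (operator_power R (Suc m) o\<^sub>L b) = c * \<kappa> b"
        using peakingD[OF pow \<phi> _ b, of c] eq by simp
      then show ?case
        using Suc by (simp add: predual_add[OF normal_part_predual[OF \<phi>]] distrib_right del: operator_power_Suc)
    qed
    from this[of "Suc n" for n] have "normal_part \<phi> (M n o\<^sub>L b) = c * \<kappa> b" for n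
      by (simp add: M_def predual_scaleR[OF normal_part_predual[OF \<phi>]] scaleR_conv_of_real del: of_nat_Suc sum.lessThan_Suc)
    moreover have "((\<lambda>n. normal_part \<phi> (M n o\<^sub>L b)) \<longlongrightarrow> normal_part \<phi> (P o\<^sub>L b)) F"
      using normal_part_weak_limit[OF \<phi> id_in_bounded_ops F M, of b] by simp
    ultimately have "((\<lambda>n. c * \<kappa> b) \<longlongrightarrow> normal_part \<phi> (P o\<^sub>L b)) F" by (simp only:)
    then show "normal_part \<phi> (P o\<^sub>L b) = c * \<kappa> b"
      by (rule tendsto_unique[OF F _ tendsto_const])
  qed
  then show ?thesis using P by blast
qed

theorem ex_peak_projection:
  assumes inf_dim: "\<not> (\<exists>B :: 'h set. finite B \<and> span B = UNIV)"
  shows "\<exists>p\<in>op_bidual A. nontrivial_projection T (bidual_incl A T p) \<and>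
    bidual_le T (bidual_incl A T p) (normal_element T id_blinfun) \<and> p \<kappa> = 1"
proof -
  obtain P where P: "peaking P" "P o\<^sub>L P = P" "adj P = P"
    using ex_peaking_projection by auto
  have Pb: "P \<in> bounded_ops" using P(1) by (simp add: peaking_def)
  have ann: "normal_part \<phi> P = 0" if "\<phi> \<in> op_dual T" "\<And>a. a \<in> A \<Longrightarrow> \<phi> a = 0" for \<phi>
    using peakingD[OF P(1) that(1) _ A_id, of 0] that(2) by simp
  obtain p where p: "p \<in> op_bidual A" "bidual_incl A T p = normal_element T P"
    "\<And>\<phi>. \<phi> \<in> op_dual T \<Longrightarrow> p (restr A \<phi>) = normal_part \<phi> P"
    using normal_element_from_subspace[OF A_space AT Pb ann] by auto
  obtain \<psi> where \<psi>: "\<psi> \<in> op_dual T" "\<And>a. a \<in> A \<Longrightarrow> \<psi> a = \<kappa> a"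
    using hahn_banach_extension[OF A_space T_space AT \<kappa>] by auto
  have \<psi>P: "normal_part \<psi> P = 1"
    using peakingD[OF P(1) \<psi>(1) _ A_id, of 1] \<psi>(2) \<kappa>_id by simp
  have "restr A \<psi> = \<kappa>"
    using \<psi>(2) op_dual_outside[OF \<kappa>] by (auto simp: restr_def)
  then have "p \<kappa> = 1" using p(3)[OF \<psi>(1)] \<psi>P by simp
  moreover have "nontrivial_projection T (normal_element T P)"
    unfolding nontrivial_projection_def
  proof (intro conjI projection_normal_element Pb P(2,3) normal_element_not_one[OF inf_dim Pb])
    show "normal_element T P \<noteq> 0"
      using normal_element_apply[OF \<psi>(1), of P] \<psi>P by auto
  qed
  ultimately show ?thesis
    using p(1,2) bidual_le_normal_element[OF Pb P(2,3)] by (intro bexI[of _ p]) simp_all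
qed

end

theorem theorem2:
  fixes T A :: "('h::complex_hilbert \<Rightarrow>\<^sub>L 'h) set"
  assumes inf_dim: "\<not> (\<exists>B :: 'h set. finite B \<and> span B = UNIV)"
    and T: "unital_cstar_algebra T" "compact_ops \<subseteq> T"
    and A: "unital_subalgebra A" "A \<subseteq> T"
    and GW: "gleason_whitney A T"
  shows "\<exists>z. lebesgue_projection T z \<and> nontrivial_projection T z \<and>
    (\<forall>\<kappa>\<in>abs_cont A. character A \<kappa> \<longrightarrow>
      (\<exists>p\<in>op_bidual A. nontrivial_projection T (bidual_incl A T p) \<and>
        bidual_le T (bidual_incl A T p) z \<and> p \<kappa> = 1))"
proof -
  interpret operators_with_compacts T by unfold_locales (rule T)+
  obtain x :: 'h where x: "x \<noteq> 0"
  proof (rule ccontr)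
    assume "\<not> thesis"
    with that have "span {} = (UNIV :: 'h set)" by auto
    then show False using inf_dim by blast
  qed
  show ?thesis
  proof (intro exI[of _ "normal_element T id_blinfun"] conjI ballI impI)
    show leb: "lebesgue_projection T (normal_element T id_blinfun)"
      by (rule lebesgue_projection_normal_element)
    show "nontrivial_projection T (normal_element T id_blinfun)"
      using leb normal_element_id_nonzero[OF x] normal_element_not_one[OF inf_dim id_in_bounded_ops]
      by (simp add: nontrivial_projection_def lebesgue_projection_def)
    fix \<kappa> assume \<kappa>: "\<kappa> \<in> abs_cont A" "character A \<kappa>"
    interpret gleason_whitney_character T A \<kappa>
      by unfold_locales (use A GW \<kappa> in \<open>auto simp: abs_cont_def\<close>)
    show "\<exists>p\<in>op_bidual A. nontrivial_projection T (bidual_incl A T p) \<and>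
        bidual_le T (bidual_incl A T p) (normal_element T id_blinfun) \<and> p \<kappa> = 1"
      by (rule ex_peak_projection[OF inf_dim])
  qed
qed

end
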